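(* Let $(A,\mathfrak m)$ be a Noetherian local ring with infinite residue field and $\dim A>0$, and let $I$ be an $\mathfrak m$-primary ideal of $A$ such that $\operatorname{grade} I>0$. Suppose $I^{n_0}=\mathfrak m I^{n_0-1}$ for some positive integer $n_0$. Then $\operatorname{reg} F(I)=\operatorname{reg} G(I)$.
   Context: For an ideal $I$ of a local ring $(A,\mathfrak m)$: the associated graded ring is $G(I)=\bigoplus_{n\ge 0}I^n/I^{n+1}$ and the fiber cone is $F(I)=\bigoplus_{n\ge0}I^n/\mathfrak m I^n$; $I^0=A$. Castelnuovo-Mumford regularity: let $S=\bigoplus_{n\ge0}S_n$ be a standard graded algebra over a commutative Noetherian ring $S_0$, with $S_+=\bigoplus_{n\geq 1}S_n$, and let $M$ be a finitely generated graded $S$-module. Put $a_i(M)=\max\{n : [H^i_{S_+}(M)]_n\ne 0\}$ (with value $-\infty$ if $H^i_{S_+}(M)=0$), and $\operatorname{reg}(M)=\max\{a_i(M)+i : i\ge 0\}$. *)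

theory Defs
  imports "HOL-Algebra.Algebra" "HOL-Library.Extended_Nat" "HOL-Library.Extended_Real"
begin

section \<open>Local rings, dimension, grade\<close>

definition local_ring :: "('a, 'b) ring_scheme \<Rightarrow> 'a set \<Rightarrow> bool" where
  "local_ring R M \<longleftrightarrow> cring R \<and> maximalideal M R \<and> (\<forall>J. maximalideal J R \<longrightarrow> J = M)"

definition krull_dim :: "('a, 'b) ring_scheme \<Rightarrow> enat" where
  "krull_dim R = Sup {enat n | n.
     \<exists>P :: nat \<Rightarrow> 'a set. (\<forall>i\<le>n. primeideal (P i) R) \<and> (\<forall>i<n. P i \<subset> P (Suc i))}"

definition radical_of :: "('a, 'b) ring_scheme \<Rightarrow> 'a set \<Rightarrow> 'a set" where
  "radical_of R I = {a \<in> carrier R. \<exists>n::nat. n > 0 \<and> a [^]\<^bsub>R\<^esub> n \<in> I}"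

definition primary_ideal :: "('a, 'b) ring_scheme \<Rightarrow> 'a set \<Rightarrow> bool" where
  "primary_ideal R I \<longleftrightarrow> ideal I R \<and> I \<noteq> carrier R \<and>
     (\<forall>a\<in>carrier R. \<forall>b\<in>carrier R. a \<otimes>\<^bsub>R\<^esub> b \<in> I \<longrightarrow> a \<in> I \<or> b \<in> radical_of R I)"

definition primary_to :: "('a, 'b) ring_scheme \<Rightarrow> 'a set \<Rightarrow> 'a set \<Rightarrow> bool" where
  "primary_to R P I \<longleftrightarrow> primary_ideal R I \<and> radical_of R I = P"

definition regular_sequence :: "('a, 'b) ring_scheme \<Rightarrow> 'a list \<Rightarrow> bool" where
  "regular_sequence R xs \<longleftrightarrow> set xs \<subseteq> carrier R \<and> genideal R (set xs) \<noteq> carrier R \<and>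
     (\<forall>i<length xs. \<forall>a\<in>carrier R.
        xs ! i \<otimes>\<^bsub>R\<^esub> a \<in> genideal R (set (take i xs)) \<longrightarrow> a \<in> genideal R (set (take i xs)))"

definition grade :: "('a, 'b) ring_scheme \<Rightarrow> 'a set \<Rightarrow> enat" where
  "grade R I = Sup {enat (length xs) | xs. regular_sequence R xs \<and> set xs \<subseteq> I}"

text \<open>Powers are taken in the monoid of ideals, whose unit is the whole ring.\<close>

abbreviation ideal_pow :: "('a, 'b) ring_scheme \<Rightarrow> 'a set \<Rightarrow> nat \<Rightarrow> 'a set" where
  "ideal_pow R I n \<equiv> I [^]\<^bsub>ideals_set R\<^esub> n"


section \<open>Graded rings and modules; the associated graded ring and the fiber cone\<close>

record 'a graded_ring = "'a ring" +
  hcomp :: "nat \<Rightarrow> 'a set"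

record ('a, 'b) graded_module = "('a, 'b) module" +
  mcomp :: "int \<Rightarrow> 'b set"

text \<open>
  The direct sum of the quotients \<open>P n / Q n\<close>, where the ideals satisfy \<open>Q n \<subseteq> P n\<close>,
  \<open>P i \<cdot> P j \<subseteq> P (i + j)\<close> and \<open>P i \<cdot> Q j \<subseteq> Q (i + j)\<close>. An element is a finitely supported
  family of cosets. By the last condition the set \<open>rcoset_mult R (Q n) (f i) (g (n - i))\<close> is a single
  coset of \<open>Q n\<close>, although \<open>f i\<close> and \<open>g (n - i)\<close> are cosets of \<open>Q i\<close> and \<open>Q (n - i)\<close>.
\<close>

definition graded_quotient_carrier ::
    "('a, 'b) ring_scheme \<Rightarrow> (nat \<Rightarrow> 'a set) \<Rightarrow> (nat \<Rightarrow> 'a set) \<Rightarrow> (nat \<Rightarrow> 'a set) set" where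
  "graded_quotient_carrier R P Q =
     {f. (\<forall>n. \<exists>a\<in>P n. f n = Q n +>\<^bsub>R\<^esub> a) \<and> finite {n. f n \<noteq> Q n}}"

definition graded_quotient ::
    "('a, 'b) ring_scheme \<Rightarrow> (nat \<Rightarrow> 'a set) \<Rightarrow> (nat \<Rightarrow> 'a set) \<Rightarrow> (nat \<Rightarrow> 'a set) graded_ring"
where
  "graded_quotient R P Q =
    \<lparr> carrier = graded_quotient_carrier R P Q,
      monoid.mult = (\<lambda>f g n. \<Oplus>\<^bsub>R Quot Q n\<^esub> i\<in>{..n}. rcoset_mult R (Q n) (f i) (g (n - i))),
      monoid.one = (\<lambda>n. if n = 0 then Q 0 +>\<^bsub>R\<^esub> \<one>\<^bsub>R\<^esub> else Q n),
      ring.zero = Q,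
      ring.add = (\<lambda>f g n. f n <+>\<^bsub>R\<^esub> g n),
      hcomp = (\<lambda>n. {f \<in> graded_quotient_carrier R P Q. \<forall>k. k \<noteq> n \<longrightarrow> f k = Q k}) \<rparr>"

definition assoc_graded_ring ::
    "('a, 'b) ring_scheme \<Rightarrow> 'a set \<Rightarrow> (nat \<Rightarrow> 'a set) graded_ring" where
  "assoc_graded_ring R I = graded_quotient R (ideal_pow R I) (\<lambda>n. ideal_pow R I (Suc n))"

definition fiber_cone ::
    "('a, 'b) ring_scheme \<Rightarrow> 'a set \<Rightarrow> 'a set \<Rightarrow> (nat \<Rightarrow> 'a set) graded_ring" where
  "fiber_cone R M I = graded_quotient R (ideal_pow R I) (\<lambda>n. M \<cdot>\<^bsub>R\<^esub> ideal_pow R I n)"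

definition self_module :: "('a, 'b) graded_ring_scheme \<Rightarrow> ('a, 'a) graded_module" where
  "self_module S =
    \<lparr> carrier = carrier S, monoid.mult = monoid.mult S, monoid.one = monoid.one S,
      ring.zero = ring.zero S, ring.add = ring.add S,
      smult = monoid.mult S,
      mcomp = (\<lambda>n. if n \<ge> 0 then hcomp S (nat n) else {\<zero>\<^bsub>S\<^esub>}) \<rparr>"

definition irrelevant_ideal :: "('a, 'b) graded_ring_scheme \<Rightarrow> 'a set" where
  "irrelevant_ideal S =
     {\<Oplus>\<^bsub>S\<^esub> n\<in>{1..N}. f n | f N. \<forall>n\<in>{1..N::nat}. f n \<in> hcomp S n}"


section \<open>Homogeneous localization\<close>

text \<open>The class of the fraction \<open>m / f\<^sup>k\<close>.\<close>

definition frac_class ::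
    "('s, 'x) ring_scheme \<Rightarrow> ('s, 'm, 'y) module_scheme \<Rightarrow> 's \<Rightarrow> 'm \<Rightarrow> nat \<Rightarrow> ('m \<times> nat) set" where
  "frac_class S M f m k = {(m', k'). m' \<in> carrier M \<and>
     (\<exists>t::nat. (f [^]\<^bsub>S\<^esub> (t + k')) \<odot>\<^bsub>M\<^esub> m = (f [^]\<^bsub>S\<^esub> (t + k)) \<odot>\<^bsub>M\<^esub> m')}"

text \<open>
  The localization of \<open>M\<close> at the powers of \<open>f\<close>, a homogeneous element of degree \<open>d\<close>.
  The unions range over all representatives and are single classes. The multiplicative fields
  of the module record carry no meaning.
\<close>

definition localization ::
    "('s, 'x) ring_scheme \<Rightarrow> ('s, 'm, 'y) graded_module_scheme \<Rightarrow> 's \<Rightarrow> nat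
      \<Rightarrow> ('s, ('m \<times> nat) set) graded_module" where
  "localization S M f d =
    \<lparr> carrier = {frac_class S M f m k | m k. m \<in> carrier M},
      monoid.mult = undefined, monoid.one = undefined,
      ring.zero = frac_class S M f \<zero>\<^bsub>M\<^esub> 0,
      ring.add = (\<lambda>C D. \<Union>(m, k)\<in>C. \<Union>(m', k')\<in>D.
        frac_class S M f
          (((f [^]\<^bsub>S\<^esub> k') \<odot>\<^bsub>M\<^esub> m) \<oplus>\<^bsub>M\<^esub> ((f [^]\<^bsub>S\<^esub> k) \<odot>\<^bsub>M\<^esub> m')) (k + k')),
      smult = (\<lambda>s C. \<Union>(m, k)\<in>C. frac_class S M f (s \<odot>\<^bsub>M\<^esub> m) k),
      mcomp = (\<lambda>n. {frac_class S M f m k | m k. m \<in> mcomp M (n + int k * int d)}) \<rparr>"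


section \<open>Local cohomology with support in the irrelevant ideal\<close>

text \<open>
  Local cohomology is computed by the Cech complex of a finite sequence of degree-one elements
  generating \<open>S\<^sub>+\<close>, which exists when \<open>S\<close> is a standard graded algebra over a
  Noetherian ring. In cohomological degree \<open>p\<close> and internal degree \<open>n\<close> the complex is the product,
  over the \<open>p\<close>-element sets \<open>s\<close> of indices, of the degree-\<open>n\<close> parts of the localizations of \<open>M\<close>
  at the product of the \<open>xs ! i\<close>, \<open>i \<in> s\<close>; for \<open>p = 0\<close> this is the degree-\<open>n\<close> part of \<open>M\<close>.
\<close>

definition cech_loc ::
    "('s, 'x) ring_scheme \<Rightarrow> ('s, 'm, 'y) graded_module_scheme \<Rightarrow> 's list \<Rightarrow> nat set
      \<Rightarrow> ('s, ('m \<times> nat) set) graded_module" where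
  "cech_loc S M xs s = localization S M (\<Otimes>\<^bsub>S\<^esub> i\<in>s. xs ! i) (card s)"

definition cech_indices :: "'s list \<Rightarrow> nat \<Rightarrow> nat set set" where
  "cech_indices xs p = {s. s \<subseteq> {..<length xs} \<and> card s = p}"

definition cech_cochains ::
    "('s, 'x) ring_scheme \<Rightarrow> ('s, 'm, 'y) graded_module_scheme \<Rightarrow> 's list \<Rightarrow> nat \<Rightarrow> int
      \<Rightarrow> (nat set \<Rightarrow> ('m \<times> nat) set) monoid" where
  "cech_cochains S M xs p n =
     product_group (cech_indices xs p)
       (\<lambda>s. (add_monoid (cech_loc S M xs s)) \<lparr> carrier := mcomp (cech_loc S M xs s) n \<rparr>)"

text \<open>
  The canonical map from the localization indexed by \<open>s - {j}\<close> to the one indexed by \<open>s\<close>, where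
  \<open>j \<in> s\<close>: a fraction \<open>m / f\<^sup>k\<close> becomes \<open>x\<^sub>j\<^sup>k m / (x\<^sub>j f)\<^sup>k\<close>.
\<close>

definition cech_res ::
    "('s, 'x) ring_scheme \<Rightarrow> ('s, 'm, 'y) graded_module_scheme \<Rightarrow> 's list \<Rightarrow> nat \<Rightarrow> nat set
      \<Rightarrow> ('m \<times> nat) set \<Rightarrow> ('m \<times> nat) set" where
  "cech_res S M xs j s C =
     (\<Union>(m, k)\<in>C. frac_class S M (\<Otimes>\<^bsub>S\<^esub> i\<in>s. xs ! i) (((xs ! j) [^]\<^bsub>S\<^esub> k) \<odot>\<^bsub>M\<^esub> m) k)"

definition cech_diff ::
    "('s, 'x) ring_scheme \<Rightarrow> ('s, 'm, 'y) graded_module_scheme \<Rightarrow> 's list \<Rightarrow> nat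
      \<Rightarrow> (nat set \<Rightarrow> ('m \<times> nat) set) \<Rightarrow> (nat set \<Rightarrow> ('m \<times> nat) set)" where
  "cech_diff S M xs p c =
     (\<lambda>s\<in>cech_indices xs (Suc p).
        \<Oplus>\<^bsub>cech_loc S M xs s\<^esub> j\<in>s.
          (let y = cech_res S M xs j s (c (s - {j}))
           in if even (card {i\<in>s. i < j}) then y else \<ominus>\<^bsub>cech_loc S M xs s\<^esub> y))"

definition cech_cocycles ::
    "('s, 'x) ring_scheme \<Rightarrow> ('s, 'm, 'y) graded_module_scheme \<Rightarrow> 's list \<Rightarrow> nat \<Rightarrow> int
      \<Rightarrow> (nat set \<Rightarrow> ('m \<times> nat) set) set" where
  "cech_cocycles S M xs p n =
     kernel (cech_cochains S M xs p n) (cech_cochains S M xs (Suc p) n) (cech_diff S M xs p)"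

definition cech_coboundaries ::
    "('s, 'x) ring_scheme \<Rightarrow> ('s, 'm, 'y) graded_module_scheme \<Rightarrow> 's list \<Rightarrow> nat \<Rightarrow> int
      \<Rightarrow> (nat set \<Rightarrow> ('m \<times> nat) set) set" where
  "cech_coboundaries S M xs p n =
     (case p of 0 \<Rightarrow> {\<one>\<^bsub>cech_cochains S M xs 0 n\<^esub>}
      | Suc q \<Rightarrow> cech_diff S M xs q ` carrier (cech_cochains S M xs q n))"

definition cech_cohomology ::
    "('s, 'x) ring_scheme \<Rightarrow> ('s, 'm, 'y) graded_module_scheme \<Rightarrow> 's list \<Rightarrow> nat \<Rightarrow> int
      \<Rightarrow> (nat set \<Rightarrow> ('m \<times> nat) set) set monoid" where
  "cech_cohomology S M xs p n =
     (cech_cochains S M xs p n) \<lparr> carrier := cech_cocycles S M xs p n \<rparr>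
       Mod cech_coboundaries S M xs p n"

definition generates_irrelevant :: "('s, 'x) graded_ring_scheme \<Rightarrow> 's list \<Rightarrow> bool" where
  "generates_irrelevant S xs \<longleftrightarrow>
     set xs \<subseteq> hcomp S 1 \<and> genideal S (set xs) = irrelevant_ideal S"

text \<open>Up to isomorphism the following group does not depend on the chosen generators.\<close>

definition local_cohomology ::
    "('s, 'x) graded_ring_scheme \<Rightarrow> ('s, 'm, 'y) graded_module_scheme \<Rightarrow> nat \<Rightarrow> int
      \<Rightarrow> (nat set \<Rightarrow> ('m \<times> nat) set) set monoid" where
  "local_cohomology S M i n =
     cech_cohomology S M (SOME xs. generates_irrelevant S xs) i n"


section \<open>Castelnuovo-Mumford regularity\<close>

text \<open>
  For a finitely generated graded module over a standard graded algebra both suprema are maxima,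
  the supremum of the empty set being \<open>- \<infinity>\<close>.
\<close>

definition a_invariant ::
    "('s, 'x) graded_ring_scheme \<Rightarrow> ('s, 'm, 'y) graded_module_scheme \<Rightarrow> nat \<Rightarrow> ereal" where
  "a_invariant S M i =
     Sup {ereal (real_of_int n) | n :: int.
            carrier (local_cohomology S M i n) \<noteq> {\<one>\<^bsub>local_cohomology S M i n\<^esub>}}"

definition regularity ::
    "('s, 'x) graded_ring_scheme \<Rightarrow> ('s, 'm, 'y) graded_module_scheme \<Rightarrow> ereal" where
  "regularity S M = (SUP i. a_invariant S M i + ereal (real i))"

end

theory Submission
  imports Defs
begin

text \<open>
  The kernel of \<open>G(I) \<rightarrow> F(I)\<close> is the sum of the quotients \<open>\<mm>I\<^sup>n/I\<^sup>n\<^sup>+\<^sup>1\<close>, which vanish for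
  \<open>n \<ge> n0 - 1\<close>. After inverting an element of degree one the two rings agree, so their local
  cohomology modules coincide in cohomological degrees \<open>p \<ge> 1\<close>, and \<open>H\<^sup>0(F(I))\<close> is a quotient of
  \<open>H\<^sup>0(G(I))\<close> that is isomorphic to it in degrees \<open>n \<ge> n0 - 1\<close>. Hence \<open>reg F(I) \<le> reg G(I)\<close>, and the
  converse follows from \<open>a\<^sub>0(G(I)) < a\<^sub>1(G(I))\<close>. For this last inequality let \<open>a \<in> I\<^sup>n - I\<^sup>n\<^sup>+\<^sup>1\<close> represent
  a class in \<open>H\<^sup>0\<close>. If \<open>H\<^sup>1\<close> vanishes in all degrees above \<open>n\<close>, then \<open>a\<close> can be changed modulo \<open>I\<^sup>n\<^sup>+\<^sup>1\<close>
  to lie in the Ratliff--Rush closure of any power \<open>I\<^sup>r\<close>. Since \<open>I\<close> contains a regular element, this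
  closure is \<open>I\<^sup>r\<close> for large \<open>r\<close>, so \<open>a \<in> I\<^sup>n\<^sup>+\<^sup>1\<close>, a contradiction.

  As \<open>F(I)\<close> and \<open>G(I)\<close> come with unrelated generators of their irrelevant ideals, the comparison needs
  that the vanishing of Cech cohomology does not depend on the generators.
\<close>


section \<open>Koszul cochains\<close>


text \<open>Regularity only records the bidegrees in which Cech cohomology is nonzero, so vanishing
  statements are compared and no maps between cohomology groups are constructed. Once all fractions
  of a cochain have one exponent N, vanishing concerns numerators only, and N may be raised freely.
  Raising it by T moves the numerator over a p-element set from degree \<open>n + N p\<close> to
  \<open>n + (N + T) p\<close>. For p \<ge> 1 this reaches the degrees in which both rings have the
  same components, whatever n is; for p = 0 the degree stays n. This is why \<open>H^0\<close> is
  the obstacle and needs an argument of its own.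

  The inequality for \<open>H^0\<close> is used in contraposition, so that no a-invariant has to be
  known to be finite. If reg F(I) < n, all cohomology of F(I) vanishes from degree n on. Hence
  \<open>H^1\<close> of G(I) vanishes above n, and \<open>H^0\<close> of G(I) vanishes in all large
  degrees. The first fact allows corrections of a class in degree n, the second bounds how far
  Ratliff--Rush closures can differ from powers of I, and together they kill \<open>H^0\<close> of
  G(I) in degree n.\<close>

definition ksign :: "('a, 'b) ring_scheme \<Rightarrow> nat \<Rightarrow> nat set \<Rightarrow> 'a" where
  "ksign R j s = (if even (card {i \<in> s. i < j}) then \<one>\<^bsub>R\<^esub> else \<ominus>\<^bsub>R\<^esub> \<one>\<^bsub>R\<^esub>)"

definition kdiff ::
    "('a, 'b) ring_scheme \<Rightarrow> (nat \<Rightarrow> 'a) \<Rightarrow> nat \<Rightarrow> (nat set \<Rightarrow> 'a) \<Rightarrow> nat set \<Rightarrow> 'a" where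
  "kdiff R x N c s =
     (\<Oplus>\<^bsub>R\<^esub> j\<in>s. ksign R j s \<otimes>\<^bsub>R\<^esub> (x j [^]\<^bsub>R\<^esub> N \<otimes>\<^bsub>R\<^esub> c (s - {j})))"

lemma funcset_PowD: "c \<in> Pow U \<rightarrow> A \<Longrightarrow> s \<subseteq> U \<Longrightarrow> c s \<in> A"
  by auto

context cring
begin

lemma ideal_memI:
  assumes "J \<subseteq> carrier R" "\<zero> \<in> J"
    and "\<And>a b. a \<in> J \<Longrightarrow> b \<in> J \<Longrightarrow> a \<oplus> b \<in> J"
    and "\<And>a r. a \<in> J \<Longrightarrow> r \<in> carrier R \<Longrightarrow> r \<otimes> a \<in> J"
  shows "ideal J R"
proof (rule idealI)
  have inv: "\<ominus> a \<in> J" if "a \<in> J" for a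
    using assms(4) [OF that, of "\<ominus> \<one>"] assms(1) that by (auto simp: l_minus)
  show "subgroup J (add_monoid R)"
    by (rule add.subgroupI) (use assms inv in \<open>auto simp: a_inv_def\<close>)
  show "a \<otimes> r \<in> J" if "a \<in> J" "r \<in> carrier R" for a r
    using assms(1) assms(4) [OF that] that by (auto simp: m_comm)
qed (use assms ring_axioms in auto)

lemma ksign_closed [simp, intro]: "ksign R j s \<in> carrier R"
  by (simp add: ksign_def)

lemma ksign_square [simp]: "ksign R j s \<otimes> ksign R j s = \<one>"
  by (auto simp: ksign_def l_minus)

text \<open>Passing from \<open>t\<close> to \<open>insert u t\<close> changes the sign of
  \<open>j\<close> iff \<open>u < j\<close>, and removing \<open>j\<close> changes the sign of
  \<open>u\<close> iff \<open>j < u\<close>. Exactly one of the two holds, whence the minus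
  sign.\<close>

lemma ksign_insert:
  assumes "finite t" "j \<in> t" "u \<notin> t"
  shows "ksign R j (insert u t) =
    \<ominus> (ksign R u (insert u t) \<otimes> (ksign R j t \<otimes> ksign R u (insert u (t - {j}))))"
proof -
  let ?a = "card {i \<in> t. i < j}" and ?b = "card {i \<in> t. i < u}"
  have uj: "u \<noteq> j" using assms by auto
  have 1: "card {i \<in> insert u t. i < j} = ?a + (if u < j then 1 else 0)"
  proof (cases "u < j")
    case True
    then have "{i \<in> insert u t. i < j} = insert u {i \<in> t. i < j}" by auto
    then show ?thesis using True assms by simp
  next
    case False
    then have "{i \<in> insert u t. i < j} = {i \<in> t. i < j}" by auto
    then show ?thesis using False by simp
  qed
  have 2: "{i \<in> insert u t. i < u} = {i \<in> t. i < u}" by auto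
  have 3: "card {i \<in> insert u (t - {j}). i < u} + (if j < u then 1 else 0) = ?b"
  proof (cases "j < u")
    case True
    then have "{i \<in> t. i < u} = insert j {i \<in> insert u (t - {j}). i < u}" using assms by auto
    then show ?thesis using True assms by simp
  next
    case False
    then have "{i \<in> insert u (t - {j}). i < u} = {i \<in> t. i < u}" by auto
    then show ?thesis using False by simp
  qed
  have 4: "even ?b \<longleftrightarrow> (even (card {i \<in> insert u (t - {j}). i < u}) \<longleftrightarrow> \<not> j < u)"
    by (subst 3 [symmetric]) auto
  have 5: "u < j \<longleftrightarrow> \<not> j < u" using uj by auto
  show ?thesis
    unfolding ksign_def 1 2 by (auto simp: 4 5 l_minus r_minus)
qed

lemma finsum_closed': "(\<And>i. i \<in> s \<Longrightarrow> f i \<in> carrier R) \<Longrightarrow> (\<Oplus>i\<in>s. f i) \<in> carrier R"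
  by (rule finsum_closed) auto

lemma kdiff_closed:
  assumes "s \<subseteq> U" "x \<in> U \<rightarrow> carrier R" "c \<in> Pow U \<rightarrow> carrier R"
  shows "kdiff R x N c s \<in> carrier R"
  unfolding kdiff_def
proof (rule finsum_closed')
  fix j assume "j \<in> s"
  then have "x j \<in> carrier R" "c (s - {j}) \<in> carrier R" using assms by auto
  then show "ksign R j s \<otimes> (x j [^] N \<otimes> c (s - {j})) \<in> carrier R" by simp
qed

lemma kdiff_empty [simp]: "kdiff R x N c {} = \<zero>"
  by (simp add: kdiff_def)

lemma finsum_cong_strong:
  assumes "\<And>i. i \<in> s \<Longrightarrow> f i = g i" "\<And>i. i \<in> s \<Longrightarrow> g i \<in> carrier R"
  shows "(\<Oplus>i\<in>s. f i) = (\<Oplus>i\<in>s. g i)"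
  by (rule finsum_cong') (use assms in auto)

lemma kdiff_cong:
  assumes "s \<subseteq> U" "x \<in> U \<rightarrow> carrier R" "c \<in> Pow U \<rightarrow> carrier R"
    and "\<And>j. j \<in> s \<Longrightarrow> c' (s - {j}) = c (s - {j})"
  shows "kdiff R x N c' s = kdiff R x N c s"
  unfolding kdiff_def
proof (rule finsum_cong_strong)
  fix j assume j: "j \<in> s"
  then have "x j \<in> carrier R" "c (s - {j}) \<in> carrier R" using assms by auto
  then show "ksign R j s \<otimes> (x j [^] N \<otimes> c (s - {j})) \<in> carrier R" by simp
  show "ksign R j s \<otimes> (x j [^] N \<otimes> c' (s - {j})) = ksign R j s \<otimes> (x j [^] N \<otimes> c (s - {j}))"
    using assms(4) [OF j] by simp
qed

lemma kdiff_add: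
  assumes "s \<subseteq> U" "x \<in> U \<rightarrow> carrier R" "c \<in> Pow U \<rightarrow> carrier R" "d \<in> Pow U \<rightarrow> carrier R"
  shows "kdiff R x N (\<lambda>t. c t \<oplus> d t) s = kdiff R x N c s \<oplus> kdiff R x N d s"
proof -
  have cl: "x j \<in> carrier R" "c (s - {j}) \<in> carrier R" "d (s - {j}) \<in> carrier R" if "j \<in> s" for j
    using assms that by auto
  have "kdiff R x N (\<lambda>t. c t \<oplus> d t) s =
    (\<Oplus>j\<in>s. ksign R j s \<otimes> (x j [^] N \<otimes> c (s - {j})) \<oplus> ksign R j s \<otimes> (x j [^] N \<otimes> d (s - {j})))"
    unfolding kdiff_def by (rule finsum_cong_strong) (use cl in \<open>simp_all add: r_distr\<close>)
  also have "\<dots> = kdiff R x N c s \<oplus> kdiff R x N d s"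
    unfolding kdiff_def by (rule finsum_addf) (use cl in \<open>auto\<close>)
  finally show ?thesis .
qed

lemma kdiff_scale:
  assumes "finite s" "s \<subseteq> U" "x \<in> U \<rightarrow> carrier R" "c \<in> Pow U \<rightarrow> carrier R" "r \<in> carrier R"
  shows "kdiff R x N (\<lambda>t. r \<otimes> c t) s = r \<otimes> kdiff R x N c s"
proof -
  have cl: "x j \<in> carrier R" "c (s - {j}) \<in> carrier R" if "j \<in> s" for j
    using assms that by auto
  have "r \<otimes> kdiff R x N c s = (\<Oplus>j\<in>s. r \<otimes> (ksign R j s \<otimes> (x j [^] N \<otimes> c (s - {j}))))"
    unfolding kdiff_def by (rule finsum_rdistr) (use assms cl in auto)
  also have "\<dots> = kdiff R x N (\<lambda>t. r \<otimes> c t) s"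
    unfolding kdiff_def
    by (rule finsum_cong_strong) (use cl assms in \<open>simp_all add: m_ac\<close>)
  finally show ?thesis by simp
qed

text \<open>Splitting cochains according to whether the index set contains \<open>u\<close> presents
  the complex as the cone of multiplication by \<open>x u [^] N\<close>. The factor
  \<open>ksign R u (insert u s)\<close> identifies the part over sets containing \<open>u\<close>
  with a cochain over sets avoiding it; the minus sign comes from
  \<open>ksign_insert\<close>.\<close>

lemma kdiff_insert:
  assumes "finite t" "u \<notin> t" "insert u t \<subseteq> U" "x \<in> U \<rightarrow> carrier R" "c \<in> Pow U \<rightarrow> carrier R"
  shows "kdiff R x N c (insert u t) = ksign R u (insert u t) \<otimes>
    (x u [^] N \<otimes> c t \<ominus> kdiff R x N (\<lambda>s. ksign R u (insert u s) \<otimes> c (insert u s)) t)"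
proof -
  have xj: "x j \<in> carrier R" if "j \<in> insert u t" for j
    using assms that by auto
  have cc: "c s \<in> carrier R" if "s \<subseteq> U" for s using assms that by auto
  have cu: "c (insert u (t - {j})) \<in> carrier R" "c t \<in> carrier R" for j
    by (rule cc; use assms in auto)+
  let ?e = "ksign R u (insert u t)"
  let ?f = "\<lambda>s. ksign R u (insert u s) \<otimes> c (insert u s)"
  let ?g = "\<lambda>j. ksign R j t \<otimes> (x j [^] N \<otimes> ?f (t - {j}))"
  have kf: "kdiff R x N ?f t \<in> carrier R"
    unfolding kdiff_def by (rule finsum_closed') (use cu xj in simp)
  have "kdiff R x N c (insert u t) =
    (\<Oplus>j\<in>insert u t. ksign R j (insert u t) \<otimes> (x j [^] N \<otimes> c (insert u t - {j})))"
    by (simp add: kdiff_def)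
  also have "\<dots> = (\<Oplus>j\<in>insert u t. if j = u then ?e \<otimes> (x u [^] N \<otimes> c t) else (\<ominus> ?e) \<otimes> ?g j)"
  proof (rule finsum_cong_strong)
    fix j assume j: "j \<in> insert u t"
    show "ksign R j (insert u t) \<otimes> (x j [^] N \<otimes> c (insert u t - {j})) =
      (if j = u then ?e \<otimes> (x u [^] N \<otimes> c t) else (\<ominus> ?e) \<otimes> ?g j)"
    proof (cases "j = u")
      case True
      then show ?thesis using assms by simp
    next
      case False
      then have jt: "j \<in> t" and eq: "insert u t - {j} = insert u (t - {j})" using j by auto
      show ?thesis
        unfolding eq using False xj [OF j] cu(1) [of j] ksign_insert [OF assms(1) jt assms(2)]
        by (simp add: l_minus r_minus m_ac)
    qed
    show "(if j = u then ?e \<otimes> (x u [^] N \<otimes> c t) else (\<ominus> ?e) \<otimes> ?g j) \<in> carrier R"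
      using j xj cu by auto
  qed
  also have "\<dots> = ?e \<otimes> (x u [^] N \<otimes> c t) \<oplus>
      (\<Oplus>j\<in>t. if j = u then ?e \<otimes> (x u [^] N \<otimes> c t) else (\<ominus> ?e) \<otimes> ?g j)"
    by (subst finsum_insert) (use assms xj cu in auto)
  also have "(\<Oplus>j\<in>t. if j = u then ?e \<otimes> (x u [^] N \<otimes> c t) else (\<ominus> ?e) \<otimes> ?g j) =
      (\<Oplus>j\<in>t. (\<ominus> ?e) \<otimes> ?g j)"
    by (rule finsum_cong_strong) (use assms xj cu in auto)
  also have "\<dots> = (\<ominus> ?e) \<otimes> kdiff R x N ?f t"
    unfolding kdiff_def by (rule finsum_rdistr [symmetric]) (use assms xj cu in auto)
  finally show ?thesis
    using xj cu kf by (simp add: a_minus_def r_distr l_minus r_minus)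
qed

lemma kdiff_zero:
  assumes "s \<subseteq> U" "x \<in> U \<rightarrow> carrier R" "\<And>j. j \<in> s \<Longrightarrow> c (s - {j}) = \<zero>"
  shows "kdiff R x N c s = \<zero>"
proof -
  have "kdiff R x N c s = (\<Oplus>j\<in>s. \<zero>)"
    unfolding kdiff_def
  proof (rule finsum_cong_strong)
    fix j assume "j \<in> s"
    then have "x j \<in> carrier R" using assms by auto
    then show "ksign R j s \<otimes> (x j [^] N \<otimes> c (s - {j})) = \<zero>"
      using assms(3) [OF \<open>j \<in> s\<close>] by simp
  qed simp
  then show ?thesis by simp
qed

text \<open>For a cocycle \<open>c\<close> of degree \<open>p\<close> this is the annihilator of its
  class in the Koszul cohomology of the powers \<open>x i [^] N\<close>. Cochains have values on all
  subsets of \<open>U\<close>, but only those of size \<open>p\<close> are compared.\<close>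

definition cobounding :: "(nat \<Rightarrow> 'a) \<Rightarrow> nat set \<Rightarrow> nat \<Rightarrow> nat \<Rightarrow> (nat set \<Rightarrow> 'a) \<Rightarrow> 'a set" where
  "cobounding x U p N c = {r \<in> carrier R. \<exists>b \<in> Pow U \<rightarrow> carrier R.
     \<forall>s\<subseteq>U. card s = p \<longrightarrow> r \<otimes> c s = kdiff R x N b s}"

lemma cobounding_ideal:
  assumes "finite U" "x \<in> U \<rightarrow> carrier R" "c \<in> Pow U \<rightarrow> carrier R"
  shows "ideal (cobounding x U p N c) R"
proof (rule ideal_memI)
  have cc: "c s \<in> carrier R" if "s \<subseteq> U" for s using assms that by auto
  have fin: "finite s" if "s \<subseteq> U" for s using that assms(1) by (rule finite_subset)
  show "r \<otimes> a \<in> cobounding x U p N c"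
    if a: "a \<in> cobounding x U p N c" and r: "r \<in> carrier R" for a r
  proof -
    from a obtain b where b: "b \<in> Pow U \<rightarrow> carrier R" "a \<in> carrier R"
      "\<And>s. s \<subseteq> U \<Longrightarrow> card s = p \<Longrightarrow> a \<otimes> c s = kdiff R x N b s"
      by (auto simp: cobounding_def)
    have "\<forall>s\<subseteq>U. card s = p \<longrightarrow> r \<otimes> a \<otimes> c s = kdiff R x N (\<lambda>t. r \<otimes> b t) s"
    proof (intro allI impI)
      fix s assume s: "s \<subseteq> U" "card s = p"
      show "r \<otimes> a \<otimes> c s = kdiff R x N (\<lambda>t. r \<otimes> b t) s"
        using kdiff_scale [OF fin [OF s(1)] s(1) assms(2) b(1) r] b(2) b(3) [OF s] r cc [OF s(1)]
        by (simp add: m_assoc)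
    qed
    moreover have "(\<lambda>t. r \<otimes> b t) \<in> Pow U \<rightarrow> carrier R" using b r by auto
    ultimately show ?thesis using r b(2) by (auto simp: cobounding_def intro!: bexI [where x = "\<lambda>t. r \<otimes> b t"])
  qed
  show "a \<oplus> a' \<in> cobounding x U p N c"
    if a: "a \<in> cobounding x U p N c" "a' \<in> cobounding x U p N c" for a a'
  proof -
    from a obtain b b' where b: "b \<in> Pow U \<rightarrow> carrier R" "a \<in> carrier R"
      "\<And>s. s \<subseteq> U \<Longrightarrow> card s = p \<Longrightarrow> a \<otimes> c s = kdiff R x N b s"
      and b': "b' \<in> Pow U \<rightarrow> carrier R" "a' \<in> carrier R"
      "\<And>s. s \<subseteq> U \<Longrightarrow> card s = p \<Longrightarrow> a' \<otimes> c s = kdiff R x N b' s"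
      by (auto simp: cobounding_def)
    have "\<forall>s\<subseteq>U. card s = p \<longrightarrow> (a \<oplus> a') \<otimes> c s = kdiff R x N (\<lambda>t. b t \<oplus> b' t) s"
    proof (intro allI impI)
      fix s assume s: "s \<subseteq> U" "card s = p"
      show "(a \<oplus> a') \<otimes> c s = kdiff R x N (\<lambda>t. b t \<oplus> b' t) s"
        using kdiff_add [OF s(1) assms(2) b(1) b'(1)] b(2) b(3) [OF s] b'(2) b'(3) [OF s] cc [OF s(1)]
        by (simp add: l_distr)
    qed
    moreover have "(\<lambda>t. b t \<oplus> b' t) \<in> Pow U \<rightarrow> carrier R" using b b' by auto
    ultimately show ?thesis using b(2) b'(2)
      by (auto simp: cobounding_def intro!: bexI [where x = "\<lambda>t. b t \<oplus> b' t"])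
  qed
  show "cobounding x U p N c \<subseteq> carrier R" by (auto simp: cobounding_def)
  show "\<zero> \<in> cobounding x U p N c"
  proof -
    have "\<forall>s\<subseteq>U. card s = p \<longrightarrow> \<zero> \<otimes> c s = kdiff R x N (\<lambda>t. \<zero>) s"
      using cc kdiff_zero [OF _ assms(2), of _ "\<lambda>t. \<zero>"] by auto
    then show ?thesis by (auto simp: cobounding_def intro!: bexI [where x = "\<lambda>t. \<zero>"])
  qed
qed

text \<open>Inserting the index \<open>i\<close> is a null homotopy of the multiplication by \<open>x\<^sub>i\<^sup>N\<close>.\<close>

lemma power_mem_cobounding:
  assumes "finite U" "x \<in> U \<rightarrow> carrier R" "c \<in> Pow U \<rightarrow> carrier R"
    and cyc: "\<And>s. s \<subseteq> U \<Longrightarrow> card s = Suc p \<Longrightarrow> kdiff R x N c s = \<zero>"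
    and i: "i \<in> U"
  shows "x i [^] N \<in> cobounding x U p N c"
proof -
  define b where "b t = (if i \<in> t then \<zero> else ksign R i (insert i t) \<otimes> c (insert i t))" for t
  have cc: "c s \<in> carrier R" if "s \<subseteq> U" for s using assms that by auto
  have fin: "finite s" if "s \<subseteq> U" for s using that assms(1) by (rule finite_subset)
  have bc: "b \<in> Pow U \<rightarrow> carrier R"
    using i by (auto simp: b_def intro!: m_closed cc)
  have xi: "x i \<in> carrier R" using assms by auto
  have "x i [^] N \<otimes> c s = kdiff R x N b s" if s: "s \<subseteq> U" "card s = p" for s
  proof (cases "i \<in> s")
    \<comment> \<open>The contraction \<open>b\<close> vanishes on sets containing \<open>i\<close>,
      so only the term that removes \<open>i\<close> survives. The cocycle condition enters in the
      other case, at \<open>insert i s\<close>.\<close>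
    case True
    define t where "t = s - {i}"
    have t: "s = insert i t" "i \<notin> t" "t \<subseteq> U" "finite t" using True s fin by (auto simp: t_def)
    have "kdiff R x N (\<lambda>s. ksign R i (insert i s) \<otimes> b (insert i s)) t = \<zero>"
      by (rule kdiff_zero [OF t(3) assms(2)]) (simp add: b_def)
    then have "kdiff R x N b s = ksign R i s \<otimes> (x i [^] N \<otimes> (ksign R i s \<otimes> c s) \<ominus> \<zero>)"
      using kdiff_insert [OF t(4) t(2) _ assms(2) bc] s t by (simp add: b_def)
    also have "\<dots> = (ksign R i s \<otimes> ksign R i s) \<otimes> (x i [^] N \<otimes> c s)"
      using xi cc [OF s(1)] by (simp add: a_minus_def m_ac del: ksign_square)
    finally show ?thesis using xi cc [OF s(1)] by simp
  next
    case False
    let ?f = "\<lambda>s. ksign R i (insert i s) \<otimes> c (insert i s)"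
    have s': "insert i s \<subseteq> U" "card (insert i s) = Suc p"
      using False s fin i by auto
    have fc: "?f \<in> Pow U \<rightarrow> carrier R" using i by (auto intro!: m_closed cc)
    have kc: "kdiff R x N ?f s \<in> carrier R"
      by (rule kdiff_closed [OF s(1) assms(2) fc])
    have "ksign R i (insert i s) \<otimes> (x i [^] N \<otimes> c s \<ominus> kdiff R x N ?f s) = \<zero>"
      using kdiff_insert [OF fin [OF s(1)] False s'(1) assms(2,3), of N] cyc [OF s'] by simp
    then have "ksign R i (insert i s) \<otimes> (ksign R i (insert i s) \<otimes> (x i [^] N \<otimes> c s \<ominus> kdiff R x N ?f s)) = \<zero>"
      by simp
    then have "x i [^] N \<otimes> c s \<ominus> kdiff R x N ?f s = \<zero>"
      using xi cc [OF s(1)] kc by (simp add: m_assoc [symmetric])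
    then have "x i [^] N \<otimes> c s = kdiff R x N ?f s"
      using xi cc [OF s(1)] kc by (simp add: r_right_minus_eq)
    also have "\<dots> = kdiff R x N b s"
      by (rule kdiff_cong [symmetric, OF s(1) assms(2) fc]) (use False in \<open>auto simp: b_def\<close>)
    finally show ?thesis .
  qed
  then show ?thesis using bc xi by (auto simp: cobounding_def)
qed

text \<open>One factor \<open>a \<oplus> b\<close> is split off and its summand is absorbed into
  \<open>r\<close>, which lowers \<open>m\<close> or \<open>n\<close>; this replaces a binomial
  expansion.\<close>

lemma power_add_mem_ideal:
  assumes "ideal J R" "a \<in> carrier R" "b \<in> carrier R" "r \<in> carrier R"
    and "r \<otimes> a [^] m \<in> J" "r \<otimes> b [^] n \<in> J"
  shows "r \<otimes> (a \<oplus> b) [^] (m + n :: nat) \<in> J"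
  using assms(4-)
proof (induction "m + n" arbitrary: m n r)
  case 0
  then show ?case by simp
next
  case (Suc k)
  interpret J: ideal J R by fact
  show ?case
  proof (cases "m = 0 \<or> n = 0")
    case True
    then have "r \<in> J" using Suc(3-5) by auto
    then show ?thesis using assms(2,3) by (intro J.I_r_closed) auto
  next
    case False
    then obtain m' n' where mn: "m = Suc m'" "n = Suc n'"
      by (metis not0_implies_Suc)
    have 1: "(r \<otimes> a) \<otimes> (a \<oplus> b) [^] (m' + n) \<in> J"
    proof (rule Suc(1))
      show "r \<otimes> a \<otimes> a [^] m' \<in> J" using Suc(3-) assms(2,3) mn by (simp add: m_ac)
      have "a \<otimes> (r \<otimes> b [^] n) \<in> J" by (rule J.I_l_closed) (use Suc(3-) assms(2,3) in auto)
      then show "r \<otimes> a \<otimes> b [^] n \<in> J" using Suc(3-) assms(2,3) by (simp add: m_ac)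
    qed (use Suc(2,3) assms(2,3) mn in auto)
    have 2: "(r \<otimes> b) \<otimes> (a \<oplus> b) [^] (m + n') \<in> J"
    proof (rule Suc(1))
      show "r \<otimes> b \<otimes> b [^] n' \<in> J" using Suc(3-) assms(2,3) mn by (simp add: m_ac)
      have "b \<otimes> (r \<otimes> a [^] m) \<in> J" by (rule J.I_l_closed) (use Suc(3-) assms(2,3) in auto)
      then show "r \<otimes> b \<otimes> a [^] m \<in> J" using Suc(3-) assms(2,3) by (simp add: m_ac)
    qed (use Suc(2,3) assms(2,3) mn in auto)
    let ?q = "(a \<oplus> b) [^] (m' + n)"
    have q: "?q \<in> carrier R" using assms by auto
    have "r \<otimes> (a \<oplus> b) [^] (m + n) = r \<otimes> (?q \<otimes> (a \<oplus> b))" using mn by simp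
    also have "\<dots> = (r \<otimes> a) \<otimes> ?q \<oplus> (r \<otimes> b) \<otimes> ?q"
    proof -
      have "r \<otimes> (q \<otimes> (a \<oplus> b)) = (r \<otimes> a) \<otimes> q \<oplus> (r \<otimes> b) \<otimes> q" if "q \<in> carrier R" for q
        using that assms(2,3) Suc(3) by (simp add: r_distr m_ac)
      then show ?thesis using q .
    qed
    finally show ?thesis using 1 2 mn J.a_closed by simp
  qed
qed

lemma ideal_radical:
  assumes "ideal J R"
  shows "ideal {r \<in> carrier R. \<exists>n::nat. r [^] n \<in> J} R" (is "ideal ?K R")
proof (rule ideal_memI)
  interpret J: ideal J R by fact
  show "r \<otimes> a \<in> ?K" if "a \<in> ?K" "r \<in> carrier R" for a r
  proof -
    from that obtain n :: nat where n: "a [^] n \<in> J" "a \<in> carrier R" by auto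
    have "r [^] n \<otimes> a [^] n \<in> J" using n that by (intro J.I_l_closed) auto
    then have "(r \<otimes> a) [^] n \<in> J" using n that by (simp add: nat_pow_distrib)
    then show ?thesis using n that by auto
  qed
  show "a \<oplus> b \<in> ?K" if ab: "a \<in> ?K" "b \<in> ?K" for a b
  proof -
    from ab obtain m n :: nat where mn: "a \<in> carrier R" "b \<in> carrier R" "a [^] m \<in> J" "b [^] n \<in> J"
      by auto
    have "\<one> \<otimes> (a \<oplus> b) [^] (m + n) \<in> J"
      by (rule power_add_mem_ideal [OF assms]) (use mn in auto)
    then show ?thesis using mn by auto
  qed
  have "\<zero> [^] (1::nat) \<in> J" by simp
  then show "\<zero> \<in> ?K" by blast
qed auto

text \<open>The elements some power of which annihilates the class of \<open>c\<close> form an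
  ideal, the radical of the annihilator, and it contains every \<open>x i\<close>. Thus the class of
  \<open>c\<close> dies once \<open>y\<close> is inverted.\<close>

lemma power_generated_mem_cobounding:
  assumes "finite U" "x \<in> U \<rightarrow> carrier R" "c \<in> Pow U \<rightarrow> carrier R"
    and "\<And>s. s \<subseteq> U \<Longrightarrow> card s = Suc p \<Longrightarrow> kdiff R x N c s = \<zero>"
    and "y \<in> genideal R (x ` U)"
  shows "\<exists>L::nat. y [^] L \<in> cobounding x U p N c"
proof -
  let ?J = "cobounding x U p N c"
  let ?K = "{r \<in> carrier R. \<exists>n::nat. r [^] n \<in> ?J}"
  have "ideal ?K R" by (rule ideal_radical [OF cobounding_ideal]) (use assms in auto)
  moreover have "x ` U \<subseteq> ?K"
    using power_mem_cobounding [OF assms(1-4)] assms(2) by auto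
  ultimately have "genideal R (x ` U) \<subseteq> ?K" by (rule genideal_minimal)
  then show ?thesis using assms(5) by auto
qed

end


section \<open>Cech cohomology and change of generators\<close>

definition kprod :: "('a, 'b) ring_scheme \<Rightarrow> (nat \<Rightarrow> 'a) \<Rightarrow> nat set \<Rightarrow> 'a" where
  "kprod R x s = (\<Otimes>\<^bsub>R\<^esub> i\<in>s. x i)"

context cring
begin

lemma ksign_cancel: "w \<in> carrier R \<Longrightarrow> ksign R j s \<otimes> w = \<zero> \<Longrightarrow> w = \<zero>"
  by (auto simp: ksign_def l_minus split: if_splits)

lemma ksign_ksign [simp]: "w \<in> carrier R \<Longrightarrow> ksign R j s \<otimes> (ksign R j s \<otimes> w) = w"
  by (simp add: m_assoc [symmetric])

lemma minus_one_distr: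
  assumes "k \<in> carrier R" "w \<in> carrier R" "f \<in> carrier R" "z \<in> carrier R" "b \<in> carrier R"
  shows "\<ominus> \<one> \<otimes> (k \<otimes> (w \<otimes> (f \<oplus> (\<ominus> z) \<otimes> b))) = \<ominus> (k \<otimes> (w \<otimes> f)) \<oplus> k \<otimes> (w \<otimes> (z \<otimes> b))"
  using assms by (simp add: r_distr l_minus r_minus minus_add)

lemma minus_uminus_add:
  assumes "a \<in> carrier R" "b \<in> carrier R"
  shows "b \<ominus> (\<ominus> a \<oplus> b) = a"
proof -
  have "b \<ominus> (\<ominus> a \<oplus> b) = b \<oplus> (a \<oplus> \<ominus> b)" using assms by (simp add: a_minus_def minus_add)
  also have "\<dots> = a \<oplus> (b \<oplus> \<ominus> b)" using assms by (rule_tac a_lcomm) auto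
  finally show ?thesis using assms by (simp add: r_neg)
qed

lemma kprod_closed: "x \<in> s \<rightarrow> carrier R \<Longrightarrow> kprod R x s \<in> carrier R"
  unfolding kprod_def by (rule finprod_closed)

lemma kprod_closed': "s \<subseteq> U \<Longrightarrow> x \<in> U \<rightarrow> carrier R \<Longrightarrow> kprod R x s \<in> carrier R"
  by (rule kprod_closed) auto

lemma kprod_insert:
  assumes "finite s" "j \<notin> s" "x \<in> insert j s \<rightarrow> carrier R"
  shows "kprod R x (insert j s) = x j \<otimes> kprod R x s"
  unfolding kprod_def by (rule finprod_insert) (use assms in auto)

lemma kprod_remove:
  assumes "finite s" "j \<in> s" "x \<in> s \<rightarrow> carrier R"
  shows "kprod R x s = x j \<otimes> kprod R x (s - {j})"
  using kprod_insert [of "s - {j}" j x] assms by (simp add: insert_absorb)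

lemma kprod_empty [simp]: "kprod R x {} = \<one>"
  by (simp add: kprod_def)

text \<open>Rewriting a fraction over the exponent \<open>N + T\<close> multiplies its numerator by
  \<open>kprod R x t [^] T\<close>. This is a chain map on numerators, since the factor
  \<open>x j\<close> missing from \<open>kprod R x (s - {j})\<close> is supplied by the larger power
  of \<open>x j\<close> in the differential.\<close>

lemma kdiff_shift:
  assumes "finite s" "s \<subseteq> U" "x \<in> U \<rightarrow> carrier R" "c \<in> Pow U \<rightarrow> carrier R"
  shows "kdiff R x (N + T) (\<lambda>t. kprod R x t [^] T \<otimes> c t) s = kprod R x s [^] T \<otimes> kdiff R x N c s"
proof -
  have cl: "x j \<in> carrier R" "c (s - {j}) \<in> carrier R" "kprod R x s \<in> carrier R"
    "kprod R x (s - {j}) \<in> carrier R" if "j \<in> s" for j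
    using assms that by (auto intro!: kprod_closed)
  have kp: "kprod R x s \<in> carrier R" using assms by (auto intro!: kprod_closed)
  have "kprod R x s [^] T \<otimes> kdiff R x N c s =
    (\<Oplus>j\<in>s. kprod R x s [^] T \<otimes> (ksign R j s \<otimes> (x j [^] N \<otimes> c (s - {j}))))"
    unfolding kdiff_def by (rule finsum_rdistr) (use assms cl kp in auto)
  also have "\<dots> = kdiff R x (N + T) (\<lambda>t. kprod R x t [^] T \<otimes> c t) s"
    unfolding kdiff_def
  proof (rule finsum_cong_strong)
    fix j assume j: "j \<in> s"
    have "kprod R x s = x j \<otimes> kprod R x (s - {j})"
      by (rule kprod_remove) (use assms j in auto)
    then show "kprod R x s [^] T \<otimes> (ksign R j s \<otimes> (x j [^] N \<otimes> c (s - {j}))) =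
        ksign R j s \<otimes> (x j [^] (N + T) \<otimes> (kprod R x (s - {j}) [^] T \<otimes> c (s - {j})))"
      using cl [OF j] by (simp add: nat_pow_distrib nat_pow_mult [symmetric] m_ac)
    show "ksign R j s \<otimes> (x j [^] (N + T) \<otimes> (kprod R x (s - {j}) [^] T \<otimes> c (s - {j}))) \<in> carrier R"
      using cl [OF j] by simp
  qed
  finally show ?thesis by simp
qed

text \<open>The signs depend only on the order of the indices, so strict monotonicity preserves
  them. It allows two lists of generators to be placed side by side in one list.\<close>

lemma kdiff_reindex:
  assumes "strict_mono \<phi>" "s \<subseteq> U" "x \<in> \<phi> ` U \<rightarrow> carrier R" "c \<in> Pow (\<phi> ` U) \<rightarrow> carrier R"
    and "\<And>i. i \<in> U \<Longrightarrow> y i = x (\<phi> i)"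
  shows "kdiff R y N (\<lambda>t. c (\<phi> ` t)) s = kdiff R x N c (\<phi> ` s)"
proof -
  have inj: "inj \<phi>" using assms(1) by (rule strict_mono_imp_inj_on)
  have cl: "x (\<phi> j) \<in> carrier R" "c (\<phi> ` (s - {j})) \<in> carrier R" if "j \<in> s" for j
    using assms that by (auto intro!: funcset_PowD [OF assms(4)])
  have sg: "ksign R (\<phi> j) (\<phi> ` s) = ksign R j s" for j
  proof -
    have "{i \<in> \<phi> ` s. i < \<phi> j} = \<phi> ` {i \<in> s. i < j}"
      using assms(1) by (auto simp: strict_mono_less)
    then have "card {i \<in> \<phi> ` s. i < \<phi> j} = card {i \<in> s. i < j}"
      using inj by (simp add: card_image inj_on_def inj_def)
    then show ?thesis by (simp add: ksign_def)
  qed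
  have im: "\<phi> ` s - {\<phi> j} = \<phi> ` (s - {j})" for j
    using inj by (auto simp: inj_def)
  have "kdiff R x N c (\<phi> ` s) = (\<Oplus>j\<in>s. ksign R (\<phi> j) (\<phi> ` s) \<otimes> (x (\<phi> j) [^] N \<otimes> c (\<phi> ` s - {\<phi> j})))"
    unfolding kdiff_def
    by (rule finsum_reindex) (use inj cl in \<open>auto simp: im inj_on_def inj_def\<close>)
  also have "\<dots> = kdiff R y N (\<lambda>t. c (\<phi> ` t)) s"
    unfolding kdiff_def
  proof (rule finsum_cong_strong)
    fix j assume j: "j \<in> s"
    then have "y j = x (\<phi> j)" using assms by auto
    then show "ksign R (\<phi> j) (\<phi> ` s) \<otimes> (x (\<phi> j) [^] N \<otimes> c (\<phi> ` s - {\<phi> j})) =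
        ksign R j s \<otimes> (y j [^] N \<otimes> c (\<phi> ` (s - {j})))"
      and "ksign R j s \<otimes> (y j [^] N \<otimes> c (\<phi> ` (s - {j}))) \<in> carrier R"
      using cl [OF j] by (simp_all add: sg im)
  qed
  finally show ?thesis by simp
qed

end

section \<open>Graded rings with projections onto their components\<close>

definition gcomp :: "('a, 'b) graded_ring_scheme \<Rightarrow> int \<Rightarrow> 'a set" where
  "gcomp S k = (if k \<ge> 0 then hcomp S (nat k) else {\<zero>\<^bsub>S\<^esub>})"

definition gproj :: "('a, 'b) graded_ring_scheme \<Rightarrow> (nat \<Rightarrow> 'a \<Rightarrow> 'a) \<Rightarrow> int \<Rightarrow> 'a \<Rightarrow> 'a" where
  "gproj S pr k a = (if k \<ge> 0 then pr (nat k) a else \<zero>\<^bsub>S\<^esub>)"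

text \<open>Fractions \<open>m s / (\<Prod>i\<in>s. x i)\<^sup>N\<close> with one common exponent \<open>N\<close> turn Cech cochains into Koszul
  cochains for the powers \<open>x i\<^sup>N\<close>; enlarging the exponent clears the annihilating powers.\<close>

definition cech_vanishes ::
    "('a, 'b) graded_ring_scheme \<Rightarrow> (nat \<Rightarrow> 'a) \<Rightarrow> nat set \<Rightarrow> nat \<Rightarrow> int \<Rightarrow> bool" where
  "cech_vanishes S x U p n \<longleftrightarrow> (\<forall>N. \<forall>m \<in> Pow U \<rightarrow> carrier S.
     (\<forall>s\<subseteq>U. card s = p \<longrightarrow> m s \<in> gcomp S (n + int (N * p))) \<longrightarrow>
     (\<forall>s\<subseteq>U. card s = Suc p \<longrightarrow> kdiff S x N m s = \<zero>\<^bsub>S\<^esub>) \<longrightarrow>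
     (\<exists>T. \<exists>b \<in> Pow U \<rightarrow> carrier S. \<forall>s\<subseteq>U. card s = p \<longrightarrow>
        kprod S x s [^]\<^bsub>S\<^esub> T \<otimes>\<^bsub>S\<^esub> m s = kdiff S x (N + T) b s))"

text \<open>\<open>pr k\<close> is the projection onto degree \<open>k\<close>. In place of a direct
  sum decomposition, the locale records that projections are additive and that a homogeneous factor
  can be pulled out with a shift of degree; this suffices to replace a cochain by its component in
  the right degree.\<close>

locale graded_cring = cring S for S :: "('a, 'b) graded_ring_scheme" (structure) +
  fixes pr :: "nat \<Rightarrow> 'a \<Rightarrow> 'a"
  assumes hcomp_closed: "a \<in> hcomp S k \<Longrightarrow> a \<in> carrier S"
    and hcomp_add: "a \<in> hcomp S k \<Longrightarrow> b \<in> hcomp S k \<Longrightarrow> a \<oplus> b \<in> hcomp S k"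
    and hcomp_mult: "a \<in> hcomp S k \<Longrightarrow> b \<in> hcomp S l \<Longrightarrow> a \<otimes> b \<in> hcomp S (k + l)"
    and hcomp_zero: "\<zero> \<in> hcomp S k"
    and hcomp_one: "\<one> \<in> hcomp S 0"
    and hcomp_uminus: "a \<in> hcomp S k \<Longrightarrow> \<ominus> a \<in> hcomp S k"
    and pr_mem: "a \<in> carrier S \<Longrightarrow> pr k a \<in> hcomp S k"
    and pr_id: "a \<in> hcomp S k \<Longrightarrow> pr k a = a"
    and pr_add: "a \<in> carrier S \<Longrightarrow> b \<in> carrier S \<Longrightarrow> pr k (a \<oplus> b) = pr k a \<oplus> pr k b"
    and pr_mult: "a \<in> hcomp S k \<Longrightarrow> b \<in> carrier S \<Longrightarrow> pr (k + l) (a \<otimes> b) = a \<otimes> pr l b"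
    and pr_mult_less: "a \<in> hcomp S k \<Longrightarrow> b \<in> carrier S \<Longrightarrow> l < k \<Longrightarrow> pr l (a \<otimes> b) = \<zero>"
begin

lemma gcomp_closed: "a \<in> gcomp S k \<Longrightarrow> a \<in> carrier S"
  by (auto simp: gcomp_def hcomp_closed split: if_splits)

lemma gcomp_zero: "\<zero> \<in> gcomp S k"
  by (auto simp: gcomp_def hcomp_zero)

lemma gcomp_add: "a \<in> gcomp S k \<Longrightarrow> b \<in> gcomp S k \<Longrightarrow> a \<oplus> b \<in> gcomp S k"
  by (auto simp: gcomp_def hcomp_add split: if_splits)

lemma gcomp_uminus: "a \<in> gcomp S k \<Longrightarrow> \<ominus> a \<in> gcomp S k"
  by (auto simp: gcomp_def hcomp_uminus split: if_splits)

lemma gcomp_mult: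
  assumes "a \<in> hcomp S i" "b \<in> gcomp S k"
  shows "a \<otimes> b \<in> gcomp S (int i + k)"
proof (cases "k \<ge> 0")
  case True
  then have "nat (int i + k) = i + nat k" by simp
  then show ?thesis using True assms hcomp_mult by (auto simp: gcomp_def)
next
  case False
  then have "b = \<zero>" using assms by (simp add: gcomp_def)
  then show ?thesis using assms hcomp_closed gcomp_zero by auto
qed

lemma gproj_mem: "a \<in> carrier S \<Longrightarrow> gproj S pr k a \<in> gcomp S k"
  by (auto simp: gproj_def gcomp_def pr_mem)

lemma gproj_closed [simp]: "a \<in> carrier S \<Longrightarrow> gproj S pr k a \<in> carrier S"
  using gproj_mem gcomp_closed by blast

lemma gproj_id: "a \<in> gcomp S k \<Longrightarrow> gproj S pr k a = a"
  by (auto simp: gproj_def gcomp_def pr_id split: if_splits)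

lemma gproj_add: "a \<in> carrier S \<Longrightarrow> b \<in> carrier S \<Longrightarrow> gproj S pr k (a \<oplus> b) = gproj S pr k a \<oplus> gproj S pr k b"
  by (auto simp: gproj_def pr_add)

lemma gproj_mult:
  assumes "a \<in> hcomp S i" "b \<in> carrier S"
  shows "gproj S pr k (a \<otimes> b) = a \<otimes> gproj S pr (k - int i) b"
proof (cases "k \<ge> int i")
  case True
  then have "nat k = i + nat (k - int i)" "k \<ge> 0" by auto
  then show ?thesis using pr_mult [OF assms, of "nat (k - int i)"] True by (simp add: gproj_def)
next
  case False
  then show ?thesis using pr_mult_less [OF assms, of "nat k"] assms hcomp_closed [OF assms(1)]
    by (simp add: gproj_def)
qed

lemma gproj_zero: "gproj S pr k \<zero> = \<zero>"
  by (rule gproj_id [OF gcomp_zero])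

lemma gproj_finsum:
  assumes "finite A" "\<And>i. i \<in> A \<Longrightarrow> f i \<in> carrier S"
  shows "gproj S pr k (\<Oplus>i\<in>A. f i) = (\<Oplus>i\<in>A. gproj S pr k (f i))"
  using assms
proof (induction A)
  case (insert a A)
  have 1: "f \<in> A \<rightarrow> carrier S" "f a \<in> carrier S" using insert by auto
  have 2: "(\<lambda>i. gproj S pr k (f i)) \<in> A \<rightarrow> carrier S" using 1(1) gproj_closed by blast
  have IH: "gproj S pr k (\<Oplus>i\<in>A. f i) = (\<Oplus>i\<in>A. gproj S pr k (f i))"
    by (rule insert.IH) (use insert.prems in auto)
  have "(\<Oplus>i\<in>insert a A. f i) = f a \<oplus> (\<Oplus>i\<in>A. f i)"
    by (rule finsum_insert) (use insert.hyps 1 in auto)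
  moreover have "(\<Oplus>i\<in>insert a A. gproj S pr k (f i)) = gproj S pr k (f a) \<oplus> (\<Oplus>i\<in>A. gproj S pr k (f i))"
    by (rule finsum_insert) (use insert.hyps 1 2 in auto)
  moreover have "(\<Oplus>i\<in>A. f i) \<in> carrier S" using 1(1) by (rule finsum_closed)
  ultimately show ?case using IH 1(2) by (simp only: gproj_add)
qed (simp add: gproj_zero)

lemma hcomp_pow: "a \<in> hcomp S d \<Longrightarrow> a [^] (k::nat) \<in> hcomp S (d * k)"
proof (induction k)
  case (Suc k)
  then show ?case using hcomp_mult [of "a [^] k" "d * k" a d] by (simp add: add.commute)
qed (simp add: hcomp_one)

lemma hcomp_1_pow: "a \<in> hcomp S 1 \<Longrightarrow> a [^] (k::nat) \<in> hcomp S k"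
  using hcomp_pow [of a 1 k] by simp

lemma ksign_hcomp: "ksign S j s \<in> hcomp S 0"
  by (auto simp: ksign_def hcomp_one hcomp_uminus)

lemma kprod_hcomp:
  assumes "finite s" "x \<in> s \<rightarrow> hcomp S 1"
  shows "kprod S x s \<in> hcomp S (card s)"
  using assms
proof (induction s)
  case (insert j s)
  have "kprod S x (insert j s) = x j \<otimes> kprod S x s"
    by (rule kprod_insert) (use insert hcomp_closed in auto)
  then show ?case using insert hcomp_mult [of "x j" 1 "kprod S x s" "card s"] by auto
qed (simp add: hcomp_one)

text \<open>The differential for the powers \<open>x j [^] N\<close> raises degrees by
  \<open>N\<close>, so a coboundary of degree \<open>k\<close> involves only the components of
  \<open>b\<close> in degree \<open>k - N\<close>. Hence \<open>cech_vanishes\<close> can do without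
  a homogeneity condition on \<open>b\<close>.\<close>

lemma kdiff_gproj:
  assumes "finite s" "s \<subseteq> U" "x \<in> U \<rightarrow> hcomp S 1" "b \<in> Pow U \<rightarrow> carrier S"
    and "kdiff S x N b s \<in> gcomp S k"
  shows "kdiff S x N (\<lambda>t. gproj S pr (k - int N) (b t)) s = kdiff S x N b s"
proof -
  have cl: "x j \<in> hcomp S 1" "x j \<in> carrier S" "x j [^] N \<in> hcomp S N" "b (s - {j}) \<in> carrier S" if "j \<in> s" for j
  proof -
    show *: "x j \<in> hcomp S 1" "b (s - {j}) \<in> carrier S" using assms that by auto
    then show "x j \<in> carrier S" "x j [^] N \<in> hcomp S N" by (blast intro: hcomp_closed hcomp_1_pow)+
  qed
  have "kdiff S x N b s = gproj S pr k (kdiff S x N b s)"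
    using assms(5) by (simp add: gproj_id)
  also have "\<dots> = (\<Oplus>j\<in>s. gproj S pr k (ksign S j s \<otimes> (x j [^] N \<otimes> b (s - {j}))))"
    unfolding kdiff_def by (rule gproj_finsum) (use assms cl in auto)
  also have "\<dots> = kdiff S x N (\<lambda>t. gproj S pr (k - int N) (b t)) s"
    unfolding kdiff_def
  proof (rule finsum_cong_strong)
    fix j assume j: "j \<in> s"
    show "gproj S pr k (ksign S j s \<otimes> (x j [^] N \<otimes> b (s - {j}))) =
      ksign S j s \<otimes> (x j [^] N \<otimes> gproj S pr (k - int N) (b (s - {j})))"
      using gproj_mult [OF ksign_hcomp, of "x j [^] N \<otimes> b (s - {j})" k j s]
        gproj_mult [OF cl(3), of j "b (s - {j})" k] cl [OF j] j by simp
    show "ksign S j s \<otimes> (x j [^] N \<otimes> gproj S pr (k - int N) (b (s - {j}))) \<in> carrier S"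
      using cl [OF j] by simp
  qed
  finally show ?thesis by simp
qed

lemma cech_vanishesD:
  assumes "cech_vanishes S x U p n" "m \<in> Pow U \<rightarrow> carrier S"
    and "\<forall>s\<subseteq>U. card s = p \<longrightarrow> m s \<in> gcomp S (n + int (N * p))"
    and "\<forall>s\<subseteq>U. card s = Suc p \<longrightarrow> kdiff S x N m s = \<zero>"
  shows "\<exists>T. \<exists>b \<in> Pow U \<rightarrow> carrier S. \<forall>s\<subseteq>U. card s = p \<longrightarrow>
        kprod S x s [^]\<^bsub>S\<^esub> T \<otimes>\<^bsub>S\<^esub> m s = kdiff S x (N + T) b s"
  using assms unfolding cech_vanishes_def by simp

text \<open>The complex for \<open>insert u U\<close> is the cone over the map from the complex for \<open>U\<close> to its localization
  at \<open>x u\<close>. As \<open>x u\<close> lies in the ideal of the \<open>x i\<close>, \<open>i \<in> U\<close>, a power of it kills the cohomology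
  of the localization, which is therefore acyclic.\<close>

lemma cech_vanishes_insertD:
  assumes U: "finite U" "u \<notin> U" and x: "x \<in> insert u U \<rightarrow> hcomp S 1"
    and gen: "x u \<in> genideal S (x ` U)"
    and van: "cech_vanishes S x (insert u U) p n"
  shows "cech_vanishes S x U p n"
  unfolding cech_vanishes_def
proof (intro allI ballI impI)
  fix N m assume m: "m \<in> Pow U \<rightarrow> carrier S"
    and hom: "\<forall>s\<subseteq>U. card s = p \<longrightarrow> m s \<in> gcomp S (n + int (N * p))"
    and cyc: "\<forall>s\<subseteq>U. card s = Suc p \<longrightarrow> kdiff S x N m s = \<zero>"
  let ?V = "insert u U"
  have xV: "x \<in> ?V \<rightarrow> carrier S" using x hcomp_closed by blast
  have xU: "x \<in> U \<rightarrow> carrier S" and xU1: "x \<in> U \<rightarrow> hcomp S 1" using xV x by auto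
  have fin: "finite s" if "s \<subseteq> U" for s using that U(1) by (rule finite_subset)
  define y where "y = x u"
  have y1: "y \<in> hcomp S 1" and y: "y \<in> carrier S" using x xV by (auto simp: y_def)
  \<comment> \<open>As \<open>y\<close> lies in the ideal of the \<open>x i\<close>, a power of it
    turns the cocycle \<open>m\<close> into a coboundary.\<close>
  obtain L :: nat and f where f: "f \<in> Pow U \<rightarrow> carrier S"
    "\<And>s. s \<subseteq> U \<Longrightarrow> card s = p \<Longrightarrow> y [^] L \<otimes> m s = kdiff S x N f s"
    using power_generated_mem_cobounding [OF U(1) xU m, of p N y] cyc gen
    by (auto simp: cobounding_def y_def)
  define M where "M = N + L"
  define m1 where "m1 s = kprod S x s [^] L \<otimes> m s" for s
  have kpc: "kprod S x s \<in> carrier S" if "s \<subseteq> U" for s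
    using that xU by (rule kprod_closed')
  have m1: "m1 \<in> Pow U \<rightarrow> carrier S"
    by (auto simp: m1_def intro!: m_closed nat_pow_closed kpc funcset_PowD [OF m])
  have m1h: "m1 s \<in> gcomp S (n + int (M * p))" if "s \<subseteq> U" "card s = p" for s
  proof -
    have "kprod S x s \<in> hcomp S p" using kprod_hcomp [OF fin [OF that(1)], of x] xU1 that by auto
    then have "kprod S x s [^] L \<in> hcomp S (p * L)" by (rule hcomp_pow)
    moreover have "m s \<in> gcomp S (n + int (N * p))" using hom that by simp
    ultimately have "m1 s \<in> gcomp S (int (p * L) + (n + int (N * p)))"
      unfolding m1_def by (rule gcomp_mult)
    moreover have "int (p * L) + (n + int (N * p)) = n + int (M * p)"
      by (simp add: M_def algebra_simps)
    ultimately show ?thesis by metis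
  qed
  \<comment> \<open>Scaled by \<open>y [^] N\<close> and rewritten over the exponent
    \<open>M = N + L\<close>, the cochain \<open>f\<close> bounds
    \<open>y [^] M \<otimes> m1\<close>, the image of \<open>m1\<close> in the part of the cone over
    sets containing \<open>u\<close>.\<close>
  define g where "g t = y [^] N \<otimes> (kprod S x t [^] L \<otimes> f t)" for t
  have g: "g \<in> Pow U \<rightarrow> carrier S"
    by (auto simp: g_def intro!: m_closed nat_pow_closed kpc y funcset_PowD [OF f(1)])
  have kg: "kdiff S x M g s = y [^] M \<otimes> m1 s" if s: "s \<subseteq> U" "card s = p" for s
  proof -
    have "kdiff S x M g s = y [^] N \<otimes> kdiff S x M (\<lambda>t. kprod S x t [^] L \<otimes> f t) s"
      unfolding g_def
      by (rule kdiff_scale [OF fin [OF s(1)] s(1) xU]) (use y in \<open>auto intro!: m_closed nat_pow_closed kpc funcset_PowD [OF f(1)]\<close>)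
    also have "\<dots> = y [^] N \<otimes> (kprod S x s [^] L \<otimes> (y [^] L \<otimes> m s))"
      using kdiff_shift [OF fin [OF s(1)] s(1) xU f(1), of N L] f(2) [OF s] by (simp add: M_def)
    also have "\<dots> = y [^] M \<otimes> m1 s"
      using funcset_PowD [OF m s(1)] kpc [OF s(1)] y
      by (simp add: M_def m1_def nat_pow_mult [symmetric] m_ac)
    finally show ?thesis .
  qed
  \<comment> \<open>The component of \<open>g\<close> in the degree that numerators over
    \<open>p\<close>-element sets have for the exponent \<open>M\<close>, because \<open>h t\<close>
    is going to be the value at \<open>insert u t\<close>.\<close>
  define h where "h t = gproj S pr (n + int (M * p)) (g t)" for t
  have hc: "h t \<in> gcomp S (n + int (M * p))" "h t \<in> carrier S" if "t \<subseteq> U" for t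
    using gproj_mem [of "g t" "n + int (M * p)"] funcset_PowD [OF g that] by (auto simp: h_def)
  have kh: "kdiff S x M h s = y [^] M \<otimes> m1 s" if s: "s \<subseteq> U" "card s = p" for s
  proof -
    have "y [^] M \<otimes> m1 s \<in> gcomp S (int M + (n + int (M * p)))"
      using hcomp_1_pow [OF y1] m1h [OF s] by (rule gcomp_mult)
    then have "kdiff S x M g s \<in> gcomp S (int M + (n + int (M * p)))" using kg [OF s] by simp
    from kdiff_gproj [OF fin [OF s(1)] s(1) xU1 g this]
    have "kdiff S x M h s = kdiff S x M g s" by (simp add: h_def [abs_def])
    then show ?thesis using kg [OF s] by simp
  qed
  \<comment> \<open>The cocycle \<open>m1\<close> over \<open>U\<close> extends to a cocycle of the
    cone because its image there is the coboundary of \<open>h\<close>.\<close>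
  define c where "c s = (if u \<in> s then ksign S u s \<otimes> h (s - {u}) else m1 s)" for s
  have c: "c \<in> Pow ?V \<rightarrow> carrier S"

  proof
    fix s assume "s \<in> Pow ?V"
    then have "s - {u} \<subseteq> U" "u \<notin> s \<Longrightarrow> s \<subseteq> U" by auto
    then show "c s \<in> carrier S" using hc(2) funcset_PowD [OF m1] by (simp add: c_def)
  qed
  have ch: "c s \<in> gcomp S (n + int (M * p))" if s: "s \<subseteq> ?V" "card s = p" for s
  proof (cases "u \<in> s")
    case True
    have "ksign S u s \<otimes> h (s - {u}) \<in> gcomp S (int 0 + (n + int (M * p)))"
      using ksign_hcomp by (rule gcomp_mult) (rule hc(1), use s in auto)
    then show ?thesis using True by (simp add: c_def)
  next
    case False
    then show ?thesis using m1h [of s] s by (auto simp: c_def)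
  qed
  have cc: "kdiff S x M c s = \<zero>" if s: "s \<subseteq> ?V" "card s = Suc p" for s
  proof (cases "u \<in> s")
    case True
    define t where "t = s - {u}"
    have t: "s = insert u t" "u \<notin> t" "t \<subseteq> U" "finite t" "card t = p"
      using True s fin [of "s - {u}"] U by (auto simp: t_def card_Diff_singleton)
    have "kdiff S x M (\<lambda>s. ksign S u (insert u s) \<otimes> c (insert u s)) t = kdiff S x M h t"
    proof (rule kdiff_cong [OF t(3) xU])
      show "h \<in> Pow U \<rightarrow> carrier S" using hc by auto
      fix j assume "j \<in> t"
      have "h (t - {j}) \<in> carrier S" by (rule hc(2)) (use t in auto)
      then show "ksign S u (insert u (t - {j})) \<otimes> c (insert u (t - {j})) = h (t - {j})"
        using t by (simp add: c_def m_assoc [symmetric])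
    qed
    then have "kdiff S x M c s = ksign S u s \<otimes> (y [^] M \<otimes> m1 t \<ominus> y [^] M \<otimes> m1 t)"
      using kdiff_insert [OF t(4,2) _ xV c, of M] s(1) t kh [of t] by (simp add: c_def y_def)
    also have "\<dots> = \<zero>"
      using funcset_PowD [OF m1 t(3)] y by (simp add: a_minus_def r_neg)
    finally show ?thesis .
  next
    case False
    then have sU: "s \<subseteq> U" using s by auto
    have "kdiff S x M c s = kdiff S x M m1 s"
      by (rule kdiff_cong [OF sU xU m1]) (use False in \<open>simp add: c_def\<close>)
    also have "\<dots> = kprod S x s [^] L \<otimes> kdiff S x N m s"
      unfolding m1_def [abs_def] M_def by (rule kdiff_shift [OF fin [OF sU] sU xU m])
    also have "\<dots> = \<zero>" using cyc s sU kpc by simp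
    finally show ?thesis .
  qed
  have ch': "\<forall>s\<subseteq>?V. card s = p \<longrightarrow> c s \<in> gcomp S (n + int (M * p))"
    and cc': "\<forall>s\<subseteq>?V. card s = Suc p \<longrightarrow> kdiff S x M c s = \<zero>"
    using ch cc by blast+
  obtain T b where b0: "b \<in> Pow ?V \<rightarrow> carrier S"
      "\<forall>s\<subseteq>?V. card s = p \<longrightarrow> kprod S x s [^] T \<otimes> c s = kdiff S x (M + T) b s"
    using cech_vanishesD [OF van c ch' cc'] by (elim exE bexE)
  have b: "b \<in> Pow ?V \<rightarrow> carrier S"
    "\<And>s. s \<subseteq> ?V \<Longrightarrow> card s = p \<Longrightarrow> kprod S x s [^] T \<otimes> c s = kdiff S x (M + T) b s"
    using b0 by simp_all
  \<comment> \<open>The differential at a set \<open>s \<subseteq> U\<close> evaluates only subsets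
    of \<open>s\<close>, so a cochain bounding \<open>c\<close> over \<open>insert u U\<close> also
    bounds its restriction to \<open>U\<close>.\<close>
  have bU: "b \<in> Pow U \<rightarrow> carrier S" using b(1) by auto
  show "\<exists>T. \<exists>b\<in>Pow U \<rightarrow> carrier S. \<forall>s\<subseteq>U. card s = p \<longrightarrow>
      kprod S x s [^] T \<otimes> m s = kdiff S x (N + T) b s"
  proof (intro exI bexI allI impI)
    fix s assume s: "s \<subseteq> U" "card s = p"
    have cs: "c s = kprod S x s [^] L \<otimes> m s" using s U by (auto simp: c_def m1_def)
    have "kprod S x s [^] (L + T) = kprod S x s [^] L \<otimes> kprod S x s [^] T"
      using kpc [OF s(1)] by (simp add: nat_pow_mult)
    then have "kprod S x s [^] (L + T) \<otimes> m s = kprod S x s [^] T \<otimes> c s"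
      using funcset_PowD [OF m s(1)] kpc [OF s(1)] by (simp add: cs m_ac)
    also have "\<dots> = kdiff S x (N + (L + T)) b s"
      using b(2) [of s] s unfolding M_def by (simp add: add.assoc subset_insertI2)
    finally show "kprod S x s [^] (L + T) \<otimes> m s = kdiff S x (N + (L + T)) b s" .
  qed (rule bU)
qed

text \<open>The other half of the cone argument. A cocycle over \<open>insert u U\<close> restricts
  to a cocycle over \<open>U\<close>, where it is the coboundary of some \<open>b\<close>.
  Subtracting the effect of \<open>b\<close> from its part over sets containing \<open>u\<close>
  leaves a cocycle of degree \<open>p - 1\<close> over \<open>U\<close>, which a power of
  \<open>x u\<close> turns into a coboundary.\<close>

lemma cech_vanishes_insertI:
  assumes U: "finite U" "u \<notin> U" and x: "x \<in> insert u U \<rightarrow> hcomp S 1"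
    and gen: "x u \<in> genideal S (x ` U)"
    and van: "cech_vanishes S x U p n"
  shows "cech_vanishes S x (insert u U) p n"
  unfolding cech_vanishes_def
proof (intro allI ballI impI)
  let ?V = "insert u U"
  fix N m assume m: "m \<in> Pow ?V \<rightarrow> carrier S"
    and hom: "\<forall>s\<subseteq>?V. card s = p \<longrightarrow> m s \<in> gcomp S (n + int (N * p))"
    and cyc: "\<forall>s\<subseteq>?V. card s = Suc p \<longrightarrow> kdiff S x N m s = \<zero>"
  have xV: "x \<in> ?V \<rightarrow> carrier S" using x hcomp_closed by blast
  have xU: "x \<in> U \<rightarrow> carrier S" and xU1: "x \<in> U \<rightarrow> hcomp S 1" using xV x by auto
  have fin: "finite s" if "s \<subseteq> ?V" for s using that U(1) finite_subset by blast
  define y where "y = x u"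
  have y: "y \<in> carrier S" using x xV by (auto simp: y_def)
  have mU: "m \<in> Pow U \<rightarrow> carrier S" using m by auto
  have homU: "\<forall>s\<subseteq>U. card s = p \<longrightarrow> m s \<in> gcomp S (n + int (N * p))"
    using hom by blast
  have cycU: "\<forall>s\<subseteq>U. card s = Suc p \<longrightarrow> kdiff S x N m s = \<zero>"
    using cyc by blast
  obtain T b where b0: "b \<in> Pow U \<rightarrow> carrier S"
      "\<forall>s\<subseteq>U. card s = p \<longrightarrow> kprod S x s [^] T \<otimes> m s = kdiff S x (N + T) b s"
    using cech_vanishesD [OF van mU homU cycU] by (elim exE bexE)
  have b: "b \<in> Pow U \<rightarrow> carrier S"
    "\<And>s. s \<subseteq> U \<Longrightarrow> card s = p \<Longrightarrow> kprod S x s [^] T \<otimes> m s = kdiff S x (N + T) b s"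
    using b0 by simp_all
  define M where "M = N + T"
  define m1 where "m1 s = kprod S x s [^] T \<otimes> m s" for s
  have kpc: "kprod S x s \<in> carrier S" if "s \<subseteq> ?V" for s
    using that xV by (rule kprod_closed')
  have m1: "m1 \<in> Pow ?V \<rightarrow> carrier S"
    by (auto simp: m1_def intro!: m_closed nat_pow_closed kpc funcset_PowD [OF m])
  have m1c: "kdiff S x M m1 s = \<zero>" if s: "s \<subseteq> ?V" "card s = Suc p" for s
    using kdiff_shift [OF fin [OF s(1)] s(1) xV m, of N T] cyc s kpc [OF s(1)]
    by (simp add: M_def m1_def [abs_def])
  have kb: "kdiff S x M b s = m1 s" if "s \<subseteq> U" "card s = p" for s
    using b(2) [OF that] by (simp add: M_def m1_def)
  define f where "f t = ksign S u (insert u t) \<otimes> m1 (insert u t)" for t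
  have f: "f \<in> Pow U \<rightarrow> carrier S"
    by (auto simp: f_def intro!: m_closed funcset_PowD [OF m1])
  have kf: "kdiff S x M f t = y [^] M \<otimes> m1 t" if t: "t \<subseteq> U" "card t = p" for t
  proof -
    have t': "finite t" "u \<notin> t" "insert u t \<subseteq> ?V" "card (insert u t) = Suc p"
    proof -
      show *: "finite t" "u \<notin> t" "insert u t \<subseteq> ?V" using t U fin [of t] by auto
      then show "card (insert u t) = Suc p" using t by simp
    qed
    have cl: "kdiff S x M f t \<in> carrier S" "m1 t \<in> carrier S"
      using kdiff_closed [OF t(1) xU f] funcset_PowD [OF m1, of t] t by auto
    have "ksign S u (insert u t) \<otimes> (y [^] M \<otimes> m1 t \<ominus> kdiff S x M f t) = \<zero>"
      using kdiff_insert [OF t'(1-3) xV m1, of M] m1c [OF t'(3,4)] by (simp add: f_def [abs_def] y_def)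
    then have "y [^] M \<otimes> m1 t \<ominus> kdiff S x M f t = \<zero>"
      by (rule ksign_cancel [rotated]) (use cl y in simp)
    then show ?thesis using cl y by (simp add: r_right_minus_eq)
  qed
  show "\<exists>T. \<exists>b\<in>Pow ?V \<rightarrow> carrier S. \<forall>s\<subseteq>?V. card s = p \<longrightarrow>
      kprod S x s [^] T \<otimes> m s = kdiff S x (N + T) b s"
  proof (cases p)
    \<comment> \<open>The empty set is the only index set here, and it does not contain
      \<open>u\<close>.\<close>
    case 0
    have "\<forall>s\<subseteq>?V. card s = p \<longrightarrow> kprod S x s [^] T \<otimes> m s = kdiff S x (N + T) (\<lambda>t. \<zero>) s"
    proof (intro allI impI)
      fix s assume "s \<subseteq> ?V" "card s = p"
      then have "s = {}" using fin 0 by auto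
      then show "kprod S x s [^] T \<otimes> m s = kdiff S x (N + T) (\<lambda>t. \<zero>) s"
        using b(2) [of "{}"] 0 by simp
    qed
    then show ?thesis by (intro exI [of _ T] bexI [of _ "\<lambda>t. \<zero>"]) auto
  next
    case (Suc q)
    \<comment> \<open>On sets of size \<open>p\<close> both \<open>f\<close> and
      \<open>y [^] M \<otimes> b\<close> have the differential \<open>y [^] M \<otimes> m1\<close>,
      so their difference is a cocycle.\<close>
    define f' where "f' t = f t \<oplus> (\<ominus> (y [^] M)) \<otimes> b t" for t
    have f': "f' \<in> Pow U \<rightarrow> carrier S"
      by (auto simp: f'_def intro!: a_closed m_closed nat_pow_closed a_inv_closed y funcset_PowD [OF f] funcset_PowD [OF b(1)])
    have f'c: "kdiff S x M f' t = \<zero>" if t: "t \<subseteq> U" "card t = Suc q" for t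
    proof -
      have yb: "(\<lambda>t. (\<ominus> (y [^] M)) \<otimes> b t) \<in> Pow U \<rightarrow> carrier S"
        by (auto intro!: m_closed nat_pow_closed a_inv_closed y funcset_PowD [OF b(1)])
      have "kdiff S x M f' t = kdiff S x M f t \<oplus> kdiff S x M (\<lambda>t. (\<ominus> (y [^] M)) \<otimes> b t) t"
        unfolding f'_def by (rule kdiff_add [OF t(1) xU f yb])
      also have "kdiff S x M (\<lambda>t. (\<ominus> (y [^] M)) \<otimes> b t) t = (\<ominus> (y [^] M)) \<otimes> kdiff S x M b t"
        by (rule kdiff_scale [OF _ t(1) xU b(1)]) (use y t fin [of t] in auto)
      finally have "kdiff S x M f' t = y [^] M \<otimes> m1 t \<oplus> (\<ominus> (y [^] M)) \<otimes> m1 t"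
        using kf [of t] kb [of t] t Suc by simp
      moreover have "m1 t \<in> carrier S" using funcset_PowD [OF m1] t by blast
      ultimately show ?thesis using y by (simp add: l_minus r_neg)
    qed
    have "\<exists>L::nat. y [^] L \<in> cobounding x U q M f'"
      by (rule power_generated_mem_cobounding [OF U(1) xU f']) (use f'c gen in \<open>simp_all add: y_def\<close>)
    then obtain L :: nat and g where g: "g \<in> Pow U \<rightarrow> carrier S"
      "\<And>s. s \<subseteq> U \<Longrightarrow> card s = q \<Longrightarrow> y [^] L \<otimes> f' s = kdiff S x M g s"
      unfolding cobounding_def by blast
    \<comment> \<open>Over sets containing \<open>u\<close> the cochain \<open>g\<close> enters with
      a minus sign, so that in the differential of the cone the terms with \<open>b\<close> cancel
      and the term with \<open>f\<close> remains.\<close>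
    define B where "B s = (if u \<in> s then ksign S u s \<otimes> (\<ominus> \<one> \<otimes> (kprod S x (s - {u}) [^] L \<otimes> g (s - {u})))
      else kprod S x s [^] L \<otimes> b s)" for s
    have gc: "g s \<in> carrier S" and bc: "b s \<in> carrier S" if "s \<subseteq> U" for s
      using that g b by auto
    have kpU: "kprod S x s \<in> carrier S" if "s \<subseteq> U" for s using kpc that by auto
    have B: "B \<in> Pow ?V \<rightarrow> carrier S"
    proof
      fix s assume "s \<in> Pow ?V"
      then have "s - {u} \<subseteq> U" "u \<notin> s \<Longrightarrow> s \<subseteq> U" by auto
      then show "B s \<in> carrier S" using gc bc kpU by (auto simp: B_def)
    qed
    have KB: "kprod S x s [^] L \<otimes> m1 s = kdiff S x (M + L) B s" if s: "s \<subseteq> ?V" "card s = p" for s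
    proof (cases "u \<in> s")
      case True
      define t where "t = s - {u}"
      have t: "s = insert u t" "u \<notin> t" "t \<subseteq> U" "finite t" "card t = q"
        using True s fin [of s] Suc by (auto simp: t_def card_Diff_singleton)
      let ?h = "\<lambda>t. kprod S x t [^] L \<otimes> g t"
      have hc: "?h \<in> Pow U \<rightarrow> carrier S" using gc kpU by auto
      define k where "k = kprod S x t [^] L"
      define e where "e = ksign S u s"
      define z where "z = y [^] M"
      define w where "w = y [^] L"
      have cl: "k \<in> carrier S" "e \<in> carrier S" "z \<in> carrier S" "w \<in> carrier S" "b t \<in> carrier S"
         "f t \<in> carrier S" "m1 s \<in> carrier S"
        using kpU t y bc f m1 s by (auto simp: k_def e_def z_def w_def)
      have "kdiff S x (M + L) (\<lambda>s. ksign S u (insert u s) \<otimes> B (insert u s)) t =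
        kdiff S x (M + L) (\<lambda>t. \<ominus> \<one> \<otimes> ?h t) t"
      proof (rule kdiff_cong [OF t(3) xU])
        show "(\<lambda>t. \<ominus> \<one> \<otimes> ?h t) \<in> Pow U \<rightarrow> carrier S" using gc kpU by auto
        fix j assume "j \<in> t"
        have "?h (t - {j}) \<in> carrier S" by (rule funcset_PowD [OF hc]) (use t in auto)
        moreover have "insert u (t - {j}) - {u} = t - {j}" using t(2) by auto
        ultimately show "ksign S u (insert u (t - {j})) \<otimes> B (insert u (t - {j})) = \<ominus> \<one> \<otimes> ?h (t - {j})"
          unfolding B_def by simp
      qed
      also have "\<dots> = \<ominus> \<one> \<otimes> kdiff S x (M + L) ?h t"
        by (rule kdiff_scale [OF t(4,3) xU hc]) simp
      also have "kdiff S x (M + L) ?h t = k \<otimes> (w \<otimes> f' t)"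
        using kdiff_shift [OF t(4,3) xU g(1), of M L] g(2) [OF t(3,5)] by (simp add: k_def w_def)
      also have "f' t = f t \<oplus> (\<ominus> z) \<otimes> b t" by (simp add: f'_def z_def)
      finally have 1: "kdiff S x (M + L) (\<lambda>s. ksign S u (insert u s) \<otimes> B (insert u s)) t =
         \<ominus> (k \<otimes> (w \<otimes> f t)) \<oplus> k \<otimes> (w \<otimes> (z \<otimes> b t))"
        using minus_one_distr [of k w "f t" z "b t"] cl by (simp del: One_nat_def)
      have "kdiff S x (M + L) B s = e \<otimes> (y [^] (M + L) \<otimes> B t \<ominus>
          kdiff S x (M + L) (\<lambda>s. ksign S u (insert u s) \<otimes> B (insert u s)) t)"
        using kdiff_insert [OF t(4,2) _ xV B, of "M + L"] s(1) t by (simp add: y_def e_def)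
      also have "y [^] (M + L) \<otimes> B t = k \<otimes> (w \<otimes> (z \<otimes> b t))"
      proof -
        have "y [^] (M + L) = z \<otimes> w" using y by (simp add: z_def w_def nat_pow_mult)
        moreover have "B t = k \<otimes> b t" using t(2) by (simp add: B_def k_def)
        ultimately show ?thesis using cl by (simp add: m_ac)
      qed
      finally have "kdiff S x (M + L) B s = e \<otimes> (k \<otimes> (w \<otimes> f t))"
        unfolding 1 using cl by (simp add: minus_uminus_add)
      also have "f t = e \<otimes> m1 s" by (simp add: f_def e_def t)
      also have "e \<otimes> (k \<otimes> (w \<otimes> (e \<otimes> m1 s))) = (e \<otimes> e) \<otimes> (k \<otimes> (w \<otimes> m1 s))"
        using cl by (simp add: m_ac)
      also have "\<dots> = k \<otimes> w \<otimes> m1 s" using cl by (simp add: e_def m_assoc)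
      also have "k \<otimes> w = kprod S x s [^] L"
      proof -
        have "kprod S x s = y \<otimes> kprod S x t"
          unfolding t(1) y_def by (rule kprod_insert) (use t xV in auto)
        then show ?thesis using y kpU [OF t(3)] by (simp add: k_def w_def nat_pow_distrib m_comm)
      qed
      finally show ?thesis by simp
    next
      case False
      then have sU: "s \<subseteq> U" using s by auto
      have "kdiff S x (M + L) B s = kdiff S x (M + L) (\<lambda>t. kprod S x t [^] L \<otimes> b t) s"
        by (rule kdiff_cong [OF sU xU]) (use False kpU bc in \<open>auto simp: B_def\<close>)
      also have "\<dots> = kprod S x s [^] L \<otimes> kdiff S x M b s"
        by (rule kdiff_shift [OF fin [OF s(1)] sU xU b(1)])
      also have "\<dots> = kprod S x s [^] L \<otimes> m1 s" using kb [OF sU s(2)] by simp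
      finally show ?thesis by simp
    qed
    show ?thesis
    proof (intro exI bexI allI impI)
      fix s assume s: "s \<subseteq> ?V" "card s = p"
      have "kprod S x s [^] (T + L) \<otimes> m s = kprod S x s [^] L \<otimes> m1 s"
        using kpc [OF s(1)] funcset_PowD [OF m s(1)]
        by (simp add: m1_def nat_pow_mult [symmetric] m_ac)
      also have "\<dots> = kdiff S x (N + (T + L)) B s" using KB [OF s] by (simp add: M_def add.assoc)
      finally show "kprod S x s [^] (T + L) \<otimes> m s = kdiff S x (N + (T + L)) B s" .
    qed (rule B)
  qed
qed

text \<open>The members of \<open>V\<close> are added one at a time; each lies in the ideal of the
  generators already present, so both halves of the cone argument apply.\<close>

lemma cech_vanishes_union:
  assumes "finite V" "finite U" "U \<inter> V = {}" "x \<in> U \<union> V \<rightarrow> hcomp S 1"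
    and "x ` V \<subseteq> genideal S (x ` U)"
  shows "cech_vanishes S x (U \<union> V) p n \<longleftrightarrow> cech_vanishes S x U p n"
  using assms
proof (induction V)
  case (insert v V)
  have "x ` U \<subseteq> carrier S" "x ` (U \<union> V) \<subseteq> carrier S" proof -
    have "x \<in> insert v (U \<union> V) \<rightarrow> carrier S" using insert.prems hcomp_closed by blast
    then show "x ` U \<subseteq> carrier S" "x ` (U \<union> V) \<subseteq> carrier S" by auto
  qed
  then have "genideal S (x ` U) \<subseteq> genideal S (x ` (U \<union> V))"
    using genideal_self [of "x ` (U \<union> V)"] by (intro genideal_minimal genideal_ideal) auto
  then have gen: "x v \<in> genideal S (x ` (U \<union> V))" using insert.prems by auto
  have fin: "finite (U \<union> V)" "v \<notin> U \<union> V" "x \<in> insert v (U \<union> V) \<rightarrow> hcomp S 1"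
    using insert.hyps insert.prems by auto
  have "cech_vanishes S x (insert v (U \<union> V)) p n \<longleftrightarrow> cech_vanishes S x (U \<union> V) p n"
    using cech_vanishes_insertD [OF fin gen] cech_vanishes_insertI [OF fin gen] by blast
  also have "\<dots> \<longleftrightarrow> cech_vanishes S x U p n"
    by (rule insert.IH) (use insert.prems in auto)
  finally show ?case by simp
qed simp

lemma cech_vanishes_reindex:
  assumes "strict_mono \<phi>" "x \<in> \<phi> ` U \<rightarrow> hcomp S 1" "\<And>i. i \<in> U \<Longrightarrow> y i = x (\<phi> i)"
  shows "cech_vanishes S y U p n \<longleftrightarrow> cech_vanishes S x (\<phi> ` U) p n"
proof -
  have inj: "inj \<phi>" using assms(1) by (rule strict_mono_imp_inj_on)
  have x: "x \<in> \<phi> ` U \<rightarrow> carrier S" using assms(2) hcomp_closed by auto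
  have card: "card (\<phi> ` s) = card s" for s
    by (rule card_image) (use inj in \<open>auto simp: inj_on_def inj_def\<close>)
  have kp: "kprod S x (\<phi> ` s) = kprod S y s" if "s \<subseteq> U" for s
  proof -
    have "kprod S x (\<phi> ` s) = (\<Otimes>i\<in>s. x (\<phi> i))"
      unfolding kprod_def
    proof (rule finprod_reindex)
      show "x \<in> \<phi> ` s \<rightarrow> carrier S" using x that by auto
    qed (use inj in \<open>auto simp: inj_on_def inj_def\<close>)
    also have "\<dots> = kprod S y s"
      unfolding kprod_def by (rule finprod_cong') (use x that in \<open>auto simp: subset_eq assms(3)\<close>)
    finally show ?thesis .
  qed
  have vi: "\<phi> -` (\<phi> ` s) = s" for s using inj by (rule inj_vimage_image_eq)
  have vc: "(\<lambda>t. c (\<phi> -` t)) \<in> Pow (\<phi> ` U) \<rightarrow> carrier S" if "c \<in> Pow U \<rightarrow> carrier S" for c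
  proof
    fix t assume "t \<in> Pow (\<phi> ` U)"
    then obtain r where "r \<subseteq> U" "t = \<phi> ` r" by (auto simp: subset_image_iff)
    then show "c (\<phi> -` t) \<in> carrier S" using funcset_PowD [OF that] by (simp add: vi)
  qed
  have kd: "kdiff S y N (\<lambda>t. c (\<phi> ` t)) s = kdiff S x N c (\<phi> ` s)"
    if "s \<subseteq> U" "c \<in> Pow (\<phi> ` U) \<rightarrow> carrier S" for s c N
    by (rule kdiff_reindex [OF assms(1) that(1) x that(2) assms(3)])
  have kd': "kdiff S x N (\<lambda>t. c (\<phi> -` t)) (\<phi> ` s) = kdiff S y N c s"
    if "s \<subseteq> U" "c \<in> Pow U \<rightarrow> carrier S" for s c N
  proof -
    have "(\<lambda>t. c (\<phi> -` t)) \<in> Pow (\<phi> ` U) \<rightarrow> carrier S"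
      using that(2) by (rule vc)
    from kd [OF that(1) this] show ?thesis by (simp add: vi)
  qed
  show ?thesis
  proof
    assume L: "cech_vanishes S y U p n"
    show "cech_vanishes S x (\<phi> ` U) p n"
      unfolding cech_vanishes_def
    proof (intro allI ballI impI)
      fix N m assume m: "m \<in> Pow (\<phi> ` U) \<rightarrow> carrier S"
        and hom: "\<forall>s\<subseteq>\<phi> ` U. card s = p \<longrightarrow> m s \<in> gcomp S (n + int (N * p))"
        and cyc: "\<forall>s\<subseteq>\<phi> ` U. card s = Suc p \<longrightarrow> kdiff S x N m s = \<zero>"
      have 1: "(\<lambda>s. m (\<phi> ` s)) \<in> Pow U \<rightarrow> carrier S" by (auto intro!: funcset_PowD [OF m])
      have 2: "\<forall>s\<subseteq>U. card s = p \<longrightarrow> m (\<phi> ` s) \<in> gcomp S (n + int (N * p))"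
        using hom card by (simp add: image_mono)
      have 3: "\<forall>s\<subseteq>U. card s = Suc p \<longrightarrow> kdiff S y N (\<lambda>s. m (\<phi> ` s)) s = \<zero>"
        using cyc card kd [OF _ m] by (simp add: image_mono)
      obtain T b where b0: "b \<in> Pow U \<rightarrow> carrier S"
          "\<forall>s\<subseteq>U. card s = p \<longrightarrow> kprod S y s [^] T \<otimes> m (\<phi> ` s) = kdiff S y (N + T) b s"
        using cech_vanishesD [OF L 1 2 3] by (elim exE bexE)
      have b: "b \<in> Pow U \<rightarrow> carrier S"
        "\<And>s. s \<subseteq> U \<Longrightarrow> card s = p \<Longrightarrow> kprod S y s [^] T \<otimes> m (\<phi> ` s) = kdiff S y (N + T) b s"
        using b0 by simp_all
      show "\<exists>T. \<exists>b\<in>Pow (\<phi> ` U) \<rightarrow> carrier S. \<forall>s\<subseteq>\<phi> ` U. card s = p \<longrightarrow>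
        kprod S x s [^] T \<otimes> m s = kdiff S x (N + T) b s"
      proof (intro exI bexI allI impI)
        fix s assume s: "s \<subseteq> \<phi> ` U" "card s = p"
        then obtain t where t: "t \<subseteq> U" "s = \<phi> ` t" by (auto simp: subset_image_iff)
        show "kprod S x s [^] T \<otimes> m s = kdiff S x (N + T) (\<lambda>t. b (\<phi> -` t)) s"
          using b t s kp kd' card by simp
      qed (rule vc [OF b(1)])
    qed
  next
    assume L: "cech_vanishes S x (\<phi> ` U) p n"
    show "cech_vanishes S y U p n"
      unfolding cech_vanishes_def
    proof (intro allI ballI impI)
      fix N m assume m: "m \<in> Pow U \<rightarrow> carrier S"
        and hom: "\<forall>s\<subseteq>U. card s = p \<longrightarrow> m s \<in> gcomp S (n + int (N * p))"
        and cyc: "\<forall>s\<subseteq>U. card s = Suc p \<longrightarrow> kdiff S y N m s = \<zero>"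
      have 1: "(\<lambda>s. m (\<phi> -` s)) \<in> Pow (\<phi> ` U) \<rightarrow> carrier S"
        using m by (rule vc)
      have 2: "\<forall>s\<subseteq>\<phi> ` U. card s = p \<longrightarrow> m (\<phi> -` s) \<in> gcomp S (n + int (N * p))"
        using hom card by (auto simp: subset_image_iff vi)
      have 3: "\<forall>s\<subseteq>\<phi> ` U. card s = Suc p \<longrightarrow> kdiff S x N (\<lambda>s. m (\<phi> -` s)) s = \<zero>"
        using cyc card kd' [OF _ m] by (auto simp: subset_image_iff vi)
      obtain T b where b0: "b \<in> Pow (\<phi> ` U) \<rightarrow> carrier S"
          "\<forall>s\<subseteq>\<phi> ` U. card s = p \<longrightarrow> kprod S x s [^] T \<otimes> m (\<phi> -` s) = kdiff S x (N + T) b s"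
        using cech_vanishesD [OF L 1 2 3] by (elim exE bexE)
      have b: "b \<in> Pow (\<phi> ` U) \<rightarrow> carrier S"
        "\<And>s. s \<subseteq> \<phi> ` U \<Longrightarrow> card s = p \<Longrightarrow> kprod S x s [^] T \<otimes> m (\<phi> -` s) = kdiff S x (N + T) b s"
        using b0 by simp_all
      show "\<exists>T. \<exists>b\<in>Pow U \<rightarrow> carrier S. \<forall>s\<subseteq>U. card s = p \<longrightarrow>
        kprod S y s [^] T \<otimes> m s = kdiff S y (N + T) b s"
      proof (intro exI bexI allI impI)
        fix s assume s: "s \<subseteq> U" "card s = p"
        show "kprod S y s [^] T \<otimes> m s = kdiff S y (N + T) (\<lambda>t. b (\<phi> ` t)) s"
          using b(2) [of "\<phi> ` s"] s kp kd [OF s(1) b(1)] card by (simp add: vi image_mono)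
      qed (auto intro!: funcset_PowD [OF b(1)])
    qed
  qed
qed

lemma cech_vanishes_generators:
  assumes "set xs \<subseteq> hcomp S 1" "set ys \<subseteq> hcomp S 1"
    and "set xs \<subseteq> genideal S (set ys)" "set ys \<subseteq> genideal S (set xs)"
  shows "cech_vanishes S (nth xs) {..<length xs} p n \<longleftrightarrow> cech_vanishes S (nth ys) {..<length ys} p n"
proof -
  define z where "z = (!) (xs @ ys)"
  let ?U = "{..<length xs}" and ?W = "{..<length ys}"
  \<comment> \<open>The position of the entries of \<open>ys\<close> inside \<open>xs @ ys\<close>;
    a shift is strictly monotone and keeps the signs.\<close>
  let ?\<phi> = "\<lambda>i. i + length xs"
  have sm: "strict_mono ?\<phi>" "strict_mono (id :: nat \<Rightarrow> nat)" by (auto simp: strict_mono_def)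
  have zU: "z ` ?U = set xs" by (auto simp: z_def set_conv_nth nth_append image_iff)
  have "z ` ?\<phi> ` ?W = (!) ys ` ?W"
    unfolding image_image by (rule image_cong) (auto simp: z_def nth_append)
  then have zV: "z ` ?\<phi> ` ?W = set ys" by (auto simp: set_conv_nth)
  have z: "z \<in> ?U \<union> ?\<phi> ` ?W \<rightarrow> hcomp S 1"
    using zU zV assms by blast
  have "cech_vanishes S (nth xs) ?U p n \<longleftrightarrow> cech_vanishes S z (id ` ?U) p n"
    by (rule cech_vanishes_reindex [OF sm(2)]) (use z in \<open>auto simp: z_def nth_append\<close>)
  also have "\<dots> \<longleftrightarrow> cech_vanishes S z (?U \<union> ?\<phi> ` ?W) p n"
    using cech_vanishes_union [of "?\<phi> ` ?W" ?U z p n] z assms by (auto simp: zU zV)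
  also have "\<dots> \<longleftrightarrow> cech_vanishes S z (?\<phi> ` ?W) p n"
    using cech_vanishes_union [of ?U "?\<phi> ` ?W" z p n] z assms by (auto simp: zU zV Un_commute)
  also have "\<dots> \<longleftrightarrow> cech_vanishes S (nth ys) ?W p n"
    by (rule cech_vanishes_reindex [OF sm(1), symmetric]) (use z in \<open>auto simp: z_def nth_append\<close>)
  finally show ?thesis .
qed

end


section \<open>Cech cochains as fractions\<close>

lemma self_module_simps [simp]:
  "carrier (self_module S) = carrier S"
  "\<zero>\<^bsub>self_module S\<^esub> = \<zero>\<^bsub>S\<^esub>"
  "ring.add (self_module S) = ring.add S"
  "module.smult (self_module S) = monoid.mult S"
  "mcomp (self_module S) n = gcomp S n"
  by (simp_all add: self_module_def gcomp_def)

section \<open>Localization at the powers of one element\<close>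

context graded_cring
begin

abbreviation fc :: "'a \<Rightarrow> 'a \<Rightarrow> nat \<Rightarrow> ('a \<times> nat) set" where
  "fc \<equiv> frac_class S (self_module S)"

abbreviation loc :: "'a \<Rightarrow> nat \<Rightarrow> ('a, ('a \<times> nat) set) graded_module" where
  "loc \<equiv> localization S (self_module S)"

lemma mem_fc: "(m', k') \<in> fc f m k \<longleftrightarrow>
    m' \<in> carrier S \<and> (\<exists>t::nat. f [^] (t + k') \<otimes> m = f [^] (t + k) \<otimes> m')"
  by (simp add: frac_class_def)

lemma fc_refl: "m \<in> carrier S \<Longrightarrow> (m, k) \<in> fc f m k"
  by (auto simp: mem_fc)

lemma fc_sym: "m \<in> carrier S \<Longrightarrow> (m', k') \<in> fc f m k \<Longrightarrow> (m, k) \<in> fc f m' k'"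
  by (auto simp: mem_fc intro: sym)

lemma fc_trans:
  assumes f: "f \<in> carrier S" and m: "m \<in> carrier S"
    and 1: "(m', k') \<in> fc f m k" and 2: "(m'', k'') \<in> fc f m' k'"
  shows "(m'', k'') \<in> fc f m k"
proof -
  obtain t u :: nat where t: "f [^] (t + k') \<otimes> m = f [^] (t + k) \<otimes> m'" and m': "m' \<in> carrier S"
    and u: "f [^] (u + k'') \<otimes> m' = f [^] (u + k') \<otimes> m''" and m'': "m'' \<in> carrier S"
    using 1 2 by (auto simp: mem_fc)
  have "f [^] ((t + u + k') + k'') \<otimes> m = f [^] (u + k'') \<otimes> (f [^] (t + k') \<otimes> m)"
    using f m by (simp add: m_assoc [symmetric] nat_pow_mult ac_simps)
  also have "\<dots> = f [^] (t + k) \<otimes> (f [^] (u + k'') \<otimes> m')"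
    unfolding t using f m' by (simp add: m_ac)
  also have "\<dots> = f [^] ((t + u + k') + k) \<otimes> m''"
    unfolding u using f m'' by (simp add: m_assoc [symmetric] nat_pow_mult ac_simps)
  finally show ?thesis using m'' by (auto simp: mem_fc)
qed

lemma fc_eqI:
  assumes "f \<in> carrier S" "m \<in> carrier S" "(m', k') \<in> fc f m k"
  shows "fc f m' k' = fc f m k"
proof -
  have m': "m' \<in> carrier S" using assms(3) by (simp add: mem_fc)
  have s: "(m, k) \<in> fc f m' k'" using assms fc_sym by blast
  show ?thesis
  proof (intro equalityI subrelI)
    show "(a, k'') \<in> fc f m k" if "(a, k'') \<in> fc f m' k'" for a k''
      using assms that by (rule fc_trans)
    show "(a, k'') \<in> fc f m' k'" if "(a, k'') \<in> fc f m k" for a k''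
      using assms(1) m' s that by (rule fc_trans)
  qed
qed

lemma fc_eq_iff:
  assumes "f \<in> carrier S" "m \<in> carrier S" "m' \<in> carrier S"
  shows "fc f m k = fc f m' k' \<longleftrightarrow> (\<exists>t::nat. f [^] (t + k') \<otimes> m = f [^] (t + k) \<otimes> m')"
proof
  assume "fc f m k = fc f m' k'"
  then have "(m', k') \<in> fc f m k" using fc_refl [OF assms(3)] by simp
  then show "\<exists>t::nat. f [^] (t + k') \<otimes> m = f [^] (t + k) \<otimes> m'" by (simp add: mem_fc)
next
  assume "\<exists>t::nat. f [^] (t + k') \<otimes> m = f [^] (t + k) \<otimes> m'"
  then have "(m', k') \<in> fc f m k" using assms(3) by (simp add: mem_fc)
  then show "fc f m k = fc f m' k'" using fc_eqI [OF assms(1,2)] by simp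
qed

lemma fc_raise:
  assumes "f \<in> carrier S" "m \<in> carrier S"
  shows "fc f (f [^] T \<otimes> m) (k + T) = fc f m k"
proof (rule fc_eqI [OF assms])
  have "f [^] (0 + (k + T)) \<otimes> m = f [^] (0 + k) \<otimes> (f [^] T \<otimes> m)"
    using assms by (simp add: m_assoc [symmetric] nat_pow_mult)
  then show "(f [^] T \<otimes> m, k + T) \<in> fc f m k"
    using assms unfolding mem_fc by blast
qed

lemma fc_zero:
  assumes "f \<in> carrier S"
  shows "fc f \<zero> k = fc f \<zero> l"
  using assms by (subst fc_eq_iff) auto

lemma UN_pair_const:
  assumes "x \<in> A" "\<And>m k. (m, k) \<in> A \<Longrightarrow> F m k = c"
  shows "(\<Union>(m, k)\<in>A. F m k) = c"
proof (rule SUP_eq_const)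
  show "(case p of (m, k) \<Rightarrow> F m k) = c" if "p \<in> A" for p
    using assms(2) that by (cases p) simp
qed (use assms(1) in auto)

text \<open>\<open>localization\<close> forms a sum as a union over all pairs of representatives.
  Each pair yields the same class, so the union is that class; for equal exponents it is found by
  adding numerators.\<close>

lemma loc_add:
  assumes f: "f \<in> carrier S" and m: "m \<in> carrier S" "m' \<in> carrier S"
  shows "fc f m k \<oplus>\<^bsub>loc f d\<^esub> fc f m' k = fc f (m \<oplus> m') k"
proof -
  have w: "fc f ((f [^] k2 \<otimes> m1) \<oplus> (f [^] k1 \<otimes> m2)) (k1 + k2) = fc f ((f [^] k \<otimes> m) \<oplus> (f [^] k \<otimes> m')) (k + k)"
    if a: "(m1, k1) \<in> fc f m k" and b: "(m2, k2) \<in> fc f m' k" for m1 k1 m2 k2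
  proof -
    obtain t u :: nat where t: "f [^] (t + k1) \<otimes> m = f [^] (t + k) \<otimes> m1" and m1: "m1 \<in> carrier S"
      and u: "f [^] (u + k2) \<otimes> m' = f [^] (u + k) \<otimes> m2" and m2: "m2 \<in> carrier S"
      using a b by (auto simp: mem_fc)
    have "f [^] ((t + u) + (k1 + k2)) \<otimes> (f [^] k \<otimes> m \<oplus> f [^] k \<otimes> m') =
      f [^] (u + k2 + k) \<otimes> (f [^] (t + k1) \<otimes> m) \<oplus> f [^] (t + k1 + k) \<otimes> (f [^] (u + k2) \<otimes> m')"
      using f m by (simp add: r_distr m_assoc [symmetric] nat_pow_mult ac_simps)
    also have "\<dots> = f [^] ((t + u) + (k + k)) \<otimes> (f [^] k2 \<otimes> m1 \<oplus> f [^] k1 \<otimes> m2)"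
      unfolding t u using f m1 m2 by (simp add: r_distr m_assoc [symmetric] nat_pow_mult ac_simps)
    finally show ?thesis
      using f m m1 m2 by (intro fc_eqI) (auto simp: mem_fc)
  qed
  have "fc f m k \<oplus>\<^bsub>loc f d\<^esub> fc f m' k = fc f ((f [^] k \<otimes> m) \<oplus> (f [^] k \<otimes> m')) (k + k)"
    unfolding localization_def
    by (simp, rule UN_pair_const [OF fc_refl [OF m(1)]], rule UN_pair_const [OF fc_refl [OF m(2)]], rule w)
  also have "(f [^] k \<otimes> m) \<oplus> (f [^] k \<otimes> m') = f [^] k \<otimes> (m \<oplus> m')"
    using f m by (simp add: r_distr)
  finally show ?thesis using fc_raise f m by simp
qed

lemma loc_carrier: "carrier (loc f d) = {fc f m k | m k. m \<in> carrier S}"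
  by (simp add: localization_def)

lemma loc_zero: "\<zero>\<^bsub>loc f d\<^esub> = fc f \<zero> 0"
  by (simp add: localization_def)

lemma loc_mcomp: "mcomp (loc f d) n = {fc f m k | m k. m \<in> gcomp S (n + int k * int d)}"
  by (simp add: localization_def)

lemma fc_closed: "m \<in> carrier S \<Longrightarrow> fc f m k \<in> carrier (loc f d)"
  by (auto simp: loc_carrier)

text \<open>Three fractions at once, because associativity needs one denominator for all
  three.\<close>

lemma loc_common3:
  assumes "f \<in> carrier S" "a \<in> carrier (loc f d)" "b \<in> carrier (loc f d)" "c \<in> carrier (loc f d)"
  obtains m1 m2 m3 k where "m1 \<in> carrier S" "m2 \<in> carrier S" "m3 \<in> carrier S"
    "a = fc f m1 k" "b = fc f m2 k" "c = fc f m3 k"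
proof -
  obtain m1 k1 m2 k2 m3 k3 where m: "m1 \<in> carrier S" "m2 \<in> carrier S" "m3 \<in> carrier S"
    "a = fc f m1 k1" "b = fc f m2 k2" "c = fc f m3 k3"
    using assms by (auto simp: loc_carrier)
  have "a = fc f (f [^] (k2 + k3) \<otimes> m1) (k1 + (k2 + k3))"
    "b = fc f (f [^] (k1 + k3) \<otimes> m2) (k2 + (k1 + k3))"
    "c = fc f (f [^] (k1 + k2) \<otimes> m3) (k3 + (k1 + k2))"
    using m assms(1) by (simp_all only: fc_raise)
  then show ?thesis
    using that [of "f [^] (k2 + k3) \<otimes> m1" "f [^] (k1 + k3) \<otimes> m2" "f [^] (k1 + k2) \<otimes> m3" "k1 + k2 + k3"]
      m assms(1) by (simp add: ac_simps)
qed

lemma loc_abelian_group: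
  assumes f: "f \<in> carrier S"
  shows "abelian_group (loc f d)"
proof (rule abelian_groupI)
  fix a b c assume abc: "a \<in> carrier (loc f d)" "b \<in> carrier (loc f d)" "c \<in> carrier (loc f d)"
  obtain m1 m2 m3 k where m: "m1 \<in> carrier S" "m2 \<in> carrier S" "m3 \<in> carrier S"
    "a = fc f m1 k" "b = fc f m2 k" "c = fc f m3 k"
    using loc_common3 [OF f abc] by metis
  show "a \<oplus>\<^bsub>loc f d\<^esub> b \<oplus>\<^bsub>loc f d\<^esub> c = a \<oplus>\<^bsub>loc f d\<^esub> (b \<oplus>\<^bsub>loc f d\<^esub> c)"
    using m f by (simp add: loc_add a_assoc)
next
  fix a b assume ab: "a \<in> carrier (loc f d)" "b \<in> carrier (loc f d)"
  obtain m1 m2 m3 k where m: "m1 \<in> carrier S" "m2 \<in> carrier S"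
    "a = fc f m1 k" "b = fc f m2 k"
    using loc_common3 [OF f ab ab(2)] by metis
  show "a \<oplus>\<^bsub>loc f d\<^esub> b \<in> carrier (loc f d)"
    using m f by (simp add: loc_add fc_closed)
  show "a \<oplus>\<^bsub>loc f d\<^esub> b = b \<oplus>\<^bsub>loc f d\<^esub> a"
    using m f by (simp add: loc_add a_comm)
next
  show "\<zero>\<^bsub>loc f d\<^esub> \<in> carrier (loc f d)" by (simp add: loc_zero fc_closed)
next
  fix a assume "a \<in> carrier (loc f d)"
  then obtain m k where m: "m \<in> carrier S" "a = fc f m k" by (auto simp: loc_carrier)
  have z: "\<zero>\<^bsub>loc f d\<^esub> = fc f \<zero> k" using f by (simp add: loc_zero fc_zero)
  show "\<zero>\<^bsub>loc f d\<^esub> \<oplus>\<^bsub>loc f d\<^esub> a = a" using m f by (simp add: z loc_add)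
  show "\<exists>b\<in>carrier (loc f d). b \<oplus>\<^bsub>loc f d\<^esub> a = \<zero>\<^bsub>loc f d\<^esub>"
    using m f by (intro bexI [of _ "fc f (\<ominus> m) k"]) (simp_all add: z loc_add fc_closed l_neg)
qed

lemma loc_uminus:
  assumes f: "f \<in> carrier S" and m: "m \<in> carrier S"
  shows "\<ominus>\<^bsub>loc f d\<^esub> fc f m k = fc f (\<ominus> m) k"
proof -
  interpret L: abelian_group "loc f d" using f by (rule loc_abelian_group)
  have z: "\<zero>\<^bsub>loc f d\<^esub> = fc f \<zero> k" using f by (simp add: loc_zero fc_zero)
  show ?thesis
    by (rule L.minus_equality) (use f m in \<open>simp_all add: fc_closed loc_add z l_neg\<close>)
qed

lemma loc_finsum:
  assumes f: "f \<in> carrier S" and "finite A" "\<And>i. i \<in> A \<Longrightarrow> g i \<in> carrier S"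
  shows "(\<Oplus>\<^bsub>loc f d\<^esub> i\<in>A. fc f (g i) k) = fc f (\<Oplus>i\<in>A. g i) k"
proof -
  interpret L: abelian_group "loc f d" using f by (rule loc_abelian_group)
  show ?thesis
    using assms(2,3)
  proof (induction A)
    case empty
    then show ?case using f by (simp add: loc_zero fc_zero)
  next
    case (insert a A)
    have 1: "g a \<in> carrier S" "g \<in> A \<rightarrow> carrier S" using insert.prems by auto
    have "(\<Oplus>\<^bsub>loc f d\<^esub> i\<in>insert a A. fc f (g i) k) =
        fc f (g a) k \<oplus>\<^bsub>loc f d\<^esub> (\<Oplus>\<^bsub>loc f d\<^esub> i\<in>A. fc f (g i) k)"
      by (rule L.finsum_insert) (use insert.hyps 1 in \<open>auto intro!: fc_closed\<close>)
    also have "(\<Oplus>\<^bsub>loc f d\<^esub> i\<in>A. fc f (g i) k) = fc f (\<Oplus>i\<in>A. g i) k"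
      by (rule insert.IH) (use insert.prems in auto)
    also have "fc f (g a) k \<oplus>\<^bsub>loc f d\<^esub> \<dots> = fc f (g a \<oplus> (\<Oplus>i\<in>A. g i)) k"
      by (rule loc_add) (use f 1 in auto)
    also have "g a \<oplus> (\<Oplus>i\<in>A. g i) = (\<Oplus>i\<in>insert a A. g i)"
      by (rule finsum_insert [symmetric]) (use insert.hyps 1 in auto)
    finally show ?case .
  qed
qed

end

section \<open>The Cech complex of a list of degree-one elements\<close>

locale graded_cring_seq = graded_cring S pr
  for S :: "('a, 'b) graded_ring_scheme" (structure) and pr +
  fixes xs :: "'a list"
  assumes xs: "set xs \<subseteq> hcomp S 1"
begin

abbreviation x :: "nat \<Rightarrow> 'a" where "x \<equiv> nth xs"
abbreviation U :: "nat set" where "U \<equiv> {..<length xs}"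

lemma x_hcomp: "x \<in> U \<rightarrow> hcomp S 1"
  using xs by auto

lemma x_closed: "x \<in> U \<rightarrow> carrier S"
  using x_hcomp hcomp_closed by blast

lemma fin_sub: "s \<subseteq> U \<Longrightarrow> finite s"
  using finite_subset by blast

abbreviation F :: "nat set \<Rightarrow> 'a" where "F \<equiv> kprod S x"

lemma F_closed: "s \<subseteq> U \<Longrightarrow> F s \<in> carrier S"
  using x_closed by (rule_tac kprod_closed')

lemma F_pow_hcomp: "s \<subseteq> U \<Longrightarrow> F s [^] (T::nat) \<in> hcomp S (card s * T)"
  by (rule hcomp_pow, rule kprod_hcomp) (use fin_sub x_hcomp in auto)

lemma cech_loc_eq: "cech_loc S (self_module S) xs s = loc (F s) (card s)"
  by (simp add: cech_loc_def kprod_def)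

text \<open>The union over representatives in \<open>cech_res\<close> collapses:
  \<open>F s = x j \<otimes> F (s - {j})\<close>, so an equality of fractions over
  \<open>F (s - {j})\<close> persists over \<open>F s\<close> after multiplication by a power of
  \<open>x j\<close>.\<close>

lemma cech_res_fc:
  assumes s: "s \<subseteq> U" "j \<in> s" and m: "m \<in> carrier S"
  shows "cech_res S (self_module S) xs j s (fc (F (s - {j})) m k) = fc (F s) (x j [^] k \<otimes> m) k"
  unfolding cech_res_def self_module_simps kprod_def [symmetric]
proof (rule UN_pair_const)
  show "(m, k) \<in> fc (F (s - {j})) m k" using m by (rule fc_refl)
  fix m' k' assume "(m', k') \<in> fc (F (s - {j})) m k"
  then obtain t :: nat where m': "m' \<in> carrier S"
    and t: "F (s - {j}) [^] (t + k') \<otimes> m = F (s - {j}) [^] (t + k) \<otimes> m'"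
    by (auto simp: mem_fc)
  have xj: "x j \<in> carrier S" using s x_closed by auto
  have F': "F (s - {j}) \<in> carrier S" using s by (intro F_closed) auto
  have Fs: "F s = x j \<otimes> F (s - {j})"
    by (rule kprod_remove) (use s x_closed fin_sub in auto)
  have "F s [^] (t + k') \<otimes> (x j [^] k \<otimes> m) = x j [^] (t + k' + k) \<otimes> (F (s - {j}) [^] (t + k') \<otimes> m)"
    using xj F' m by (simp add: Fs nat_pow_distrib nat_pow_mult [symmetric] m_ac)
  also have "\<dots> = F s [^] (t + k) \<otimes> (x j [^] k' \<otimes> m')"
    unfolding t using xj F' m' by (simp add: Fs nat_pow_distrib nat_pow_mult [symmetric] m_ac)
  finally show "fc (F s) (x j [^] k' \<otimes> m') k' = fc (F s) (x j [^] k \<otimes> m) k"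
    using xj m m' s by (intro fc_eqI) (auto simp: mem_fc F_closed)
qed

abbreviation cech_cpx where "cech_cpx \<equiv> cech_cochains S (self_module S) xs"
abbreviation cech_d where "cech_d \<equiv> cech_diff S (self_module S) xs"

definition crep :: "nat \<Rightarrow> nat \<Rightarrow> (nat set \<Rightarrow> 'a) \<Rightarrow> nat set \<Rightarrow> ('a \<times> nat) set" where
  "crep p N m = (\<lambda>s\<in>cech_indices xs p. fc (F s) (m s) N)"

lemma cech_indices_iff: "s \<in> cech_indices xs p \<longleftrightarrow> s \<subseteq> U \<and> card s = p"
  by (simp add: cech_indices_def)

lemma finite_cech_indices: "finite (cech_indices xs p)"
  by (rule finite_subset [of _ "Pow U"]) (auto simp: cech_indices_def)

lemma crep_cong: "(\<And>s. s \<subseteq> U \<Longrightarrow> card s = p \<Longrightarrow> m s = m' s) \<Longrightarrow> crep p N m = crep p N m'"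
  unfolding crep_def by (rule restrict_ext) (auto simp: cech_indices_iff)

lemma cech_cpx_carrier:
  "c \<in> carrier (cech_cpx p n) \<longleftrightarrow> c \<in> extensional (cech_indices xs p) \<and>
     (\<forall>s\<subseteq>U. card s = p \<longrightarrow> (\<exists>k. \<exists>m\<in>gcomp S (n + int (k * p)). c s = fc (F s) m k))"
proof -
  have "c s \<in> mcomp (loc (F s) (card s)) n \<longleftrightarrow>
      (\<exists>k. \<exists>m\<in>gcomp S (n + int (k * p)). c s = fc (F s) m k)" if "card s = p" for s
    using that by (fastforce simp: loc_mcomp)
  then show ?thesis
    unfolding cech_cochains_def carrier_product_group cech_loc_eq PiE_iff
    by (auto simp: cech_indices_iff)
qed

lemma cech_cpx_one: "\<one>\<^bsub>cech_cpx p n\<^esub> = crep p N (\<lambda>s. \<zero>)"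
proof -
  have "\<zero>\<^bsub>loc (F s) p\<^esub> = fc (F s) \<zero> N" if "s \<in> cech_indices xs p" for s
    using that by (simp add: loc_zero cech_indices_iff F_closed fc_zero)
  then show ?thesis
    unfolding cech_cochains_def cech_loc_eq crep_def one_product_group
    by (intro restrict_ext) (auto simp: cech_indices_iff)
qed

lemma cech_cpx_mult:
  assumes "m \<in> Pow U \<rightarrow> carrier S" "m' \<in> Pow U \<rightarrow> carrier S"
  shows "crep p N m \<otimes>\<^bsub>cech_cpx p n\<^esub> crep p N m' = crep p N (\<lambda>s. m s \<oplus> m' s)"
proof -
  have "fc (F s) (m s) N \<oplus>\<^bsub>loc (F s) (card s)\<^esub> fc (F s) (m' s) N = fc (F s) (m s \<oplus> m' s) N"
    if "s \<subseteq> U" for s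
    by (rule loc_add) (use assms that F_closed in auto)
  then show ?thesis
    unfolding cech_cochains_def cech_loc_eq crep_def mult_product_group
    by (intro restrict_ext) (auto simp: cech_indices_iff)
qed

text \<open>The denominator \<open>F s [^] N\<close> over a \<open>p\<close>-element set has degree
  \<open>N * p\<close>, so these are numerators of fractions of degree \<open>n\<close>. Over sets
  of other sizes membership in the ring is enough, as \<open>crep p\<close> does not see those
  values.\<close>

definition homog :: "nat \<Rightarrow> int \<Rightarrow> nat \<Rightarrow> (nat set \<Rightarrow> 'a) \<Rightarrow> bool" where
  "homog p n N m \<longleftrightarrow> m \<in> Pow U \<rightarrow> carrier S \<and>
     (\<forall>s\<subseteq>U. card s = p \<longrightarrow> m s \<in> gcomp S (n + int (N * p)))"

lemma crep_mem: "homog p n N m \<Longrightarrow> crep p N m \<in> carrier (cech_cpx p n)"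
  unfolding cech_cpx_carrier homog_def by (auto simp: crep_def cech_indices_iff)

lemma shift_gcomp:
  assumes "s \<subseteq> U" "m \<in> gcomp S (n + int (N * card s))"
  shows "F s [^] T \<otimes> m \<in> gcomp S (n + int ((N + T) * card s))"
proof -
  have "F s [^] T \<otimes> m \<in> gcomp S (int (card s * T) + (n + int (N * card s)))"
    using F_pow_hcomp [OF assms(1)] assms(2) by (rule gcomp_mult)
  moreover have "int (card s * T) + (n + int (N * card s)) = n + int ((N + T) * card s)"
    by (simp add: algebra_simps)
  ultimately show ?thesis by metis
qed

lemma homog_shift:
  assumes "homog p n N m"
  shows "homog p n (N + T) (\<lambda>s. F s [^] T \<otimes> m s)"
  unfolding homog_def
proof (intro conjI funcsetI allI impI)
  show "F s [^] T \<otimes> m s \<in> carrier S" if "s \<in> Pow U" for s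
    using that assms F_closed by (auto simp: homog_def intro!: m_closed nat_pow_closed)
  show "F s [^] T \<otimes> m s \<in> gcomp S (n + int ((N + T) * p))" if "s \<subseteq> U" "card s = p" for s
    using shift_gcomp [of s "m s" n N T] that assms by (simp add: homog_def)
qed

lemma crep_shift:
  assumes "m \<in> Pow U \<rightarrow> carrier S"
  shows "crep p (N + T) (\<lambda>s. F s [^] T \<otimes> m s) = crep p N m"
  unfolding crep_def
  by (rule restrict_ext, rule fc_raise) (use funcset_PowD [OF assms] F_closed in \<open>auto simp: cech_indices_iff\<close>)

lemma crep_ex:
  assumes "c \<in> carrier (cech_cpx p n)"
  shows "\<exists>N m. homog p n N m \<and> c = crep p N m"
proof -
  have "\<forall>s\<in>cech_indices xs p. \<exists>k m. m \<in> gcomp S (n + int (k * p)) \<and> c s = fc (F s) m k"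
  proof
    fix s assume "s \<in> cech_indices xs p"
    then have "\<exists>k. \<exists>m\<in>gcomp S (n + int (k * p)). c s = fc (F s) m k"
      using assms unfolding cech_cpx_carrier cech_indices_iff by blast
    then show "\<exists>k m. m \<in> gcomp S (n + int (k * p)) \<and> c s = fc (F s) m k" by blast
  qed
  then obtain k m where km: "\<And>s. s \<in> cech_indices xs p \<Longrightarrow>
      m s \<in> gcomp S (n + int (k s * p)) \<and> c s = fc (F s) (m s) (k s)"
    by metis
  \<comment> \<open>There are finitely many index sets, and the sum of their exponents dominates
    each of them.\<close>
  define N where "N = (\<Sum>s\<in>cech_indices xs p. k s)"
  define m' where "m' s = (if s \<in> cech_indices xs p then F s [^] (N - k s) \<otimes> m s else \<zero>)" for s
  have N: "k s + (N - k s) = N" if "s \<in> cech_indices xs p" for s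
    using that finite_cech_indices by (simp add: N_def member_le_sum)
  have "homog p n N m'"
    unfolding homog_def
  proof (intro conjI funcsetI allI impI)
    show h: "m' s \<in> gcomp S (n + int (N * p))" if s: "s \<subseteq> U" "card s = p" for s
      using shift_gcomp [of s "m s" n "k s" "N - k s"] km [of s] N [of s] s
      by (simp add: m'_def cech_indices_iff)
    show "m' s \<in> carrier S" if "s \<in> Pow U" for s
      using gcomp_closed [OF h] that by (auto simp: m'_def cech_indices_iff)
  qed
  moreover have "c = crep p N m'"
  proof
    fix s show "c s = crep p N m' s"
    proof (cases "s \<in> cech_indices xs p")
      case True
      have "m s \<in> carrier S" using km [OF True] gcomp_closed by blast
      then have "fc (F s) (F s [^] (N - k s) \<otimes> m s) (k s + (N - k s)) = fc (F s) (m s) (k s)"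
        using True by (intro fc_raise) (auto simp: cech_indices_iff F_closed)
      then show ?thesis using True km [OF True] N [OF True] by (simp add: crep_def m'_def)
    next
      case False
      then show ?thesis using assms by (simp add: cech_cpx_carrier crep_def extensional_def)
    qed
  qed
  ultimately show ?thesis by blast
qed

lemma crep_ex2:
  assumes "c \<in> carrier (cech_cpx p n)" "c' \<in> carrier (cech_cpx p n)"
  shows "\<exists>N m m'. homog p n N m \<and> c = crep p N m \<and> homog p n N m' \<and> c' = crep p N m'"
proof -
  obtain N m N' m' where m: "homog p n N m" "c = crep p N m" "homog p n N' m'" "c' = crep p N' m'"
    using assms crep_ex by metis
  have "c = crep p (N + N') (\<lambda>s. F s [^] N' \<otimes> m s)" "c' = crep p (N' + N) (\<lambda>s. F s [^] N \<otimes> m' s)"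
    using m by (simp_all add: crep_shift homog_def)
  moreover have "homog p n (N + N') (\<lambda>s. F s [^] N' \<otimes> m s)"
    "homog p n (N' + N) (\<lambda>s. F s [^] N \<otimes> m' s)"
    using m homog_shift by blast+
  ultimately show ?thesis by (metis add.commute)
qed

text \<open>Over a common exponent \<open>N\<close>, restriction from \<open>s - {j}\<close> to
  \<open>s\<close> multiplies the numerator by \<open>x j [^] N\<close> and leaves the exponent
  alone. This turns the Cech differential into the Koszul differential of the powers.\<close>

lemma cech_d_crep:
  assumes "m \<in> Pow U \<rightarrow> carrier S"
  shows "cech_d p (crep p N m) = crep (Suc p) N (kdiff S x N m)"
proof
  fix s show "cech_d p (crep p N m) s = crep (Suc p) N (kdiff S x N m) s"
  proof (cases "s \<in> cech_indices xs (Suc p)")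
    case False
    then show ?thesis by (simp add: cech_diff_def crep_def)
  next
    case True
    then have s: "s \<subseteq> U" "card s = Suc p" "finite s" using fin_sub by (auto simp: cech_indices_iff)
    interpret L: abelian_group "loc (F s) (card s)" using s by (intro loc_abelian_group F_closed)
    have cl: "x j \<in> carrier S" "m (s - {j}) \<in> carrier S" "s - {j} \<in> cech_indices xs p" if "j \<in> s" for j
      using s that x_closed funcset_PowD [OF assms, of "s - {j}"] by (auto simp: cech_indices_iff)
    have t: "(let y = cech_res S (self_module S) xs j s (crep p N m (s - {j}))
        in if even (card {i \<in> s. i < j}) then y else \<ominus>\<^bsub>loc (F s) (card s)\<^esub> y) =
      fc (F s) (ksign S j s \<otimes> (x j [^] N \<otimes> m (s - {j}))) N" if j: "j \<in> s" for j
    proof -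
      have "cech_res S (self_module S) xs j s (crep p N m (s - {j})) = fc (F s) (x j [^] N \<otimes> m (s - {j})) N"
        using cech_res_fc [OF s(1) j cl(2) [OF j]] cl(3) [OF j] by (simp add: crep_def)
      moreover have "\<ominus>\<^bsub>loc (F s) (card s)\<^esub> fc (F s) (x j [^] N \<otimes> m (s - {j})) N =
          fc (F s) (\<ominus> (x j [^] N \<otimes> m (s - {j}))) N"
        by (rule loc_uminus) (use s F_closed cl [OF j] in auto)
      ultimately show ?thesis using cl [OF j] by (simp add: Let_def ksign_def l_minus)
    qed
    have "cech_d p (crep p N m) s =
      (\<Oplus>\<^bsub>loc (F s) (card s)\<^esub> j\<in>s. fc (F s) (ksign S j s \<otimes> (x j [^] N \<otimes> m (s - {j}))) N)"
      unfolding cech_diff_def restrict_apply cech_loc_eq if_P [OF True]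
      by (rule L.finsum_cong') (use t cl fc_closed in auto)
    also have "\<dots> = fc (F s) (kdiff S x N m s) N"
      unfolding kdiff_def by (rule loc_finsum) (use s F_closed cl in auto)
    finally show ?thesis using True by (simp add: crep_def)
  qed
qed

text \<open>Equality of fractions provides one annihilating exponent for each index set; as these
  sets are finitely many, a single \<open>t\<close> serves them all.\<close>

lemma crep_eq_iff:
  assumes "m \<in> Pow U \<rightarrow> carrier S" "m' \<in> Pow U \<rightarrow> carrier S"
  shows "crep p N m = crep p N' m' \<longleftrightarrow>
    (\<exists>t::nat. \<forall>s\<subseteq>U. card s = p \<longrightarrow> F s [^] (t + N') \<otimes> m s = F s [^] (t + N) \<otimes> m' s)"
proof
  assume eq: "crep p N m = crep p N' m'"
  have "\<exists>t::nat. F s [^] (t + N') \<otimes> m s = F s [^] (t + N) \<otimes> m' s" if "s \<in> cech_indices xs p" for s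
  proof -
    have "fc (F s) (m s) N = fc (F s) (m' s) N'"
      using fun_cong [OF eq, of s] that by (simp add: crep_def)
    then show ?thesis
      using that F_closed funcset_PowD [OF assms(1)] funcset_PowD [OF assms(2)]
      by (subst (asm) fc_eq_iff) (auto simp: cech_indices_iff)
  qed
  then obtain t :: "nat set \<Rightarrow> nat" where t: "\<And>s. s \<in> cech_indices xs p \<Longrightarrow>
      F s [^] (t s + N') \<otimes> m s = F s [^] (t s + N) \<otimes> m' s"
    by metis
  define T where "T = (\<Sum>s\<in>cech_indices xs p. t s)"
  have "F s [^] (T + N') \<otimes> m s = F s [^] (T + N) \<otimes> m' s" if s: "s \<subseteq> U" "card s = p" for s
  proof -
    have s': "s \<in> cech_indices xs p" using s by (simp add: cech_indices_iff)
    define u where "u = T - t s"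
    have T: "T = u + t s" using s' finite_cech_indices by (simp add: T_def u_def member_le_sum)
    have cl: "F s \<in> carrier S" "m s \<in> carrier S" "m' s \<in> carrier S"
      using s F_closed funcset_PowD [OF assms(1)] funcset_PowD [OF assms(2)] by auto
    have "F s [^] (T + N') \<otimes> m s = F s [^] u \<otimes> (F s [^] (t s + N') \<otimes> m s)"
      using cl by (simp add: T m_assoc [symmetric] nat_pow_mult ac_simps)
    also have "\<dots> = F s [^] (T + N) \<otimes> m' s"
      unfolding t [OF s'] using cl by (simp add: T m_assoc [symmetric] nat_pow_mult ac_simps)
    finally show ?thesis .
  qed
  then show "\<exists>t::nat. \<forall>s\<subseteq>U. card s = p \<longrightarrow> F s [^] (t + N') \<otimes> m s = F s [^] (t + N) \<otimes> m' s"
    by blast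
next
  assume "\<exists>t::nat. \<forall>s\<subseteq>U. card s = p \<longrightarrow> F s [^] (t + N') \<otimes> m s = F s [^] (t + N) \<otimes> m' s"
  then obtain t :: nat where t: "\<And>s. s \<subseteq> U \<Longrightarrow> card s = p \<Longrightarrow> F s [^] (t + N') \<otimes> m s = F s [^] (t + N) \<otimes> m' s"
    by blast
  have "fc (F s) (m s) N = fc (F s) (m' s) N'" if s: "s \<subseteq> U" "card s = p" for s
    using t [OF s] F_closed [OF s(1)] funcset_PowD [OF assms(1) s(1)] funcset_PowD [OF assms(2) s(1)]
    by (subst fc_eq_iff) auto
  then show "crep p N m = crep p N' m'"
    unfolding crep_def by (intro restrict_ext) (simp add: cech_indices_iff)
qed

lemma kdiff_Pow_closed: "m \<in> Pow U \<rightarrow> carrier S \<Longrightarrow> kdiff S x N m \<in> Pow U \<rightarrow> carrier S"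
  using kdiff_closed [OF _ x_closed] by blast

lemma crep_cocycle_iff:
  assumes "homog p n N m"
  shows "crep p N m \<in> cech_cocycles S (self_module S) xs p n \<longleftrightarrow>
    (\<exists>t::nat. \<forall>s\<subseteq>U. card s = Suc p \<longrightarrow> F s [^] t \<otimes> kdiff S x N m s = \<zero>)"
proof -
  have m: "m \<in> Pow U \<rightarrow> carrier S" using assms by (simp add: homog_def)
  have "crep p N m \<in> cech_cocycles S (self_module S) xs p n \<longleftrightarrow>
      crep (Suc p) N (kdiff S x N m) = crep (Suc p) 0 (\<lambda>s. \<zero>)"
    unfolding cech_cocycles_def kernel_def cech_cpx_one [of _ _ 0]
    using crep_mem [OF assms] by (simp add: cech_d_crep [OF m])
  also have "\<dots> \<longleftrightarrow> (\<exists>t::nat. \<forall>s\<subseteq>U. card s = Suc p \<longrightarrow> F s [^] t \<otimes> kdiff S x N m s = \<zero>)"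
  proof (subst crep_eq_iff)
    show "(\<exists>t::nat. \<forall>s\<subseteq>U. card s = Suc p \<longrightarrow> F s [^] (t + 0) \<otimes> kdiff S x N m s = F s [^] (t + N) \<otimes> \<zero>) =
      (\<exists>t::nat. \<forall>s\<subseteq>U. card s = Suc p \<longrightarrow> F s [^] t \<otimes> kdiff S x N m s = \<zero>)"
      by (simp add: F_closed)
  qed (auto intro!: funcset_PowD [OF kdiff_Pow_closed [OF m]])
  finally show ?thesis .
qed


abbreviation cob where "cob \<equiv> cech_coboundaries S (self_module S) xs"
abbreviation coc where "coc \<equiv> cech_cocycles S (self_module S) xs"

lemma cob_Suc: "c \<in> cob (Suc q) n \<longleftrightarrow> (\<exists>N b. homog q n N b \<and> c = crep (Suc q) N (kdiff S x N b))"
proof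
  assume "c \<in> cob (Suc q) n"
  then obtain c' where c': "c' \<in> carrier (cech_cpx q n)" "c = cech_d q c'"
    by (auto simp: cech_coboundaries_def)
  then obtain N b where b: "homog q n N b" "c' = crep q N b" using crep_ex by blast
  then have "c = crep (Suc q) N (kdiff S x N b)"
    using cech_d_crep [of b q N] c' by (simp add: homog_def)
  then show "\<exists>N b. homog q n N b \<and> c = crep (Suc q) N (kdiff S x N b)" using b by blast
next
  assume "\<exists>N b. homog q n N b \<and> c = crep (Suc q) N (kdiff S x N b)"
  then obtain N b where b: "homog q n N b" "c = crep (Suc q) N (kdiff S x N b)" by blast
  then have "c = cech_d q (crep q N b)" using cech_d_crep [of b q N] by (simp add: homog_def)
  then show "c \<in> cob (Suc q) n" using crep_mem [OF b(1)] by (auto simp: cech_coboundaries_def)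
qed

lemma cob_0: "cob 0 n = {crep 0 0 (\<lambda>s. \<zero>)}"
  by (simp add: cech_coboundaries_def cech_cpx_one [of 0 n 0])

lemma homogI:
  assumes "\<And>s. s \<subseteq> U \<Longrightarrow> b s \<in> carrier S"
    and "\<And>s. s \<subseteq> U \<Longrightarrow> card s = p \<Longrightarrow> b s \<in> gcomp S (n + int (N * p))"
  shows "homog p n N b"
  using assms unfolding homog_def by blast

lemma homog_closed: "homog p n N b \<Longrightarrow> s \<subseteq> U \<Longrightarrow> b s \<in> carrier S"
  unfolding homog_def by blast

lemma homog_gcomp: "homog p n N b \<Longrightarrow> s \<subseteq> U \<Longrightarrow> card s = p \<Longrightarrow> b s \<in> gcomp S (n + int (N * p))"
  unfolding homog_def by blast

lemma homog_add:
  assumes "homog p n N b" "homog p n N b'"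
  shows "homog p n N (\<lambda>s. b s \<oplus> b' s)"
  by (intro homogI a_closed gcomp_add homog_closed [OF assms(1)] homog_closed [OF assms(2)]
      homog_gcomp [OF assms(1)] homog_gcomp [OF assms(2)])

lemma homog_diff:
  assumes "homog p n N b" "homog p n N b'"
  shows "homog p n N (\<lambda>s. b s \<oplus> \<ominus> \<one> \<otimes> b' s)"
proof (rule homogI)
  fix s assume s: "s \<subseteq> U"
  have cl: "b s \<in> carrier S" "b' s \<in> carrier S"
    using homog_closed [OF assms(1) s] homog_closed [OF assms(2) s] .
  then show "b s \<oplus> \<ominus> \<one> \<otimes> b' s \<in> carrier S" by simp
  have "\<ominus> \<one> \<otimes> b' s = \<ominus> b' s" using cl by (simp add: l_minus)
  then show "b s \<oplus> \<ominus> \<one> \<otimes> b' s \<in> gcomp S (n + int (N * p))" if "card s = p"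
    using homog_gcomp [OF assms(1) s that] homog_gcomp [OF assms(2) s that]
    by (simp only: gcomp_add gcomp_uminus)
qed

lemma homog_zero: "homog p n N (\<lambda>s. \<zero>)"
  by (rule homogI) (auto simp: gcomp_zero)

lemma homogD: "homog p n N b \<Longrightarrow> b \<in> Pow U \<rightarrow> carrier S"
  by (simp add: homog_def)

lemma cob_common:
  assumes "c \<in> cob (Suc q) n" "c' \<in> cob (Suc q) n"
  shows "\<exists>N b b'. homog q n N b \<and> homog q n N b' \<and>
    c = crep (Suc q) N (kdiff S x N b) \<and> c' = crep (Suc q) N (kdiff S x N b')"
proof -
  obtain d d' where d: "d \<in> carrier (cech_cpx q n)" "c = cech_d q d"
    "d' \<in> carrier (cech_cpx q n)" "c' = cech_d q d'"
    using assms by (auto simp: cech_coboundaries_def)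
  obtain N b b' where b: "homog q n N b" "d = crep q N b" "homog q n N b'" "d' = crep q N b'"
    using crep_ex2 [OF d(1,3)] by blast
  have "c = crep (Suc q) N (kdiff S x N b)" "c' = crep (Suc q) N (kdiff S x N b')"
    using d b cech_d_crep homogD by simp_all
  then show ?thesis using b by blast
qed

lemma crep_kdiff_add:
  assumes "b \<in> Pow U \<rightarrow> carrier S" "b' \<in> Pow U \<rightarrow> carrier S"
  shows "crep p N (kdiff S x N b) \<otimes>\<^bsub>cech_cpx p n\<^esub> crep p N (kdiff S x N b') =
    crep p N (kdiff S x N (\<lambda>s. b s \<oplus> b' s))"
proof -
  have "crep p N (kdiff S x N b) \<otimes>\<^bsub>cech_cpx p n\<^esub> crep p N (kdiff S x N b') =
    crep p N (\<lambda>s. kdiff S x N b s \<oplus> kdiff S x N b' s)"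
    by (rule cech_cpx_mult) (use assms kdiff_Pow_closed in auto)
  also have "\<dots> = crep p N (kdiff S x N (\<lambda>s. b s \<oplus> b' s))"
    by (rule crep_cong) (use kdiff_add [OF _ x_closed] assms in simp)
  finally show ?thesis .
qed

lemma cob_one: "\<one>\<^bsub>cech_cpx p n\<^esub> \<in> cob p n"
proof (cases p)
  case 0
  then show ?thesis by (simp add: cob_0 cech_cpx_one [of 0 n 0])
next
  case (Suc q)
  have "crep (Suc q) 0 (\<lambda>s. \<zero>) = crep (Suc q) 0 (kdiff S x 0 (\<lambda>s. \<zero>))"
    by (rule crep_cong) (simp add: kdiff_zero [OF _ x_closed])
  then show ?thesis
    unfolding Suc cech_cpx_one [of _ _ 0] cob_Suc using homog_zero by blast
qed

text \<open>A coboundary \<open>w\<close> is reached from the coboundary of \<open>b - b'\<close>,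
  where \<open>b\<close> and \<open>b'\<close> are numerators bounding \<open>w\<close> and
  \<open>z\<close> over a common exponent.\<close>

lemma cob_coset:
  assumes z: "z \<in> cob p n"
  shows "(\<lambda>h. h \<otimes>\<^bsub>cech_cpx p n\<^esub> z) ` cob p n = cob p n"
proof (cases p)
  case 0
  have "crep 0 0 (\<lambda>s. \<zero>) \<otimes>\<^bsub>cech_cpx 0 n\<^esub> crep 0 0 (\<lambda>s. \<zero>) = crep 0 0 (\<lambda>s. \<zero> \<oplus> \<zero>)"
    by (rule cech_cpx_mult) auto
  then show ?thesis using z unfolding 0 cob_0 by simp
next
  case (Suc q)
  show ?thesis
    unfolding Suc
  proof (intro equalityI subsetI)
    fix w assume "w \<in> (\<lambda>h. h \<otimes>\<^bsub>cech_cpx (Suc q) n\<^esub> z) ` cob (Suc q) n"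
    then obtain h where h: "h \<in> cob (Suc q) n" "w = h \<otimes>\<^bsub>cech_cpx (Suc q) n\<^esub> z" by blast
    obtain N b b' where b: "homog q n N b" "homog q n N b'"
      "h = crep (Suc q) N (kdiff S x N b)" "z = crep (Suc q) N (kdiff S x N b')"
      using cob_common [OF h(1) z [unfolded Suc]] by blast
    have "w = crep (Suc q) N (kdiff S x N (\<lambda>s. b s \<oplus> b' s))"
      unfolding h b by (rule crep_kdiff_add) (use b homogD in auto)
    then show "w \<in> cob (Suc q) n" using homog_add [OF b(1,2)] cob_Suc by blast
  next
    fix w assume w: "w \<in> cob (Suc q) n"
    obtain N b b' where b: "homog q n N b" "homog q n N b'"
      "w = crep (Suc q) N (kdiff S x N b)" "z = crep (Suc q) N (kdiff S x N b')"
      using cob_common [OF w z [unfolded Suc]] by blast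
    have cl: "b s \<in> carrier S" "b' s \<in> carrier S" if "s \<subseteq> U" for s
      using funcset_PowD [OF homogD [OF b(1)] that] funcset_PowD [OF homogD [OF b(2)] that] by auto
    define h where "h = crep (Suc q) N (kdiff S x N (\<lambda>s. b s \<oplus> \<ominus> \<one> \<otimes> b' s))"
    have h: "h \<in> cob (Suc q) n"
      unfolding h_def cob_Suc using homog_diff [OF b(1,2)] by blast
    have "h \<otimes>\<^bsub>cech_cpx (Suc q) n\<^esub> z =
      crep (Suc q) N (kdiff S x N (\<lambda>s. (b s \<oplus> \<ominus> \<one> \<otimes> b' s) \<oplus> b' s))"
      unfolding h_def b(4) by (rule crep_kdiff_add) (use homogD [OF homog_diff [OF b(1,2)]] homogD [OF b(2)] in auto)
    also have "\<dots> = w"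
      unfolding b(3)
    proof (rule crep_cong, rule kdiff_cong [OF _ x_closed homogD [OF b(1)]])
      fix s j assume s: "s \<subseteq> U" "j \<in> s"
      have "s - {j} \<subseteq> U" using s by auto
      from cl [OF this] show "(b (s - {j}) \<oplus> \<ominus> \<one> \<otimes> b' (s - {j})) \<oplus> b' (s - {j}) = b (s - {j})"
        by (simp add: l_minus a_assoc l_neg)
    qed
    finally show "w \<in> (\<lambda>h. h \<otimes>\<^bsub>cech_cpx (Suc q) n\<^esub> z) ` cob (Suc q) n" using h by force
  qed
qed

lemma one_coc: "\<one>\<^bsub>cech_cpx p n\<^esub> \<in> coc p n"
proof -
  have "\<exists>t::nat. \<forall>s\<subseteq>U. card s = Suc p \<longrightarrow> F s [^] t \<otimes> kdiff S x 0 (\<lambda>s. \<zero>) s = \<zero>"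
    using kdiff_zero [OF _ x_closed, of _ "\<lambda>s. \<zero>" 0] F_closed by (intro exI [of _ 0]) simp
  then show ?thesis
    unfolding cech_cpx_one [of _ _ 0] crep_cocycle_iff [OF homog_zero] .
qed

text \<open>The zero cochain is a coboundary, so each coset contains its representative; this gives
  one direction, and \<open>cob_coset\<close> gives the other.\<close>

lemma cech_cohomology_trivial_iff:
  "carrier (cech_cohomology S (self_module S) xs p n) = {\<one>\<^bsub>cech_cohomology S (self_module S) xs p n\<^esub>}
    \<longleftrightarrow> coc p n \<subseteq> cob p n"
proof -
  let ?cos = "\<lambda>z. (\<lambda>h. h \<otimes>\<^bsub>cech_cpx p n\<^esub> z) ` cob p n"
  have car: "carrier (cech_cohomology S (self_module S) xs p n) = ?cos ` coc p n"
    unfolding cech_cohomology_def carrier_FactGroup r_coset_def by (simp add: UNION_singleton_eq_range)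
  have one: "\<one>\<^bsub>cech_cohomology S (self_module S) xs p n\<^esub> = cob p n"
    by (simp add: cech_cohomology_def)
  show ?thesis
    unfolding car one
  proof
    assume eq: "?cos ` coc p n = {cob p n}"
    show "coc p n \<subseteq> cob p n"
    proof
      fix z assume z: "z \<in> coc p n"
      then have "z \<in> carrier (cech_cpx p n)" by (simp add: cech_cocycles_def kernel_def)
      then obtain N m where m: "homog p n N m" "z = crep p N m" using crep_ex by blast
      have "\<one>\<^bsub>cech_cpx p n\<^esub> \<otimes>\<^bsub>cech_cpx p n\<^esub> z = crep p N (\<lambda>s. \<zero> \<oplus> m s)"
        unfolding m(2) cech_cpx_one [of p n N]
        by (rule cech_cpx_mult) (use homogD [OF m(1)] in auto)
      also have "\<dots> = z" unfolding m(2)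
        by (rule crep_cong) (use funcset_PowD [OF homogD [OF m(1)]] in simp)
      finally have "z = \<one>\<^bsub>cech_cpx p n\<^esub> \<otimes>\<^bsub>cech_cpx p n\<^esub> z" by simp
      then have "z \<in> ?cos z" using cob_one by (rule image_eqI)
      moreover have "?cos z = cob p n"
        using eq imageI [OF z, of ?cos] by (simp only: singleton_iff)
      ultimately show "z \<in> cob p n" by simp
    qed
  next
    assume sub: "coc p n \<subseteq> cob p n"
    have "?cos ` coc p n = (\<lambda>z. cob p n) ` coc p n"
      by (rule image_cong [OF refl], rule cob_coset) (use sub in auto)
    also have "\<dots> = {cob p n}" by (rule image_constant [OF one_coc])
    finally show "?cos ` coc p n = {cob p n}" .
  qed
qed

text \<open>For a Cech cocycle the differential of the numerators vanishes only after multiplication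
  by some \<open>F s [^] t\<close>. Raising the exponent by \<open>t\<close> makes it vanish
  exactly, as the hypothesis of \<open>cech_vanishes\<close> demands.\<close>

lemma cech_vanishes_cocycle:
  assumes van: "cech_vanishes S x U p n" and z: "z \<in> coc p n"
  shows "z \<in> cob p n"
proof -
  have "z \<in> carrier (cech_cpx p n)" using z by (simp add: cech_cocycles_def kernel_def)
  then obtain N m where m: "homog p n N m" "z = crep p N m" using crep_ex by blast
  obtain t :: nat where t: "\<And>s. s \<subseteq> U \<Longrightarrow> card s = Suc p \<Longrightarrow> F s [^] t \<otimes> kdiff S x N m s = \<zero>"
    using z crep_cocycle_iff [OF m(1)] m(2) by blast
  define m1 where "m1 = (\<lambda>s. F s [^] t \<otimes> m s)"
  define N1 where "N1 = N + t"
  have m1: "homog p n N1 m1" unfolding m1_def N1_def using m(1) by (rule homog_shift)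
  have z1: "z = crep p N1 m1"
    unfolding m1_def N1_def m(2) using crep_shift [OF homogD [OF m(1)]] by simp
  have "\<forall>s\<subseteq>U. card s = Suc p \<longrightarrow> kdiff S x N1 m1 s = \<zero>"
    unfolding m1_def N1_def using kdiff_shift [OF fin_sub _ x_closed homogD [OF m(1)], of _ N t] t by simp
  then have "\<exists>T. \<exists>b \<in> Pow U \<rightarrow> carrier S. \<forall>s\<subseteq>U. card s = p \<longrightarrow> F s [^] T \<otimes> m1 s = kdiff S x (N1 + T) b s"
    by (intro cech_vanishesD [OF van homogD [OF m1]]) (use m1 in \<open>simp_all add: homog_def\<close>)
  then obtain T b where b0: "b \<in> Pow U \<rightarrow> carrier S"
    "\<forall>s\<subseteq>U. card s = p \<longrightarrow> F s [^] T \<otimes> m1 s = kdiff S x (N1 + T) b s"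
    by blast
  have b: "F s [^] T \<otimes> m1 s = kdiff S x (N1 + T) b s" if "s \<subseteq> U" "card s = p" for s
    using b0(2) that by simp
  have z2: "z = crep p (N1 + T) (\<lambda>s. F s [^] T \<otimes> m1 s)"
    unfolding z1 using crep_shift [OF homogD [OF m1]] by simp
  show ?thesis
  proof (cases p)
    case 0
    have "z = crep p (N1 + T) (\<lambda>s. \<zero>)"
      unfolding z2
    proof (rule crep_cong)
      fix s assume s: "s \<subseteq> U" "card s = p"
      then have "s = {}" using 0 fin_sub by auto
      then show "F s [^] T \<otimes> m1 s = \<zero>" using b [OF s] by simp
    qed
    then show ?thesis using cob_one [of p n] cech_cpx_one [of p n "N1 + T"] by simp
  next
    case (Suc q)
    define M where "M = N1 + T"
    \<comment> \<open>\<open>cech_vanishes\<close> supplies \<open>b\<close> without a degree. The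
      coboundary has degree \<open>n + M * p\<close>, of which the differential contributes
      \<open>M\<close>; since \<open>p = Suc q\<close>, this leaves
      \<open>n + M * q\<close>.\<close>
    define b' where "b' s = gproj S pr (n + int (M * q)) (b s)" for s
    have b': "homog q n M b'"
      unfolding b'_def by (intro homogI gproj_mem gproj_closed funcset_PowD [OF b0(1)])
    have "z = crep p M (kdiff S x M b')"
      unfolding z2 M_def [symmetric]
    proof (rule crep_cong)
      fix s assume s: "s \<subseteq> U" "card s = p"
      have h: "homog p n M (\<lambda>s. F s [^] T \<otimes> m1 s)" unfolding M_def using m1 by (rule homog_shift)
      have e: "F s [^] T \<otimes> m1 s = kdiff S x M b s" using b [OF s] by (simp add: M_def)
      have "kdiff S x M b s \<in> gcomp S (n + int (M * p))"
        using h s unfolding homog_def e [symmetric] by blast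
      from kdiff_gproj [OF fin_sub [OF s(1)] s(1) x_hcomp b0(1) this]
      have "kdiff S x M (\<lambda>t. gproj S pr (n + int (M * p) - int M) (b t)) s = kdiff S x M b s" .
      moreover have "n + int (M * p) - int M = n + int (M * q)" by (simp add: Suc algebra_simps)
      ultimately show "F s [^] T \<otimes> m1 s = kdiff S x M b' s" by (simp only: e b'_def [abs_def])
    qed
    then show ?thesis using b' Suc cob_Suc by blast
  qed
qed

lemma cocycles_trivial_imp_vanishes:
  assumes triv: "coc p n \<subseteq> cob p n"
  shows "cech_vanishes S x U p n"
  unfolding cech_vanishes_def
proof (intro allI ballI impI)
  fix N m assume m: "m \<in> Pow U \<rightarrow> carrier S"
    and hom: "\<forall>s\<subseteq>U. card s = p \<longrightarrow> m s \<in> gcomp S (n + int (N * p))"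
    and cyc: "\<forall>s\<subseteq>U. card s = Suc p \<longrightarrow> kdiff S x N m s = \<zero>"
  have h: "homog p n N m" using m hom by (simp add: homog_def)
  have "\<exists>t::nat. \<forall>s\<subseteq>U. card s = Suc p \<longrightarrow> F s [^] t \<otimes> kdiff S x N m s = \<zero>"
    using cyc F_closed by (intro exI [of _ 0]) simp
  then have "crep p N m \<in> coc p n" unfolding crep_cocycle_iff [OF h] .
  then have cob: "crep p N m \<in> cob p n" using triv by blast
  show "\<exists>T. \<exists>b\<in>Pow U \<rightarrow> carrier S. \<forall>s\<subseteq>U. card s = p \<longrightarrow> F s [^] T \<otimes> m s = kdiff S x (N + T) b s"
  proof (cases p)
    case 0
    then have "crep 0 N m = crep 0 0 (\<lambda>s. \<zero>)" using cob cob_0 by simp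
    then obtain t :: nat where t: "\<And>s. s \<subseteq> U \<Longrightarrow> card s = 0 \<Longrightarrow> F s [^] (t + 0) \<otimes> m s = F s [^] (t + N) \<otimes> \<zero>"
      using crep_eq_iff [OF m, of "\<lambda>s. \<zero>" 0 N 0] by auto
    have "F s [^] t \<otimes> m s = kdiff S x (N + t) (\<lambda>s. \<zero>) s" if s: "s \<subseteq> U" "card s = p" for s
    proof -
      have "s = {}" using s 0 fin_sub by auto
      then show ?thesis using t [of s] s 0 by simp
    qed
    then show ?thesis by (intro exI [of _ t] bexI [of _ "\<lambda>s. \<zero>"]) auto
  next
    case (Suc q)
    obtain M b where b: "homog q n M b" "crep p N m = crep p M (kdiff S x M b)"
      using cob Suc cob_Suc by blast
    obtain t :: nat where t: "\<And>s. s \<subseteq> U \<Longrightarrow> card s = p \<Longrightarrow>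
        F s [^] (t + M) \<otimes> m s = F s [^] (t + N) \<otimes> kdiff S x M b s"
      using b(2) crep_eq_iff [OF m kdiff_Pow_closed [OF homogD [OF b(1)]]] by blast
    \<comment> \<open>The witness is \<open>T = t + M\<close>, with \<open>b\<close> multiplied by
      \<open>F r [^] (t + N)\<close>: both sides then live over the exponent
      \<open>N + T = M + (t + N)\<close>.\<close>
    show ?thesis
    proof (intro exI bexI allI impI)
      fix s assume s: "s \<subseteq> U" "card s = p"
      have "F s [^] (t + M) \<otimes> m s = kdiff S x (M + (t + N)) (\<lambda>r. F r [^] (t + N) \<otimes> b r) s"
        using t [OF s] kdiff_shift [OF fin_sub [OF s(1)] s(1) x_closed homogD [OF b(1)], of M "t + N"] by simp
      also have "M + (t + N) = N + (t + M)" by simp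
      finally show "F s [^] (t + M) \<otimes> m s = kdiff S x (N + (t + M)) (\<lambda>r. F r [^] (t + N) \<otimes> b r) s" .
    next
      show "(\<lambda>r. F r [^] (t + N) \<otimes> b r) \<in> Pow U \<rightarrow> carrier S"
        using homogD [OF homog_shift [OF b(1), of "t + N"]] .
    qed
  qed
qed

theorem cech_cohomology_trivial:
  "carrier (cech_cohomology S (self_module S) xs p n) = {\<one>\<^bsub>cech_cohomology S (self_module S) xs p n\<^esub>}
    \<longleftrightarrow> cech_vanishes S x U p n"
  unfolding cech_cohomology_trivial_iff
  using cech_vanishes_cocycle cocycles_trivial_imp_vanishes by blast

end

section \<open>Vanishing of local cohomology in terms of arbitrary generators\<close>

context graded_cring
begin

text \<open>Of the list picked by \<open>SOME\<close> it is only known that it generates the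
  irrelevant ideal; \<open>cech_vanishes_generators\<close> replaces it by
  \<open>ys\<close>.\<close>

lemma local_cohomology_trivial:
  assumes "generates_irrelevant S ys"
  shows "carrier (local_cohomology S (self_module S) p n) = {\<one>\<^bsub>local_cohomology S (self_module S) p n\<^esub>}
    \<longleftrightarrow> cech_vanishes S (nth ys) {..<length ys} p n"
proof -
  define xs where "xs = (SOME xs. generates_irrelevant S xs)"
  have gx: "generates_irrelevant S xs" unfolding xs_def using assms by (rule someI)
  interpret graded_cring_seq S pr xs
    by unfold_locales (use gx in \<open>simp add: generates_irrelevant_def\<close>)
  have sub: "set zs \<subseteq> genideal S (set zs)" if "generates_irrelevant S zs" for zs
    using that hcomp_closed by (intro genideal_self) (auto simp: generates_irrelevant_def)
  have "cech_vanishes S (nth xs) {..<length xs} p n \<longleftrightarrow> cech_vanishes S (nth ys) {..<length ys} p n"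
    by (rule cech_vanishes_generators)
      (use assms gx sub [OF assms] sub [OF gx] in \<open>auto simp: generates_irrelevant_def\<close>)
  then show ?thesis
    unfolding local_cohomology_def xs_def [symmetric] cech_cohomology_trivial .
qed

lemma a_invariant_eq:
  assumes "generates_irrelevant S ys"
  shows "a_invariant S (self_module S) p =
    Sup {ereal (real_of_int n) | n. \<not> cech_vanishes S (nth ys) {..<length ys} p n}"
  unfolding a_invariant_def using local_cohomology_trivial [OF assms] by simp

end


section \<open>Graded quotients\<close>

text \<open>The ring axioms are inherited from the Rees ring, a subring of the polynomial ring \<open>UP R\<close>.\<close>

locale graded_quot = cring R for R :: "('a, 'b) ring_scheme" (structure) +
  fixes P Q :: "nat \<Rightarrow> 'a set"
  assumes P_ideal: "ideal (P n) R" and Q_ideal: "ideal (Q n) R"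
    and Q_sub: "Q n \<subseteq> P n"
    and P_mult: "a \<in> P i \<Longrightarrow> b \<in> P j \<Longrightarrow> a \<otimes> b \<in> P (i + j)"
    and Q_mult: "a \<in> P i \<Longrightarrow> b \<in> Q j \<Longrightarrow> a \<otimes> b \<in> Q (i + j)"
    and P_0: "P 0 = carrier R"
begin

abbreviation S where "S \<equiv> graded_quotient R P Q"

definition ct :: "nat \<Rightarrow> 'a \<Rightarrow> 'a set" where "ct n a = Q n +> a"

lemma P_closed: "a \<in> P n \<Longrightarrow> a \<in> carrier R"
  using ideal.Icarr [OF P_ideal] .

lemma Q_closed: "a \<in> Q n \<Longrightarrow> a \<in> carrier R"
  using ideal.Icarr [OF Q_ideal] .

lemma P_zero: "\<zero> \<in> P n" and Q_zero: "\<zero> \<in> Q n"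
  by (simp_all add: additive_subgroup.zero_closed ideal.axioms(1) P_ideal Q_ideal)

lemma P_add: "a \<in> P n \<Longrightarrow> b \<in> P n \<Longrightarrow> a \<oplus> b \<in> P n"
  by (simp add: additive_subgroup.a_closed ideal.axioms(1) P_ideal)

lemma Q_add: "a \<in> Q n \<Longrightarrow> b \<in> Q n \<Longrightarrow> a \<oplus> b \<in> Q n"
  by (simp add: additive_subgroup.a_closed ideal.axioms(1) Q_ideal)

lemma P_uminus: "a \<in> P n \<Longrightarrow> \<ominus> a \<in> P n"
  by (simp add: additive_subgroup.a_inv_closed ideal.axioms(1) P_ideal)

lemma P_l_mult: "a \<in> P n \<Longrightarrow> r \<in> carrier R \<Longrightarrow> r \<otimes> a \<in> P n"
  by (simp add: ideal.I_l_closed P_ideal)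

lemma ct_add: "a \<in> carrier R \<Longrightarrow> b \<in> carrier R \<Longrightarrow> ct n a <+> ct n b = ct n (a \<oplus> b)"
  unfolding ct_def
  by (rule abelian_subgroup.a_rcos_sum [OF abelian_subgroupI3])
    (simp_all add: ideal.axioms(1) Q_ideal abelian_group_axioms)

lemma ct_zero: "ct n \<zero> = Q n"
  unfolding ct_def by (rule a_coset_add_zero) (auto intro: Q_closed)

lemma ct_eq_iff:
  assumes "a \<in> carrier R" "b \<in> carrier R"
  shows "ct n a = ct n b \<longleftrightarrow> a \<ominus> b \<in> Q n"
  unfolding ct_def using quotient_eq_iff_same_a_r_cos [OF Q_ideal assms] by simp

lemma ct_eq_Q: "a \<in> carrier R \<Longrightarrow> ct n a = Q n \<longleftrightarrow> a \<in> Q n"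
  using ct_eq_iff [of a \<zero> n] by (simp add: ct_zero a_minus_def)

lemma mem_ct: "a' \<in> ct n a \<longleftrightarrow> (\<exists>q\<in>Q n. a' = q \<oplus> a)"
  by (auto simp: ct_def a_r_coset_def')

text \<open>For representatives \<open>a' = q + a\<close> and \<open>b' = r + b\<close> the
  difference \<open>a' b' - a b\<close> equals \<open>q r + b q + a r\<close>, and every term lies
  in \<open>Q (i + j)\<close>; for \<open>q r\<close> this uses
  \<open>Q i \<subseteq> P i\<close>.\<close>

lemma ct_rcoset_mult:
  assumes a: "a \<in> P i" and b: "b \<in> P j"
  shows "rcoset_mult R (Q (i + j)) (ct i a) (ct j b) = ct (i + j) (a \<otimes> b)"
proof -
  have "Q (i + j) +> (a' \<otimes> b') = ct (i + j) (a \<otimes> b)" if ab': "a' \<in> ct i a" "b' \<in> ct j b" for a' b'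
  proof -
    obtain q r where q: "q \<in> Q i" "a' = q \<oplus> a" and r: "r \<in> Q j" "b' = r \<oplus> b"
      using ab' by (auto simp: mem_ct)
    have cl: "q \<in> carrier R" "r \<in> carrier R" "a \<in> carrier R" "b \<in> carrier R"
      using q r a b P_closed Q_closed by auto
    have 1: "q \<otimes> r \<in> Q (i + j)" using q r Q_sub Q_mult by blast
    have 2: "b \<otimes> q \<in> Q (i + j)" using Q_mult [OF b q(1)] by (simp add: add.commute)
    have 3: "a \<otimes> r \<in> Q (i + j)" using Q_mult [OF a r(1)] .
    have "a' \<otimes> b' \<ominus> a \<otimes> b = q \<otimes> r \<oplus> (b \<otimes> q \<oplus> a \<otimes> r)"
      unfolding q r using cl by algebra
    then have "a' \<otimes> b' \<ominus> a \<otimes> b \<in> Q (i + j)" using 1 2 3 Q_add by simp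
    then have "ct (i + j) (a' \<otimes> b') = ct (i + j) (a \<otimes> b)"
      using cl q r by (subst ct_eq_iff) auto
    then show ?thesis by (simp add: ct_def)
  qed
  moreover have "a \<in> ct i a" "b \<in> ct j b"
    using a b P_closed Q_zero by (auto simp: mem_ct intro!: bexI [of _ \<zero>])
  ultimately show ?thesis unfolding rcoset_mult_def by (auto intro!: SUP_eq_const)
qed

lemma ct_finsum:
  assumes "g \<in> A \<rightarrow> carrier R"
  shows "(\<Oplus>\<^bsub>R Quot Q n\<^esub> i\<in>A. ct n (g i)) = ct n (\<Oplus>i\<in>A. g i)"
proof -
  interpret h: ring_hom_cring R "R Quot Q n" "(+>) (Q n)"
    by (rule ideal.rcos_ring_hom_cring [OF Q_ideal]) (rule is_cring)
  show ?thesis using h.hom_finsum [OF assms] by (simp add: ct_def comp_def)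
qed

section \<open>The Rees ring and its quotient map\<close>

definition rees :: "(nat \<Rightarrow> 'a) set" where
  "rees = {p \<in> up R. \<forall>n. p n \<in> P n}"

definition rho :: "(nat \<Rightarrow> 'a) \<Rightarrow> nat \<Rightarrow> 'a set" where
  "rho p = (\<lambda>n. ct n (p n))"

lemma rees_carrier: "p \<in> rees \<Longrightarrow> p \<in> carrier (UP R)"
  by (simp add: rees_def UP_def)

lemma UP_ops:
  assumes "p \<in> up R" "q \<in> up R"
  shows "p \<otimes>\<^bsub>UP R\<^esub> q = (\<lambda>n. \<Oplus>i\<in>{..n}. p i \<otimes> q (n - i))"
    and "p \<oplus>\<^bsub>UP R\<^esub> q = (\<lambda>n. p n \<oplus> q n)"
  using assms by (simp_all add: UP_def)

lemma P_finsum: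
  assumes "finite A" "\<And>i. i \<in> A \<Longrightarrow> g i \<in> P n"
  shows "(\<Oplus>i\<in>A. g i) \<in> P n"
  using assms
proof (induction A)
  case empty
  then show ?case by (simp add: P_zero)
next
  case (insert a A)
  have "(\<Oplus>i\<in>insert a A. g i) = g a \<oplus> (\<Oplus>i\<in>A. g i)"
    by (rule finsum_insert) (use insert.hyps insert.prems P_closed in auto)
  then show ?case using insert P_add by simp
qed

lemma rees_mult:
  assumes "p \<in> rees" "q \<in> rees"
  shows "p \<otimes>\<^bsub>UP R\<^esub> q \<in> rees"
proof -
  have pq: "p \<in> up R" "q \<in> up R" using assms by (auto simp: rees_def)
  have "(\<Oplus>i\<in>{..n}. p i \<otimes> q (n - i)) \<in> P n" for n
  proof (rule P_finsum)
    fix i assume "i \<in> {..n}"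
    then have "n = i + (n - i)" by simp
    then show "p i \<otimes> q (n - i) \<in> P n" using assms P_mult [of "p i" i "q (n - i)" "n - i"] by (simp add: rees_def)
  qed simp
  then show ?thesis using up_mult_closed [OF pq] by (simp add: rees_def UP_ops pq)
qed

lemma rees_add:
  assumes "p \<in> rees" "q \<in> rees"
  shows "p \<oplus>\<^bsub>UP R\<^esub> q \<in> rees"
  using assms up_add_closed [of p q] by (auto simp: rees_def UP_ops P_add)

lemma UP_is_cring: "cring (UP R)"
proof -
  interpret UPR: UP_cring R "UP R" by unfold_locales
  show ?thesis by (rule UPR.UP_cring)
qed

lemma rees_subcring: "subcring rees (UP R)"
proof -
  interpret U: cring "UP R" by (rule UP_is_cring)
  show ?thesis
  proof (rule U.subcringI', rule U.subringI)
    show "rees \<subseteq> carrier (UP R)" using rees_carrier by (rule subsetI)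
    show "\<one>\<^bsub>UP R\<^esub> \<in> rees"
    proof -
      have P1: "(if n = 0 then \<one> else \<zero>) \<in> P n" for n
        by (cases "n = 0") (simp_all add: P_0 P_zero)
      have one: "\<one>\<^bsub>UP R\<^esub> = (\<lambda>n. if n = 0 then \<one> else \<zero>)" by (simp add: UP_def)
      show ?thesis
        unfolding one rees_def mem_Collect_eq by (intro conjI allI up_one_closed P1)
    qed
    show "\<ominus>\<^bsub>UP R\<^esub> p \<in> rees" if p: "p \<in> rees" for p
    proof -
      have pu: "p \<in> up R" using p by (simp add: rees_def)
      have neg: "(\<lambda>n. \<ominus> p n) \<in> up R" using up_a_inv_closed [OF pu] .
      have zero: "\<zero>\<^bsub>UP R\<^esub> = (\<lambda>n. \<zero>)" by (simp add: UP_def)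
      have eq: "\<ominus>\<^bsub>UP R\<^esub> p = (\<lambda>n. \<ominus> p n)"
      proof (rule U.minus_equality)
        show "(\<lambda>n. \<ominus> p n) \<oplus>\<^bsub>UP R\<^esub> p = \<zero>\<^bsub>UP R\<^esub>"
          unfolding UP_ops(2) [OF neg pu] zero using l_neg [OF mem_upD [OF pu]] by (rule ext)
        show "p \<in> carrier (UP R)" using p by (rule rees_carrier)
        show "(\<lambda>n. \<ominus> p n) \<in> carrier (UP R)" using neg by (simp only: UP_def partial_object.simps)
      qed
      have "\<ominus> p n \<in> P n" for n
        by (rule P_uminus) (use p in \<open>simp add: rees_def\<close>)
      then show ?thesis unfolding eq rees_def mem_Collect_eq using neg by (intro conjI allI)
    qed
    show "p \<otimes>\<^bsub>UP R\<^esub> q \<in> rees" if "p \<in> rees" "q \<in> rees" for p q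
      using that by (rule rees_mult)
    show "p \<oplus>\<^bsub>UP R\<^esub> q \<in> rees" if "p \<in> rees" "q \<in> rees" for p q
      using that by (rule rees_add)
  qed
qed

abbreviation B where "B \<equiv> (UP R) \<lparr> carrier := rees \<rparr>"

lemma B_cring: "cring B"
proof -
  interpret U: cring "UP R" by (rule UP_is_cring)
  show ?thesis
  proof (rule U.subcring_iff [THEN iffD1])
    show "rees \<subseteq> carrier (UP R)" using rees_carrier by (rule subsetI)
  qed (rule rees_subcring)
qed

lemma S_simps:
  "carrier S = graded_quotient_carrier R P Q"
  "f \<otimes>\<^bsub>S\<^esub> g = (\<lambda>n. \<Oplus>\<^bsub>R Quot Q n\<^esub> i\<in>{..n}. rcoset_mult R (Q n) (f i) (g (n - i)))"
  "f \<oplus>\<^bsub>S\<^esub> g = (\<lambda>n. f n <+> g n)"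
  "\<one>\<^bsub>S\<^esub> = (\<lambda>n. if n = 0 then ct 0 \<one> else Q n)"
  "\<zero>\<^bsub>S\<^esub> = Q"
  "hcomp S n = {f \<in> graded_quotient_carrier R P Q. \<forall>k. k \<noteq> n \<longrightarrow> f k = Q k}"
  by (simp_all add: graded_quotient_def ct_def cong: if_cong)

lemma rho_closed: "p \<in> rees \<Longrightarrow> rho p \<in> carrier S"
proof -
  assume p: "p \<in> rees"
  then obtain N where N: "\<And>m. m > N \<Longrightarrow> p m = \<zero>"
    using bound_upD [of p] by (auto simp: rees_def bound_def)
  have "n \<le> N" if "ct n (p n) \<noteq> Q n" for n
    using that N [of n] ct_zero by (metis not_le)
  then have "{n. ct n (p n) \<noteq> Q n} \<subseteq> {..N}" by auto
  then have "finite {n. ct n (p n) \<noteq> Q n}" using finite_subset by blast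
  then show "rho p \<in> carrier S"
    using p unfolding S_simps graded_quotient_carrier_def
    by (auto simp: rho_def ct_def rees_def)
qed

lemma rho_surj:
  assumes "f \<in> carrier S"
  shows "\<exists>p\<in>rees. f = rho p"
proof -
  have f: "\<forall>n. \<exists>a\<in>P n. f n = ct n a" "finite {n. f n \<noteq> Q n}"
    using assms unfolding S_simps graded_quotient_carrier_def ct_def by auto
  then obtain a where a: "\<And>n. a n \<in> P n" "\<And>n. f n = ct n (a n)" by metis
  \<comment> \<open>A zero coset is lifted to \<open>\<zero>\<close>, so that the finite support of
    \<open>f\<close> bounds the degree of the polynomial \<open>p\<close>.\<close>
  define p where "p n = (if f n = Q n then \<zero> else a n)" for n
  obtain N where N: "{n. f n \<noteq> Q n} \<subseteq> {..N}" using f(2) finite_nat_iff_bounded_le by auto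
  have "bound \<zero> N p" using N by (auto simp: bound_def p_def)
  then have "p \<in> rees"
  proof -
    have "p n \<in> P n" for n using a(1) P_zero by (simp add: p_def)
    then show ?thesis using \<open>bound \<zero> N p\<close> P_closed by (auto simp: rees_def intro!: mem_upI)
  qed
  moreover have "f = rho p"
  proof
    show "f n = rho p n" for n by (cases "f n = Q n") (simp_all add: rho_def p_def ct_zero a(2) [symmetric])
  qed
  ultimately show ?thesis by blast
qed

lemma rho_mult:
  assumes "p \<in> rees" "q \<in> rees"
  shows "rho p \<otimes>\<^bsub>S\<^esub> rho q = rho (p \<otimes>\<^bsub>UP R\<^esub> q)"
proof
  fix n
  have pq: "p \<in> up R" "q \<in> up R" using assms by (auto simp: rees_def)
  have g: "(\<lambda>i. p i \<otimes> q (n - i)) \<in> {..n} \<rightarrow> carrier R"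
    using mem_upD [OF pq(1)] mem_upD [OF pq(2)] by auto
  interpret Qn: abelian_group "R Quot Q n"
    using ideal.quotient_is_ring [OF Q_ideal] by (rule ring.is_abelian_group)
  have "(rho p \<otimes>\<^bsub>S\<^esub> rho q) n = (\<Oplus>\<^bsub>R Quot Q n\<^esub> i\<in>{..n}. rcoset_mult R (Q n) (ct i (p i)) (ct (n - i) (q (n - i))))"
    by (simp add: S_simps rho_def)
  also have "\<dots> = (\<Oplus>\<^bsub>R Quot Q n\<^esub> i\<in>{..n}. ct n (p i \<otimes> q (n - i)))"
  proof (rule Qn.finsum_cong' [OF refl])
    show "(\<lambda>i. ct n (p i \<otimes> q (n - i))) \<in> {..n} \<rightarrow> carrier (R Quot Q n)"
      using g by (auto simp: FactRing_def ct_def A_RCOSETS_def' Pi_iff)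
    fix i assume i: "i \<in> {..n}"
    show "rcoset_mult R (Q n) (ct i (p i)) (ct (n - i) (q (n - i))) = ct n (p i \<otimes> q (n - i))"
      using ct_rcoset_mult [of "p i" i "q (n - i)" "n - i"] assms i by (simp add: rees_def)
  qed
  also have "\<dots> = ct n (\<Oplus>i\<in>{..n}. p i \<otimes> q (n - i))" by (rule ct_finsum [OF g])
  finally show "(rho p \<otimes>\<^bsub>S\<^esub> rho q) n = rho (p \<otimes>\<^bsub>UP R\<^esub> q) n"
    using pq by (simp add: rho_def UP_ops)
qed

lemma rho_add:
  assumes "p \<in> rees" "q \<in> rees"
  shows "rho p \<oplus>\<^bsub>S\<^esub> rho q = rho (p \<oplus>\<^bsub>UP R\<^esub> q)"
proof -
  have pq: "p \<in> up R" "q \<in> up R" using assms by (auto simp: rees_def)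
  show ?thesis
    using mem_upD [OF pq(1)] mem_upD [OF pq(2)] pq by (simp add: S_simps rho_def UP_ops ct_add)
qed

lemma rho_one: "rho \<one>\<^bsub>UP R\<^esub> = \<one>\<^bsub>S\<^esub>"
  by (simp add: rho_def S_simps UP_def ct_zero if_distrib [of "ct _"] cong: if_cong)

lemma rho_zero: "rho \<zero>\<^bsub>UP R\<^esub> = \<zero>\<^bsub>S\<^esub>"
  by (auto simp: rho_def S_simps UP_def ct_zero)

text \<open>\<open>rho\<close> respects sum, product and unit, so its image is a ring; as it is onto
  and maps zero to zero, this image is \<open>S\<close> itself. Commutativity is lifted along
  \<open>rho\<close> as well.\<close>

lemma S_cring: "cring S"
proof -
  interpret B: cring B by (rule B_cring)
  have hom: "rho \<in> ring_hom B S"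
    by (rule ring_hom_memI) (simp_all add: rho_closed rho_mult rho_add rho_one)
  have im: "rho ` carrier B = carrier S" using rho_closed rho_surj by auto
  have "S \<lparr> carrier := rho ` carrier B, zero := rho \<zero>\<^bsub>B\<^esub> \<rparr> = S"
    unfolding im by (simp add: rho_zero)
  then have ring: "ring S" using B.ring_hom_imp_img_ring [OF hom] by metis
  interpret Sr: ring S by (rule ring)
  show ?thesis
  proof (intro cring.intro comm_monoid.intro comm_monoid_axioms.intro ring Sr.monoid_axioms)
    fix f g assume "f \<in> carrier S" "g \<in> carrier S"
    then obtain p q where "p \<in> rees" "q \<in> rees" "f = rho p" "g = rho q"
      using rho_surj by blast
    then show "f \<otimes>\<^bsub>S\<^esub> g = g \<otimes>\<^bsub>S\<^esub> f"
      using B.m_comm [of p q] by (simp add: rho_mult)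
  qed
qed

section \<open>Homogeneous elements and generators of the irrelevant ideal\<close>

definition kap :: "nat \<Rightarrow> 'a \<Rightarrow> nat \<Rightarrow> 'a set" where
  "kap k a = (\<lambda>n. if n = k then ct k a else Q n)"

definition mon :: "nat \<Rightarrow> 'a \<Rightarrow> nat \<Rightarrow> 'a" where
  "mon k a = (\<lambda>n. if n = k then a else \<zero>)"

lemma mon_rees:
  assumes "a \<in> P k"
  shows "mon k a \<in> rees"
proof -
  have "mon k a n \<in> P n" for n using assms P_zero by (simp add: mon_def)
  moreover have "bound \<zero> k (mon k a)" by (auto simp: bound_def mon_def)
  ultimately show ?thesis using P_closed unfolding rees_def by (auto intro!: mem_upI)
qed

lemma rho_mon: "rho (mon k a) = kap k a"
proof
  show "rho (mon k a) n = kap k a n" for n by (simp add: rho_def mon_def kap_def ct_zero)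
qed

lemma kap_closed: "a \<in> P k \<Longrightarrow> kap k a \<in> carrier S"
  using rho_closed [OF mon_rees] by (simp add: rho_mon)

lemma kap_hcomp: "a \<in> P k \<Longrightarrow> kap k a \<in> hcomp S k"
  using kap_closed [of a k] unfolding S_simps by (simp add: kap_def)

lemma hcomp_kap:
  assumes "f \<in> hcomp S k"
  shows "\<exists>a\<in>P k. f = kap k a"
proof -
  have f: "f \<in> carrier S" "\<And>j. j \<noteq> k \<Longrightarrow> f j = Q j" using assms unfolding S_simps by auto
  obtain p where p: "p \<in> rees" "f = rho p" using rho_surj [OF f(1)] by blast
  have "f = kap k (p k)"
  proof
    show "f n = kap k (p k) n" for n using f(2) [of n] by (simp add: kap_def p(2) rho_def)
  qed
  moreover have "p k \<in> P k" using p(1) by (simp add: rees_def)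
  ultimately show ?thesis by blast
qed

lemma mon_mult:
  assumes a: "a \<in> P k" and p: "p \<in> rees"
  shows "(mon k a \<otimes>\<^bsub>UP R\<^esub> p) n = (if k \<le> n then a \<otimes> p (n - k) else \<zero>)"
proof -
  have up: "mon k a \<in> up R" "p \<in> up R" using mon_rees [OF a] p by (auto simp: rees_def)
  have ac: "a \<in> carrier R" using a P_closed by auto
  have "(mon k a \<otimes>\<^bsub>UP R\<^esub> p) n = (\<Oplus>i\<in>{..n}. mon k a i \<otimes> p (n - i))"
    using up by (simp add: UP_ops)
  also have "\<dots> = (\<Oplus>i\<in>{..n}. if i = k then a \<otimes> p (n - k) else \<zero>)"
    by (rule finsum_cong_strong) (use ac mem_upD [OF up(2)] in \<open>auto simp: mon_def\<close>)
  also have "\<dots> = (if k \<le> n then a \<otimes> p (n - k) else \<zero>)"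
  proof (cases "k \<le> n")
    case True
    have "(\<Oplus>i\<in>{..n}. if k = i then a \<otimes> p (n - k) else \<zero>) = a \<otimes> p (n - k)"
      by (rule finsum_singleton [of k "{..n}" "\<lambda>i. a \<otimes> p (n - k)"]) (use True ac mem_upD [OF up(2)] in auto)
    then show ?thesis using True by (simp add: eq_commute)
  next
    case False
    have "(\<Oplus>i\<in>{..n}. if i = k then a \<otimes> p (n - k) else \<zero>) = (\<Oplus>i\<in>{..n}. \<zero>)"
      by (rule finsum_cong_strong) (use False in auto)
    then show ?thesis using False by simp
  qed
  finally show ?thesis .
qed

lemma kap_rho_mult:
  assumes a: "a \<in> P k" and p: "p \<in> rees"
  shows "(kap k a \<otimes>\<^bsub>S\<^esub> rho p) n = (if k \<le> n then ct n (a \<otimes> p (n - k)) else Q n)"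
proof -
  have "kap k a \<otimes>\<^bsub>S\<^esub> rho p = rho (mon k a \<otimes>\<^bsub>UP R\<^esub> p)"
    using rho_mult [OF mon_rees [OF a] p] by (simp only: rho_mon)
  then show ?thesis by (simp add: rho_def mon_mult [OF a p] ct_zero)
qed

lemma kap_mult:
  assumes a: "a \<in> P k" and b: "b \<in> P l"
  shows "kap k a \<otimes>\<^bsub>S\<^esub> kap l b = kap (k + l) (a \<otimes> b)"
proof
  fix n
  have "(kap k a \<otimes>\<^bsub>S\<^esub> kap l b) n = (if k \<le> n then ct n (a \<otimes> mon l b (n - k)) else Q n)"
    using kap_rho_mult [OF a mon_rees [OF b]] by (simp only: rho_mon)
  then show "(kap k a \<otimes>\<^bsub>S\<^esub> kap l b) n = kap (k + l) (a \<otimes> b) n"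
    using P_closed [OF a] by (auto simp: kap_def mon_def ct_zero)
qed

lemma Q_set_add: "Q n <+> Q n = Q n"
  using ct_add [of \<zero> \<zero> n] by (simp add: ct_zero)

lemma kap_add: "a \<in> P k \<Longrightarrow> b \<in> P k \<Longrightarrow> kap k a \<oplus>\<^bsub>S\<^esub> kap k b = kap k (a \<oplus> b)"
  by (rule ext) (simp add: S_simps kap_def ct_add Q_set_add P_closed)

lemma kap_zero: "kap k \<zero> = \<zero>\<^bsub>S\<^esub>"
  by (rule ext) (simp add: kap_def S_simps ct_zero)

lemma kap_one: "kap 0 \<one> = \<one>\<^bsub>S\<^esub>"
  by (rule ext) (simp add: kap_def S_simps)

lemma kap_eq_zero: "a \<in> P k \<Longrightarrow> kap k a = \<zero>\<^bsub>S\<^esub> \<longleftrightarrow> a \<in> Q k"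
  using ct_eq_Q [OF P_closed, of a k k] by (auto simp: kap_def S_simps fun_eq_iff)

lemma kap_uminus:
  assumes a: "a \<in> P k"
  shows "kap k (\<ominus> a) = \<ominus>\<^bsub>S\<^esub> kap k a"
proof -
  interpret S: cring S by (rule S_cring)
  have "kap k (\<ominus> a) \<oplus>\<^bsub>S\<^esub> kap k a = kap k (\<ominus> a \<oplus> a)"
    by (rule kap_add [OF P_uminus [OF a] a])
  also have "\<dots> = \<zero>\<^bsub>S\<^esub>" using P_closed [OF a] by (simp add: l_neg kap_zero)
  finally show ?thesis
    using S.minus_equality kap_closed [OF a] kap_closed [OF P_uminus [OF a]] by metis
qed

definition prj :: "nat \<Rightarrow> (nat \<Rightarrow> 'a set) \<Rightarrow> nat \<Rightarrow> 'a set" where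
  "prj k f = (\<lambda>n. if n = k then f k else Q n)"

lemma prj_rho: "prj k (rho p) = kap k (p k)"
  by (simp add: prj_def rho_def kap_def)

lemma S_graded: "graded_cring S prj"
proof (intro graded_cring.intro graded_cring_axioms.intro S_cring)
  interpret S: cring S by (rule S_cring)
  show "a \<in> carrier S" if "a \<in> hcomp S k" for a k using that unfolding S_simps by simp
  show "a \<oplus>\<^bsub>S\<^esub> b \<in> hcomp S k" if ab: "a \<in> hcomp S k" "b \<in> hcomp S k" for a b k
  proof -
    obtain a' b' where "a' \<in> P k" "b' \<in> P k" "a = kap k a'" "b = kap k b'"
      using hcomp_kap [OF ab(1)] hcomp_kap [OF ab(2)] by blast
    then show ?thesis using kap_hcomp [OF P_add] by (simp add: kap_add)
  qed
  show "a \<otimes>\<^bsub>S\<^esub> b \<in> hcomp S (k + l)" if ab: "a \<in> hcomp S k" "b \<in> hcomp S l" for a b k l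
  proof -
    obtain a' b' where "a' \<in> P k" "b' \<in> P l" "a = kap k a'" "b = kap l b'"
      using hcomp_kap [OF ab(1)] hcomp_kap [OF ab(2)] by blast
    then show ?thesis using kap_hcomp [OF P_mult] by (simp add: kap_mult)
  qed
  show "\<zero>\<^bsub>S\<^esub> \<in> hcomp S k" for k using kap_hcomp [OF P_zero] by (simp add: kap_zero)
  show "\<one>\<^bsub>S\<^esub> \<in> hcomp S 0" using kap_hcomp [of \<one> 0] by (simp add: kap_one P_0)
  show "\<ominus>\<^bsub>S\<^esub> a \<in> hcomp S k" if h: "a \<in> hcomp S k" for a k
  proof -
    obtain a' where "a' \<in> P k" "a = kap k a'" using hcomp_kap [OF h] by blast
    then show ?thesis using kap_hcomp [OF P_uminus] kap_uminus by metis
  qed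
  show "prj k a \<in> hcomp S k" if h: "a \<in> carrier S" for a k
  proof -
    obtain p where p: "p \<in> rees" "a = rho p" using rho_surj [OF h] by blast
    then show ?thesis using kap_hcomp [of "p k" k] by (simp add: prj_rho rees_def)
  qed
  show "prj k a = a" if "a \<in> hcomp S k" for a k
    using that unfolding S_simps by (auto simp: prj_def fun_eq_iff)
  show "prj k (a \<oplus>\<^bsub>S\<^esub> b) = prj k a \<oplus>\<^bsub>S\<^esub> prj k b" for a b k
    by (rule ext) (simp add: S_simps prj_def Q_set_add)
  show "prj (k + l) (a \<otimes>\<^bsub>S\<^esub> b) = a \<otimes>\<^bsub>S\<^esub> prj l b" if ab: "a \<in> hcomp S k" "b \<in> carrier S" for a b k l
  proof -
    obtain a' p where a': "a' \<in> P k" "a = kap k a'" and p: "p \<in> rees" "b = rho p"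
      using hcomp_kap [OF ab(1)] rho_surj [OF ab(2)] by blast
    have "p l \<in> P l" using p by (simp add: rees_def)
    then show ?thesis
      unfolding a' p prj_rho kap_mult [OF a'(1) \<open>p l \<in> P l\<close>]
      by (intro ext, simp add: prj_def kap_rho_mult [OF a'(1) p(1)], simp add: kap_def)
  qed
  show "prj l (a \<otimes>\<^bsub>S\<^esub> b) = \<zero>\<^bsub>S\<^esub>" if ab: "a \<in> hcomp S k" "b \<in> carrier S" "l < k" for a b k l
  proof -
    obtain a' p where a': "a' \<in> P k" "a = kap k a'" and p: "p \<in> rees" "b = rho p"
      using hcomp_kap [OF ab(1)] rho_surj [OF ab(2)] by blast
    show ?thesis
      unfolding a' p by (intro ext) (use ab(3) in \<open>simp add: prj_def kap_rho_mult [OF a'(1) p(1)] S_simps(5)\<close>)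
  qed
qed


text \<open>The top component is peeled off. What remains is still in the carrier because it is the
  image of a lift whose coefficient at \<open>Suc N\<close> has been set to zero.\<close>

lemma sum_hcomp_ex:
  assumes "f \<in> carrier S" "f 0 = Q 0" "\<And>k. k > N \<Longrightarrow> f k = Q k"
  shows "\<exists>g. (\<forall>n\<in>{1..N}. g n \<in> hcomp S n) \<and> f = (\<Oplus>\<^bsub>S\<^esub> n\<in>{1..N}. g n)"
  using assms
proof (induction N arbitrary: f)
  interpret S: graded_cring S prj by (rule S_graded)
  case 0
  then have "f k = Q k" for k by (cases k) auto
  then have "f = \<zero>\<^bsub>S\<^esub>" unfolding S_simps by (rule ext)
  then show ?case by simp
next
  interpret S: graded_cring S prj by (rule S_graded)
  case (Suc N)
  define f' where "f' = f(Suc N := Q (Suc N))"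
  obtain p where p: "p \<in> rees" "f = rho p" using rho_surj [OF Suc.prems(1)] by blast
  have "p(Suc N := \<zero>) \<in> rees"
  proof -
    obtain M where "bound \<zero> M p" using p(1) by (auto simp: rees_def)
    then have "bound \<zero> M (p(Suc N := \<zero>))" by (auto simp: bound_def)
    then show ?thesis using p(1) P_zero P_closed by (auto simp: rees_def intro!: mem_upI)
  qed
  moreover have "f' = rho (p(Suc N := \<zero>))"
    by (rule ext) (simp add: f'_def p(2) rho_def ct_zero)
  ultimately have f'c: "f' \<in> carrier S" using rho_closed by simp
  have f'2: "f' k = Q k" if "k > N" for k using Suc.prems(3) [of k] that by (cases "k = Suc N") (simp_all add: f'_def)
  have f'0: "f' 0 = Q 0" using Suc.prems(2) by (simp add: f'_def)
  obtain g where g: "\<forall>n\<in>{1..N}. g n \<in> hcomp S n" "f' = (\<Oplus>\<^bsub>S\<^esub> n\<in>{1..N}. g n)"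
    using Suc.IH [OF f'c _ f'2] f'0 by blast
  define h where "h = g(Suc N := prj (Suc N) f)"
  have hS: "prj (Suc N) f \<in> hcomp S (Suc N)" using Suc.prems(1) by (rule S.pr_mem)
  have h: "h n \<in> hcomp S n" if "n \<in> {1..Suc N}" for n
    using g(1) hS that by (cases "n = Suc N") (auto simp: h_def)
  have hcl: "h n \<in> carrier S" if "n \<in> {1..Suc N}" for n
    using h [OF that] by (rule S.hcomp_closed)
  have "f = prj (Suc N) f \<oplus>\<^bsub>S\<^esub> f'"
  proof
    fix n
    show "f n = (prj (Suc N) f \<oplus>\<^bsub>S\<^esub> f') n"
    proof (cases "n = Suc N")
      case True
      have "p (Suc N) \<in> carrier R" using p(1) P_closed by (auto simp: rees_def)
      then show ?thesis using True ct_add [of "p (Suc N)" \<zero> "Suc N"]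
        by (simp add: S_simps prj_def f'_def p(2) rho_def ct_zero)
    next
      case False
      have "p n \<in> carrier R" using p(1) P_closed by (auto simp: rees_def)
      then show ?thesis using False ct_add [of \<zero> "p n" n]
        by (simp add: S_simps prj_def f'_def p(2) rho_def ct_zero)
    qed
  qed
  also have "\<dots> = h (Suc N) \<oplus>\<^bsub>S\<^esub> (\<Oplus>\<^bsub>S\<^esub> n\<in>{1..N}. h n)"
  proof -
    have "(\<Oplus>\<^bsub>S\<^esub> n\<in>{1..N}. h n) = f'"
      unfolding g(2) by (rule S.finsum_cong_strong) (use g(1) in \<open>auto simp: h_def intro!: S.hcomp_closed\<close>)
    then show ?thesis by (simp add: h_def)
  qed
  also have "\<dots> = (\<Oplus>\<^bsub>S\<^esub> n\<in>insert (Suc N) {1..N}. h n)"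
    by (rule S.finsum_insert [symmetric]) (use hcl in \<open>auto simp: Pi_iff\<close>)
  also have "insert (Suc N) {1..N} = {1..Suc N}" by auto
  finally show ?case using h by blast
qed

text \<open>The elements without a component in degree 0 form an ideal containing the generators,
  which gives one inclusion. For the other, \<open>P (Suc n) = P 1 \<cdot> P n\<close> writes every
  class of positive degree as a sum of products with classes of degree one.\<close>

lemma generates_irrelevant_map:
  assumes ys: "set ys \<subseteq> P 1" "P 1 = genideal R (set ys)"
    and gen: "\<And>n. P (Suc n) = P 1 \<cdot> P n"
  shows "generates_irrelevant S (map (kap 1) ys)"
  unfolding generates_irrelevant_def
proof (intro conjI equalityI subsetI)
  interpret S: graded_cring S prj by (rule S_graded)
  let ?Y = "set (map (kap 1) ys)"
  let ?J = "genideal S ?Y"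
  show Y: "f \<in> hcomp S 1" if "f \<in> ?Y" for f using that ys kap_hcomp by auto
  then have Yc: "?Y \<subseteq> carrier S" using S.hcomp_closed by blast
  interpret J: ideal ?J S using Yc by (rule S.genideal_ideal)
  have ysc: "set ys \<subseteq> carrier R" using ys(1) P_closed by blast
  \<comment> \<open>Generation is transported from \<open>R\<close>: those members of
    \<open>P 1\<close> whose class lies in \<open>?J\<close> form an ideal of \<open>R\<close> that
    contains \<open>ys\<close>.\<close>
  have K1: "kap 1 i \<in> ?J" if "i \<in> P 1" for i
  proof -
    have "ideal {i \<in> P 1. kap 1 i \<in> ?J} R"
    proof (rule ideal_memI)
      show "\<zero> \<in> {i \<in> P 1. kap 1 i \<in> ?J}" using P_zero J.zero_closed by (simp add: kap_zero)
      fix a b assume ab: "a \<in> {i \<in> P 1. kap 1 i \<in> ?J}"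
      then show "a \<oplus> b \<in> {i \<in> P 1. kap 1 i \<in> ?J}" if b: "b \<in> {i \<in> P 1. kap 1 i \<in> ?J}"
      proof -
        have "kap 1 a \<oplus>\<^bsub>S\<^esub> kap 1 b \<in> ?J" by (rule J.a_closed) (use ab b in auto)
        then have "kap 1 (a \<oplus> b) \<in> ?J" using ab b by (simp only: kap_add mem_Collect_eq)
        then show ?thesis using P_add ab b by blast
      qed
      show "r \<otimes> a \<in> {i \<in> P 1. kap 1 i \<in> ?J}" if r: "r \<in> carrier R" for r
      proof -
        have "kap 0 r \<otimes>\<^bsub>S\<^esub> kap 1 a = kap (0 + 1) (r \<otimes> a)"
          by (rule kap_mult) (use ab r P_0 in auto)
        moreover have "kap 0 r \<in> carrier S" using r by (simp add: kap_closed P_0)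
        moreover have "kap 1 a \<in> ?J" using ab by blast
        ultimately have "kap (0 + 1) (r \<otimes> a) \<in> ?J" using J.I_l_closed by metis
        then show ?thesis using P_l_mult ab r by simp
      qed
    qed (use P_closed in auto)
    moreover have "set ys \<subseteq> {i \<in> P 1. kap 1 i \<in> ?J}" using ys(1) S.genideal_self [OF Yc] by auto
    ultimately have "genideal R (set ys) \<subseteq> {i \<in> P 1. kap 1 i \<in> ?J}" by (rule genideal_minimal)
    then show ?thesis using that ys(2) by auto
  qed
  have K: "kap (Suc n) a \<in> ?J" if "a \<in> P (Suc n)" for n a
  proof -
    have "a \<in> P 1 \<cdot> P n" using that gen [of n] by blast
    then have "a \<in> P (Suc n) \<and> kap (Suc n) a \<in> ?J"
    proof (induction a)
      case (prod i j)
      have "kap 1 i \<otimes>\<^bsub>S\<^esub> kap n j \<in> ?J"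
        using K1 [OF prod(1)] kap_closed [OF prod(2)] by (rule J.I_r_closed)
      then have "kap (1 + n) (i \<otimes> j) \<in> ?J" by (simp only: kap_mult [OF prod])
      then show ?case using P_mult [OF prod] by (simp only: plus_1_eq_Suc simp_thms)
    next
      case (sum a b)
      have "kap (Suc n) a \<oplus>\<^bsub>S\<^esub> kap (Suc n) b \<in> ?J"
        by (rule J.a_closed) (use sum.IH in blast)+
      then have "kap (Suc n) (a \<oplus> b) \<in> ?J" using sum.IH by (simp only: kap_add)
      moreover have "a \<oplus> b \<in> P (Suc n)" by (rule P_add) (use sum.IH in blast)+
      ultimately show ?case by blast
    qed
    then show ?thesis by simp
  qed
  show "f \<in> irrelevant_ideal S" if f: "f \<in> ?J" for f
  proof -
    \<comment> \<open>The degree-0 coefficient of a product depends only on the degree-0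
      coefficients of the factors.\<close>
    have "ideal {f \<in> carrier S. f 0 = Q 0} S"
    proof (rule S.ideal_memI)
      show "\<zero>\<^bsub>S\<^esub> \<in> {f \<in> carrier S. f 0 = Q 0}" using S.zero_closed by (simp add: S_simps(5))
      fix a b assume ab: "a \<in> {f \<in> carrier S. f 0 = Q 0}"
      show "a \<oplus>\<^bsub>S\<^esub> b \<in> {f \<in> carrier S. f 0 = Q 0}" if b: "b \<in> {f \<in> carrier S. f 0 = Q 0}"
      proof -
        have "(a \<oplus>\<^bsub>S\<^esub> b) 0 = Q 0" using ab b by (simp add: S_simps(3) Q_set_add)
        then show ?thesis using S.a_closed [of a b] ab b by blast
      qed
      show "r \<otimes>\<^bsub>S\<^esub> a \<in> {f \<in> carrier S. f 0 = Q 0}" if r: "r \<in> carrier S" for r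
      proof -
        obtain p where p: "p \<in> rees" "a = rho p" using rho_surj ab by blast
        obtain q where q: "q \<in> rees" "r = rho q" using rho_surj [OF r] by blast
        have pq: "p \<in> up R" "q \<in> up R" using p q by (auto simp: rees_def)
        have "p 0 \<in> Q 0" proof -
          have "p 0 \<in> carrier R" using p(1) P_closed [of "p 0" 0] by (simp add: rees_def)
          moreover have "ct 0 (p 0) = Q 0" using ab unfolding p(2) by (simp add: rho_def)
          ultimately show ?thesis using ct_eq_Q by blast
        qed
        then have "q 0 \<otimes> p 0 \<in> Q 0" using Q_mult [of "q 0" 0 "p 0" 0] q(1) by (simp add: rees_def)
        moreover have "(q \<otimes>\<^bsub>UP R\<^esub> p) 0 = q 0 \<otimes> p 0"
          using mem_upD [OF pq(1), of 0] mem_upD [OF pq(2), of 0] pq by (simp add: UP_ops)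
        ultimately have "(r \<otimes>\<^bsub>S\<^esub> a) 0 = Q 0"
          unfolding p(2) q(2) rho_mult [OF q(1) p(1)]
          using ct_eq_Q [of "q 0 \<otimes> p 0" 0] Q_closed [of "q 0 \<otimes> p 0" 0] by (simp add: rho_def)
        then show ?thesis using S.m_closed [of r a] ab r by blast
      qed
    qed auto
    moreover have "?Y \<subseteq> {f \<in> carrier S. f 0 = Q 0}"
      using Yc by (auto simp: kap_def)
    ultimately have "?J \<subseteq> {f \<in> carrier S. f 0 = Q 0}" by (rule S.genideal_minimal)
    then have f0: "f \<in> carrier S" "f 0 = Q 0" using f by auto
    have "finite {n. f n \<noteq> Q n}" using f0(1) unfolding S_simps graded_quotient_carrier_def by simp
    then obtain N where "{n. f n \<noteq> Q n} \<subseteq> {..N}" using finite_nat_iff_bounded_le by auto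
    then have "\<And>k. k > N \<Longrightarrow> f k = Q k" by auto
    from sum_hcomp_ex [OF f0 this] show ?thesis unfolding irrelevant_ideal_def by auto
  qed
  show "f \<in> ?J" if h: "f \<in> irrelevant_ideal S" for f
  proof -
    obtain g N where g: "\<forall>n\<in>{1..N::nat}. g n \<in> hcomp S n" "f = (\<Oplus>\<^bsub>S\<^esub> n\<in>{1..N}. g n)"
      using h unfolding irrelevant_ideal_def by blast
    have "g n \<in> ?J" if n: "n \<in> {1..N}" for n
    proof -
      obtain a where a: "a \<in> P n" "g n = kap n a" using hcomp_kap g(1) n by blast
      obtain m where "n = Suc m" using n by (cases n) auto
      then show ?thesis using K a by simp
    qed
    moreover have "(\<Oplus>\<^bsub>S\<^esub> n\<in>A. g n) \<in> ?J" if "finite A" "\<forall>n\<in>A. g n \<in> ?J" for A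
      using that
    proof (induction A)
      case (insert n A)
      have "(\<Oplus>\<^bsub>S\<^esub> n\<in>insert n A. g n) = g n \<oplus>\<^bsub>S\<^esub> (\<Oplus>\<^bsub>S\<^esub> n\<in>A. g n)"
        by (rule S.finsum_insert) (use insert.hyps insert.prems J.Icarr in auto)
      then show ?case using insert J.a_closed by simp
    qed (simp only: S.finsum_empty J.zero_closed)
    ultimately show ?thesis unfolding g(2) by blast
  qed
qed

end


section \<open>Vanishing on representatives\<close>

text \<open>Cech cohomology is graded by the integers while the ideals are indexed by naturals;
  numerators of negative degree are zero.\<close>

definition zext :: "('a, 'b) ring_scheme \<Rightarrow> (nat \<Rightarrow> 'a set) \<Rightarrow> int \<Rightarrow> 'a set" where
  "zext R P d = (if d \<ge> 0 then P (nat d) else {\<zero>\<^bsub>R\<^esub>})"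

text \<open>The condition of \<open>cech_vanishes\<close> for the graded quotient, on representatives in \<open>R\<close>.\<close>

definition quot_vanishes :: "('a, 'b) ring_scheme \<Rightarrow> (nat \<Rightarrow> 'a set) \<Rightarrow> (nat \<Rightarrow> 'a set) \<Rightarrow>
    (nat \<Rightarrow> 'a) \<Rightarrow> nat set \<Rightarrow> nat \<Rightarrow> int \<Rightarrow> bool" where
  "quot_vanishes R P Q y U p n \<longleftrightarrow> (\<forall>N. \<forall>a \<in> Pow U \<rightarrow> carrier R.
     (\<forall>s\<subseteq>U. card s = p \<longrightarrow> a s \<in> zext R P (n + int (N * p))) \<longrightarrow>
     (\<forall>s\<subseteq>U. card s = Suc p \<longrightarrow> kdiff R y N a s \<in> zext R Q (n + int (N * p) + int N)) \<longrightarrow>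
     (\<exists>T. \<exists>b \<in> Pow U \<rightarrow> carrier R.
       (\<forall>s\<subseteq>U. Suc (card s) = p \<longrightarrow> b s \<in> zext R P (n + int ((N + T) * p) - int (N + T))) \<and>
       (\<forall>s\<subseteq>U. card s = p \<longrightarrow> kprod R y s [^]\<^bsub>R\<^esub> T \<otimes>\<^bsub>R\<^esub> a s \<ominus>\<^bsub>R\<^esub> kdiff R y (N + T) b s
          \<in> zext R Q (n + int ((N + T) * p)))))"

section \<open>Lifting Koszul cochains from the graded quotient to the base ring\<close>

context graded_quot
begin

abbreviation Pz where "Pz \<equiv> zext R P"
abbreviation Qz where "Qz \<equiv> zext R Q"

definition kz :: "int \<Rightarrow> 'a \<Rightarrow> nat \<Rightarrow> 'a set" where
  "kz d a = (if d \<ge> 0 then kap (nat d) a else \<zero>\<^bsub>S\<^esub>)"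

lemma Pz_closed: "a \<in> Pz d \<Longrightarrow> a \<in> carrier R"
  by (auto simp: zext_def P_closed split: if_splits)

lemma Pz_zero: "\<zero> \<in> Pz d"
  by (simp add: zext_def P_zero)

lemma Pz_add: "a \<in> Pz d \<Longrightarrow> b \<in> Pz d \<Longrightarrow> a \<oplus> b \<in> Pz d"
  by (auto simp: zext_def P_add split: if_splits)

lemma kz_gcomp: "a \<in> Pz d \<Longrightarrow> kz d a \<in> gcomp S d"
  by (auto simp: zext_def kz_def gcomp_def kap_hcomp split: if_splits)

lemma kz_closed: "a \<in> Pz d \<Longrightarrow> kz d a \<in> carrier S"
  using kz_gcomp graded_cring.gcomp_closed [OF S_graded] by blast

lemma gcomp_kz: "f \<in> gcomp S d \<Longrightarrow> \<exists>a\<in>Pz d. f = kz d a"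
  using hcomp_kap [of f "nat d"] by (auto simp: zext_def kz_def gcomp_def split: if_splits)

lemma kz_zero: "kz d \<zero> = \<zero>\<^bsub>S\<^esub>"
  by (simp add: kz_def kap_zero)

lemma kz_add: "a \<in> Pz d \<Longrightarrow> b \<in> Pz d \<Longrightarrow> kz d (a \<oplus> b) = kz d a \<oplus>\<^bsub>S\<^esub> kz d b"
proof -
  interpret S: graded_cring S prj by (rule S_graded)
  assume "a \<in> Pz d" "b \<in> Pz d"
  then show ?thesis
    by (cases "d \<ge> 0") (simp_all add: kz_def zext_def kap_add)
qed

lemma kz_eq_zero: "a \<in> Pz d \<Longrightarrow> kz d a = \<zero>\<^bsub>S\<^esub> \<longleftrightarrow> a \<in> Qz d"
  by (cases "d \<ge> 0") (simp_all add: kz_def zext_def kap_eq_zero)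

lemma Pz_mult: "a \<in> P k \<Longrightarrow> b \<in> Pz d \<Longrightarrow> a \<otimes> b \<in> Pz (int k + d)"
proof (cases "d \<ge> 0")
  case True
  moreover assume "a \<in> P k" "b \<in> Pz d"
  ultimately show ?thesis using P_mult [of a k b "nat d"] by (simp add: zext_def nat_add_distrib)
next
  case False
  moreover assume "a \<in> P k" "b \<in> Pz d"
  ultimately show ?thesis using P_closed Pz_zero by (auto simp: zext_def)
qed

lemma Qz_mult: "a \<in> P k \<Longrightarrow> b \<in> Qz d \<Longrightarrow> a \<otimes> b \<in> Qz (int k + d)"
proof (cases "d \<ge> 0")
  case True
  moreover assume "a \<in> P k" "b \<in> Qz d"
  ultimately show ?thesis using Q_mult [of a k b "nat d"] by (simp add: zext_def nat_add_distrib)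
next
  case False
  moreover assume "a \<in> P k" "b \<in> Qz d"
  ultimately show ?thesis using P_closed Q_zero by (auto simp: zext_def)
qed

lemma kz_mult: "a \<in> P k \<Longrightarrow> b \<in> Pz d \<Longrightarrow> kap k a \<otimes>\<^bsub>S\<^esub> kz d b = kz (int k + d) (a \<otimes> b)"
proof (cases "d \<ge> 0")
  case True
  moreover assume "a \<in> P k" "b \<in> Pz d"
  ultimately show ?thesis using kap_mult [of a k b "nat d"] by (simp add: zext_def kz_def nat_add_distrib)
next
  interpret S: graded_cring S prj by (rule S_graded)
  case False
  moreover assume a: "a \<in> P k" and "b \<in> Pz d"
  ultimately have b: "b = \<zero>" by (simp add: zext_def)
  then show ?thesis using kap_closed [OF a] P_closed [OF a] by (simp add: kz_zero)
qed

lemma kz_eq_iff: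
  assumes "a \<in> Pz d" "b \<in> Pz d"
  shows "kz d a = kz d b \<longleftrightarrow> a \<ominus> b \<in> Qz d"
proof -
  interpret S: graded_cring S prj by (rule S_graded)
  have cl: "a \<in> carrier R" "b \<in> carrier R" using assms Pz_closed by auto
  have nb: "\<ominus> b \<in> Pz d" using assms(2) P_uminus by (auto simp: zext_def split: if_splits)
  have c: "a \<ominus> b \<in> Pz d" unfolding a_minus_def by (rule Pz_add [OF assms(1) nb])
  have "kz d (a \<ominus> b) \<oplus>\<^bsub>S\<^esub> kz d b = kz d ((a \<ominus> b) \<oplus> b)"
    using kz_add [OF c assms(2)] by simp
  also have "(a \<ominus> b) \<oplus> b = a" using cl by (simp add: a_minus_def a_assoc l_neg)
  finally have e: "kz d (a \<ominus> b) \<oplus>\<^bsub>S\<^esub> kz d b = kz d a" .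
  have k: "kz d (a \<ominus> b) \<in> carrier S" "kz d b \<in> carrier S" "kz d a \<in> carrier S"
    using kz_closed c assms by auto
  have "kz d a = kz d b \<longleftrightarrow> kz d (a \<ominus> b) = \<zero>\<^bsub>S\<^esub>"
  proof
    assume "kz d a = kz d b"
    then have "kz d (a \<ominus> b) \<oplus>\<^bsub>S\<^esub> kz d b = \<zero>\<^bsub>S\<^esub> \<oplus>\<^bsub>S\<^esub> kz d b" using e k by simp
    then show "kz d (a \<ominus> b) = \<zero>\<^bsub>S\<^esub>" using k by (simp only: S.add.right_cancel S.zero_closed)
  qed (use e k in auto)
  then show ?thesis using kz_eq_zero [OF c] by simp
qed

lemma kz_finsum:
  assumes "finite A" "\<And>i. i \<in> A \<Longrightarrow> g i \<in> Pz d"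
  shows "(\<Oplus>\<^bsub>S\<^esub> i\<in>A. kz d (g i)) = kz d (\<Oplus>i\<in>A. g i) \<and> (\<Oplus>i\<in>A. g i) \<in> Pz d"
  using assms
proof (induction A)
  interpret S: graded_cring S prj by (rule S_graded)
  case empty
  show ?case by (simp only: S.finsum_empty finsum_empty kz_zero Pz_zero simp_thms)
next
  interpret S: graded_cring S prj by (rule S_graded)
  case (insert a A)
  have IH: "(\<Oplus>\<^bsub>S\<^esub> i\<in>A. kz d (g i)) = kz d (\<Oplus>i\<in>A. g i)" "(\<Oplus>i\<in>A. g i) \<in> Pz d"
    using insert.IH insert.prems by blast+
  have ga: "g a \<in> Pz d" using insert.prems by blast
  have 1: "(\<Oplus>i\<in>insert a A. g i) = g a \<oplus> (\<Oplus>i\<in>A. g i)"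
    by (rule finsum_insert) (use insert.hyps insert.prems Pz_closed in auto)
  have 2: "(\<Oplus>\<^bsub>S\<^esub> i\<in>insert a A. kz d (g i)) = kz d (g a) \<oplus>\<^bsub>S\<^esub> (\<Oplus>\<^bsub>S\<^esub> i\<in>A. kz d (g i))"
    by (rule S.finsum_insert) (use insert.hyps insert.prems kz_closed in auto)
  show ?case
    unfolding 1 2 IH(1) kz_add [OF ga IH(2)] using Pz_add [OF ga IH(2)] by blast
qed

lemma kap_pow:
  assumes "a \<in> P k"
  shows "kap k a [^]\<^bsub>S\<^esub> (N::nat) = kap (k * N) (a [^] N) \<and> a [^] N \<in> P (k * N)"
proof (induction N)
  interpret S: graded_cring S prj by (rule S_graded)
  case 0
  show ?case by (simp add: kap_one P_0)
next
  interpret S: graded_cring S prj by (rule S_graded)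
  case (Suc N)
  have "kap k a [^]\<^bsub>S\<^esub> Suc N = kap (k * N) (a [^] N) \<otimes>\<^bsub>S\<^esub> kap k a" using Suc by simp
  also have "\<dots> = kap (k * N + k) (a [^] N \<otimes> a)"
    by (rule kap_mult) (use Suc assms in auto)
  finally show ?case using Suc P_mult [of "a [^] N" "k * N" a k] assms by (simp add: add.commute)
qed

lemma ksign_kap: "ksign S j s = kap 0 (ksign R j s)"
  using kap_uminus [of \<one> 0] by (simp add: ksign_def kap_one P_0)

lemma kprod_kap:
  assumes "finite s" "\<And>i. i \<in> s \<Longrightarrow> y i \<in> P 1"
  shows "kprod S (\<lambda>i. kap 1 (y i)) s = kap (card s) (kprod R y s) \<and> kprod R y s \<in> P (card s)"
  using assms
proof (induction s)
  interpret S: graded_cring S prj by (rule S_graded)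
  case empty
  show ?case by (simp add: kap_one P_0)
next
  interpret S: graded_cring S prj by (rule S_graded)
  case (insert j s)
  have IH: "kprod S (\<lambda>i. kap 1 (y i)) s = kap (card s) (kprod R y s)" "kprod R y s \<in> P (card s)"
    using insert.IH insert.prems by blast+
  have yj: "y j \<in> P 1" using insert.prems by blast
  have 1: "kprod R y (insert j s) = y j \<otimes> kprod R y s"
    by (rule kprod_insert) (use insert.hyps insert.prems P_closed in auto)
  have 2: "kprod S (\<lambda>i. kap 1 (y i)) (insert j s) = kap 1 (y j) \<otimes>\<^bsub>S\<^esub> kprod S (\<lambda>i. kap 1 (y i)) s"
    by (rule S.kprod_insert) (use insert.hyps insert.prems kap_closed in auto)
  have 3: "card (insert j s) = 1 + card s" using insert.hyps by simp
  show ?case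
    unfolding 1 2 3 IH(1) kap_mult [OF yj IH(2)] using P_mult [OF yj IH(2)] by blast
qed

lemma kdiff_kz:
  assumes "finite s" "\<And>i. i \<in> s \<Longrightarrow> y i \<in> P 1"
    and "\<And>j. j \<in> s \<Longrightarrow> a (s - {j}) \<in> Pz d" "\<And>j. j \<in> s \<Longrightarrow> b (s - {j}) = kz d (a (s - {j}))"
  shows "kdiff S (\<lambda>i. kap 1 (y i)) N b s = kz (d + int N) (kdiff R y N a s) \<and>
    kdiff R y N a s \<in> Pz (d + int N)"
proof -
  interpret S: graded_cring S prj by (rule S_graded)
  let ?g = "\<lambda>j. ksign R j s \<otimes> (y j [^] N \<otimes> a (s - {j}))"
  have g: "?g j \<in> Pz (d + int N)" "ksign S j s \<otimes>\<^bsub>S\<^esub> (kap 1 (y j) [^]\<^bsub>S\<^esub> N \<otimes>\<^bsub>S\<^esub> b (s - {j})) = kz (d + int N) (?g j)"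
    if j: "j \<in> s" for j
  proof -
    have yN: "y j [^] N \<in> P N" "kap 1 (y j) [^]\<^bsub>S\<^esub> N = kap N (y j [^] N)"
      using kap_pow [OF assms(2) [OF j], of N] by simp_all
    have 1: "y j [^] N \<otimes> a (s - {j}) \<in> Pz (int N + d)" using yN(1) assms(3) [OF j] by (rule Pz_mult)
    have k0: "ksign R j s \<in> P 0" by (simp add: P_0)
    have 2: "?g j \<in> Pz (int 0 + (int N + d))" using k0 1 by (rule Pz_mult)
    then show "?g j \<in> Pz (d + int N)" by (simp add: add.commute)
    have "ksign S j s \<otimes>\<^bsub>S\<^esub> (kap 1 (y j) [^]\<^bsub>S\<^esub> N \<otimes>\<^bsub>S\<^esub> b (s - {j})) = kz (int 0 + (int N + d)) (?g j)"
      unfolding yN(2) assms(4) [OF j] ksign_kap kz_mult [OF yN(1) assms(3) [OF j]] kz_mult [OF k0 1] ..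
    then show "ksign S j s \<otimes>\<^bsub>S\<^esub> (kap 1 (y j) [^]\<^bsub>S\<^esub> N \<otimes>\<^bsub>S\<^esub> b (s - {j})) = kz (d + int N) (?g j)"
      by (simp add: add.commute)
  qed
  have "kdiff S (\<lambda>i. kap 1 (y i)) N b s = (\<Oplus>\<^bsub>S\<^esub> j\<in>s. kz (d + int N) (?g j))"
    unfolding kdiff_def
    by (rule S.finsum_cong_strong) (use g kz_closed in auto)
  then show ?thesis
    using kz_finsum [OF assms(1), of ?g "d + int N"] g(1) unfolding kdiff_def by simp
qed

lemma kprod_pow_kz:
  assumes "finite s" "\<And>i. i \<in> s \<Longrightarrow> y i \<in> P 1" and a: "a \<in> Pz (n + int (N * card s))"
  shows "kprod S (\<lambda>i. kap 1 (y i)) s [^]\<^bsub>S\<^esub> T \<otimes>\<^bsub>S\<^esub> kz (n + int (N * card s)) a =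
      kz (n + int ((N + T) * card s)) (kprod R y s [^] T \<otimes> a)"
    and "kprod R y s [^] T \<otimes> a \<in> Pz (n + int ((N + T) * card s))"
proof -
  have p: "kprod S (\<lambda>i. kap 1 (y i)) s = kap (card s) (kprod R y s)" "kprod R y s \<in> P (card s)"
    using kprod_kap [of s y] assms(1,2) by blast+
  have q: "kap (card s) (kprod R y s) [^]\<^bsub>S\<^esub> T = kap (card s * T) (kprod R y s [^] T)"
    "kprod R y s [^] T \<in> P (card s * T)"
    using kap_pow [OF p(2)] by blast+
  have e: "int (card s * T) + (n + int (N * card s)) = n + int ((N + T) * card s)"
    by (simp add: algebra_simps)
  show "kprod S (\<lambda>i. kap 1 (y i)) s [^]\<^bsub>S\<^esub> T \<otimes>\<^bsub>S\<^esub> kz (n + int (N * card s)) a =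
      kz (n + int ((N + T) * card s)) (kprod R y s [^] T \<otimes> a)"
    unfolding p(1) q(1) kz_mult [OF q(2) a] e ..
  show "kprod R y s [^] T \<otimes> a \<in> Pz (n + int ((N + T) * card s))"
    using Pz_mult [OF q(2) a] unfolding e .
qed

lemma quot_vanishesI:
  assumes fin: "finite U" and y: "\<And>i. i \<in> U \<Longrightarrow> y i \<in> P 1"
    and van: "cech_vanishes S (\<lambda>i. kap 1 (y i)) U p n"
  shows "quot_vanishes R P Q y U p n"
  unfolding quot_vanishes_def
proof (intro allI ballI impI)
  interpret S: graded_cring S prj by (rule S_graded)
  let ?X = "\<lambda>i. kap 1 (y i)"
  fix N a
  let ?D = "n + int (N * p)"
  assume a: "a \<in> Pow U \<rightarrow> carrier R" and hom: "\<forall>s\<subseteq>U. card s = p \<longrightarrow> a s \<in> Pz ?D"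
    and cyc: "\<forall>s\<subseteq>U. card s = Suc p \<longrightarrow> kdiff R y N a s \<in> Qz (?D + int N)"
  have finS: "finite s" if "s \<subseteq> U" for s using that fin by (rule finite_subset)
  have yS: "y i \<in> P 1" if "s \<subseteq> U" "i \<in> s" for s i using that y by blast
  have X: "?X \<in> U \<rightarrow> hcomp S 1" by (rule funcsetI, rule kap_hcomp, rule y)
  \<comment> \<open>\<open>a s\<close> is known to lie in degree \<open>?D\<close> for
    \<open>p\<close>-element sets alone; the value zero elsewhere keeps \<open>m\<close> inside the
    ring.\<close>
  define m where "m s = (if card s = p then kz ?D (a s) else \<zero>\<^bsub>S\<^esub>)" for s
  have mg: "m s \<in> gcomp S ?D" if "s \<subseteq> U" for s
    using that hom kz_gcomp S.gcomp_zero by (simp add: m_def)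
  have mc: "m \<in> Pow U \<rightarrow> carrier S" by (rule funcsetI, rule S.gcomp_closed, rule mg) simp
  have mk: "kdiff S ?X N m s = \<zero>\<^bsub>S\<^esub>" if s: "s \<subseteq> U" "card s = Suc p" for s
  proof -
    have sub: "s - {j} \<subseteq> U" "card (s - {j}) = p" if "j \<in> s" for j
      using s that by auto
    have k: "kdiff S ?X N m s = kz (?D + int N) (kdiff R y N a s)" "kdiff R y N a s \<in> Pz (?D + int N)"
      using kdiff_kz [where y = y and a = a and d = ?D and b = m and N = N, OF finS [OF s(1)] yS [OF s(1)]] sub hom by (simp_all add: m_def)
    have "kdiff R y N a s \<in> Qz (?D + int N)" using cyc s by blast
    then show ?thesis unfolding k(1) kz_eq_zero [OF k(2)] .
  qed
  have mk': "\<forall>s\<subseteq>U. card s = Suc p \<longrightarrow> kdiff S ?X N m s = \<zero>\<^bsub>S\<^esub>"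
    and mg': "\<forall>s\<subseteq>U. card s = p \<longrightarrow> m s \<in> gcomp S ?D" using mk mg by blast+
  obtain T B where B: "B \<in> Pow U \<rightarrow> carrier S"
    "\<forall>s\<subseteq>U. card s = p \<longrightarrow> kprod S ?X s [^]\<^bsub>S\<^esub> T \<otimes>\<^bsub>S\<^esub> m s = kdiff S ?X (N + T) B s"
    using S.cech_vanishesD [OF van mc mg' mk'] by (elim exE bexE)
  let ?M = "N + T"
  let ?E = "n + int (?M * p)"
  define d where "d = ?E - int ?M"
  \<comment> \<open>Representatives for the components of \<open>B\<close> in degree
    \<open>d\<close>, the degree of \<open>?E\<close> lowered by the exponent \<open>?M\<close> that
    the differential adds.\<close>
  have "\<forall>t. \<exists>c. t \<subseteq> U \<longrightarrow> c \<in> Pz d \<and> gproj S prj d (B t) = kz d c"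
  proof
    fix t show "\<exists>c. t \<subseteq> U \<longrightarrow> c \<in> Pz d \<and> gproj S prj d (B t) = kz d c"
    proof (cases "t \<subseteq> U")
      case True
      have "gproj S prj d (B t) \<in> gcomp S d"
        by (rule S.gproj_mem, rule funcset_PowD [OF B(1) True])
      then show ?thesis using gcomp_kz by blast
    qed simp
  qed
  then obtain c where c: "\<And>t. t \<subseteq> U \<Longrightarrow> c t \<in> Pz d" "\<And>t. t \<subseteq> U \<Longrightarrow> gproj S prj d (B t) = kz d (c t)"
    by metis
  show "\<exists>T. \<exists>b \<in> Pow U \<rightarrow> carrier R.
       (\<forall>s\<subseteq>U. Suc (card s) = p \<longrightarrow> b s \<in> Pz (n + int ((N + T) * p) - int (N + T))) \<and>
       (\<forall>s\<subseteq>U. card s = p \<longrightarrow> kprod R y s [^] T \<otimes> a s \<ominus> kdiff R y (N + T) b s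
          \<in> Qz (n + int ((N + T) * p)))"
  proof (intro exI bexI conjI allI impI)
    show "c \<in> Pow U \<rightarrow> carrier R" by (rule funcsetI, rule Pz_closed, rule c(1)) simp
    show "c s \<in> Pz (?E - int ?M)" if "s \<subseteq> U" for s using c(1) [OF that] by (simp only: d_def)
    fix s assume s: "s \<subseteq> U" "card s = p"
    have as: "a s \<in> Pz (n + int (N * card s))" using hom s by blast
    have yi: "y i \<in> P 1" if "i \<in> s" for i using yS s that by blast
    have k1: "kprod S ?X s [^]\<^bsub>S\<^esub> T \<otimes>\<^bsub>S\<^esub> m s = kz ?E (kprod R y s [^] T \<otimes> a s)"
      "kprod R y s [^] T \<otimes> a s \<in> Pz ?E"
      using kprod_pow_kz [where y = y and T = T, OF finS [OF s(1)] yi as] s(2) by (simp_all add: m_def)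
    have "kdiff S ?X ?M B s = kz ?E (kprod R y s [^] T \<otimes> a s)" using B(2) s k1 by simp
    then have "kdiff S ?X ?M B s \<in> gcomp S ?E" using kz_gcomp k1(2) by simp
    from S.kdiff_gproj [OF finS [OF s(1)] s(1) X B(1) this]
    have "kdiff S ?X ?M (\<lambda>t. gproj S prj d (B t)) s = kdiff S ?X ?M B s" unfolding d_def .
    moreover have "kdiff S ?X ?M (\<lambda>t. gproj S prj d (B t)) s = kz (d + int ?M) (kdiff R y ?M c s) \<and>
        kdiff R y ?M c s \<in> Pz (d + int ?M)"
      by (rule kdiff_kz [where y = y, OF finS [OF s(1)] yi]) (assumption | ((rule c(1) | rule c(2)), use s in blast))+
    moreover have "d + int ?M = ?E" by (simp add: d_def)
    ultimately have "kz ?E (kprod R y s [^] T \<otimes> a s) = kz ?E (kdiff R y ?M c s)"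
      "kdiff R y ?M c s \<in> Pz ?E"
      using \<open>kdiff S ?X ?M B s = kz ?E (kprod R y s [^] T \<otimes> a s)\<close> by auto
    then show "kprod R y s [^] T \<otimes> a s \<ominus> kdiff R y (N + T) c s \<in> Qz (n + int ((N + T) * p))"
      using kz_eq_iff [OF k1(2)] by blast
  qed
qed

lemma quot_vanishesD:
  assumes fin: "finite U" and y: "\<And>i. i \<in> U \<Longrightarrow> y i \<in> P 1"
    and van: "quot_vanishes R P Q y U p n"
  shows "cech_vanishes S (\<lambda>i. kap 1 (y i)) U p n"
  unfolding cech_vanishes_def
proof (intro allI ballI impI)
  interpret S: graded_cring S prj by (rule S_graded)
  let ?X = "\<lambda>i. kap 1 (y i)"
  fix N m
  let ?D = "n + int (N * p)"
  assume m: "m \<in> Pow U \<rightarrow> carrier S" and hom: "\<forall>s\<subseteq>U. card s = p \<longrightarrow> m s \<in> gcomp S ?D"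
    and cyc: "\<forall>s\<subseteq>U. card s = Suc p \<longrightarrow> kdiff S ?X N m s = \<zero>\<^bsub>S\<^esub>"
  have finS: "finite s" if "s \<subseteq> U" for s using that fin by (rule finite_subset)
  have yS: "y i \<in> P 1" if "s \<subseteq> U" "i \<in> s" for s i using that y by blast
  have "\<forall>s. \<exists>c. c \<in> Pz ?D \<and> (s \<subseteq> U \<and> card s = p \<longrightarrow> m s = kz ?D c)"
  proof
    fix s show "\<exists>c. c \<in> Pz ?D \<and> (s \<subseteq> U \<and> card s = p \<longrightarrow> m s = kz ?D c)"
    proof (cases "s \<subseteq> U \<and> card s = p")
      case True
      then have "m s \<in> gcomp S ?D" using hom by blast
      then show ?thesis using gcomp_kz by blast
    next
      case False
      then show ?thesis using Pz_zero by blast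
    qed
  qed
  then obtain a where a: "\<And>s. a s \<in> Pz ?D" "\<And>s. s \<subseteq> U \<Longrightarrow> card s = p \<Longrightarrow> m s = kz ?D (a s)"
    by metis
  have ac: "a \<in> Pow U \<rightarrow> carrier R" by (rule funcsetI, rule Pz_closed, rule a(1))
  have ak: "kdiff R y N a s \<in> Qz (?D + int N)" if s: "s \<subseteq> U" "card s = Suc p" for s
  proof -
    have sub: "s - {j} \<subseteq> U" "card (s - {j}) = p" if "j \<in> s" for j
      using s that by auto
    have k: "kdiff S ?X N m s = kz (?D + int N) (kdiff R y N a s)" "kdiff R y N a s \<in> Pz (?D + int N)"
      using kdiff_kz [where y = y and a = a and d = ?D and b = m and N = N, OF finS [OF s(1)] yS [OF s(1)]] sub a by simp_all
    have "kdiff S ?X N m s = \<zero>\<^bsub>S\<^esub>" using cyc s by blast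
    then show ?thesis unfolding k(1) kz_eq_zero [OF k(2)] .
  qed
  have "\<exists>T. \<exists>b \<in> Pow U \<rightarrow> carrier R.
       (\<forall>s\<subseteq>U. Suc (card s) = p \<longrightarrow> b s \<in> Pz (n + int ((N + T) * p) - int (N + T))) \<and>
       (\<forall>s\<subseteq>U. card s = p \<longrightarrow> kprod R y s [^] T \<otimes> a s \<ominus> kdiff R y (N + T) b s
          \<in> Qz (n + int ((N + T) * p)))"
    using van [unfolded quot_vanishes_def, rule_format, OF ac] a(1) ak by blast
  then obtain T b where b: "b \<in> Pow U \<rightarrow> carrier R"
    "\<forall>s\<subseteq>U. Suc (card s) = p \<longrightarrow> b s \<in> Pz (n + int ((N + T) * p) - int (N + T))"
    "\<forall>s\<subseteq>U. card s = p \<longrightarrow> kprod R y s [^] T \<otimes> a s \<ominus> kdiff R y (N + T) b s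
          \<in> Qz (n + int ((N + T) * p))"
    by (elim exE bexE conjE)
  let ?M = "N + T"
  let ?E = "n + int (?M * p)"
  define d where "d = ?E - int ?M"
  define B where "B s = (if Suc (card s) = p then kz d (b s) else \<zero>\<^bsub>S\<^esub>)" for s
  have bd: "b s \<in> Pz d" if "s \<subseteq> U" "Suc (card s) = p" for s using b(2) that unfolding d_def by blast
  show "\<exists>T. \<exists>b\<in>Pow U \<rightarrow> carrier S. \<forall>s\<subseteq>U. card s = p \<longrightarrow>
      kprod S ?X s [^]\<^bsub>S\<^esub> T \<otimes>\<^bsub>S\<^esub> m s = kdiff S ?X (N + T) b s"
  proof (intro exI bexI allI impI funcsetI)
    show "B s \<in> carrier S" if "s \<in> Pow U" for s
      using that bd kz_closed by (simp add: B_def)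
    fix s assume s: "s \<subseteq> U" "card s = p"
    have as: "a s \<in> Pz (n + int (N * card s))" using a(1) s by simp
    have yi: "y i \<in> P 1" if "i \<in> s" for i using yS s that by blast
    have k1: "kprod S ?X s [^]\<^bsub>S\<^esub> T \<otimes>\<^bsub>S\<^esub> m s = kz ?E (kprod R y s [^] T \<otimes> a s)"
      "kprod R y s [^] T \<otimes> a s \<in> Pz ?E"
      using kprod_pow_kz [where y = y and T = T, OF finS [OF s(1)] yi as] s a(2) by simp_all
    have sub: "s - {j} \<subseteq> U" "Suc (card (s - {j})) = p" if "j \<in> s" for j
      using s that finS [OF s(1)] card_Suc_Diff1 [of s j] by auto
    have "kdiff S ?X ?M B s = kz (d + int ?M) (kdiff R y ?M b s) \<and>
        kdiff R y ?M b s \<in> Pz (d + int ?M)"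
      by (rule kdiff_kz [where y = y, OF finS [OF s(1)] yi]) (use sub bd in \<open>auto simp: B_def\<close>)
    moreover have "d + int ?M = ?E" by (simp add: d_def)
    ultimately have k2: "kdiff S ?X ?M B s = kz ?E (kdiff R y ?M b s)" "kdiff R y ?M b s \<in> Pz ?E"
      by simp_all
    have "kprod R y s [^] T \<otimes> a s \<ominus> kdiff R y ?M b s \<in> Qz ?E" using b(3) s by blast
    then show "kprod S ?X s [^]\<^bsub>S\<^esub> T \<otimes>\<^bsub>S\<^esub> m s = kdiff S ?X (N + T) B s"
      unfolding k1(1) k2(1) kz_eq_iff [OF k1(2) k2(2)] .
  qed
qed

end


lemma quot_vanishes_ex:
  assumes "quot_vanishes R P Q y U p n" "a \<in> Pow U \<rightarrow> carrier R"
    and "\<forall>s\<subseteq>U. card s = p \<longrightarrow> a s \<in> zext R P (n + int (N * p))"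
    and "\<forall>s\<subseteq>U. card s = Suc p \<longrightarrow> kdiff R y N a s \<in> zext R Q (n + int (N * p) + int N)"
  shows "\<exists>T. \<exists>b \<in> Pow U \<rightarrow> carrier R.
    (\<forall>s\<subseteq>U. Suc (card s) = p \<longrightarrow> b s \<in> zext R P (n + int ((N + T) * p) - int (N + T))) \<and>
    (\<forall>s\<subseteq>U. card s = p \<longrightarrow> kprod R y s [^]\<^bsub>R\<^esub> T \<otimes>\<^bsub>R\<^esub> a s \<ominus>\<^bsub>R\<^esub> kdiff R y (N + T) b s
          \<in> zext R Q (n + int ((N + T) * p)))"
proof -
  note v = assms(1) [unfolded quot_vanishes_def, THEN spec, of N, THEN bspec, OF assms(2)]
  show ?thesis by (rule v [THEN mp, THEN mp, OF assms(3,4)])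
qed

text \<open>Raising the exponent by \<open>T0\<close> moves the cocycle condition into degrees at
  least \<open>n1\<close>, where \<open>Q\<close> and \<open>Q'\<close> coincide, so that the
  hypothesis for \<open>Q\<close> applies to a cocycle for \<open>Q'\<close>. Its conclusion lives
  in degree \<open>n + (N + L) * p\<close>. For \<open>p \<ge> 1\<close> this is again at least
  \<open>n1\<close>; for \<open>p = 0\<close> it is \<open>n\<close>, and there the inclusion of
  \<open>Q\<close> in \<open>Q'\<close> has to be assumed.\<close>

lemma quot_vanishes_compare:
  fixes R :: "('a, 'b) ring_scheme" (structure)
  assumes Q: "graded_quot R P Q" and Q': "graded_quot R P Q'"
    and eq: "\<And>k. k \<ge> n1 \<Longrightarrow> Q k = Q' k"
    and fin: "finite U" and y: "\<And>i. i \<in> U \<Longrightarrow> y i \<in> P 1"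
    and p: "p \<ge> 1 \<or> zext R Q n \<subseteq> zext R Q' n"
    and van: "quot_vanishes R P Q y U p n"
  shows "quot_vanishes R P Q' y U p n"
  unfolding quot_vanishes_def
proof (intro allI ballI impI)
  interpret Q: graded_quot R P Q by (rule Q)
  interpret Q': graded_quot R P Q' by (rule Q')
  fix N a
  let ?D = "n + int (N * p)"
  assume a: "a \<in> Pow U \<rightarrow> carrier R" and hom: "\<forall>s\<subseteq>U. card s = p \<longrightarrow> a s \<in> zext R P ?D"
    and cyc: "\<forall>s\<subseteq>U. card s = Suc p \<longrightarrow> kdiff R y N a s \<in> zext R Q' (?D + int N)"
  have zeq: "zext R Q d = zext R Q' d" if "d \<ge> int n1" for d
    using that eq [of "nat d"] by (simp add: zext_def le_nat_iff)
  have finS: "finite s" if "s \<subseteq> U" for s using that fin by (rule finite_subset)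
  have yc: "y \<in> U \<rightarrow> carrier R" by (rule funcsetI, rule Q.P_closed, rule y)
  have kpP: "kprod R y s \<in> P (card s)" if "s \<subseteq> U" for s
    using Q.kprod_kap [OF finS [OF that], of y] y that by blast
  have kpc: "kprod R y s \<in> carrier R" if "s \<subseteq> U" for s using kpP [OF that] by (rule Q.P_closed)
  have powP: "kprod R y s [^] T \<in> P (card s * T)" if "s \<subseteq> U" for s and T :: nat
    using Q.kap_pow [OF kpP [OF that]] by blast
  \<comment> \<open>Large enough for \<open>n + T0\<close> to reach \<open>n1\<close> even when
    \<open>n\<close> is negative.\<close>
  define T0 where "T0 = nat (int n1 + \<bar>n\<bar>)"
  have T0: "n + int T0 \<ge> int n1" by (simp add: T0_def)
  define N1 where "N1 = N + T0"
  define a1 where "a1 s = kprod R y s [^] T0 \<otimes> a s" for s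
  have a1: "a1 \<in> Pow U \<rightarrow> carrier R"
    unfolding a1_def by (intro funcsetI Q.m_closed Q.nat_pow_closed kpc funcset_PowD [OF a]) simp_all
  have a1h: "\<forall>s\<subseteq>U. card s = p \<longrightarrow> a1 s \<in> zext R P (n + int (N1 * p))"
  proof (intro allI impI)
    fix s assume s: "s \<subseteq> U" "card s = p"
    have "a s \<in> zext R P ?D" using hom s by blast
    from Q.Pz_mult [OF powP [OF s(1)] this]
    have "a1 s \<in> zext R P (int (card s * T0) + ?D)" unfolding a1_def .
    moreover have "int (card s * T0) + ?D = n + int (N1 * p)" by (simp add: s N1_def algebra_simps)
    ultimately show "a1 s \<in> zext R P (n + int (N1 * p))" by (simp only:)
  qed
  have a1k: "\<forall>s\<subseteq>U. card s = Suc p \<longrightarrow> kdiff R y N1 a1 s \<in> zext R Q (n + int (N1 * p) + int N1)"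
  proof (intro allI impI)
    fix s assume s: "s \<subseteq> U" "card s = Suc p"
    have "kdiff R y N1 a1 s = kprod R y s [^] T0 \<otimes> kdiff R y N a s"
      unfolding a1_def [abs_def] N1_def by (rule Q.kdiff_shift [OF finS [OF s(1)] s(1) yc a])
    moreover have "kdiff R y N a s \<in> zext R Q' (?D + int N)" using cyc s by blast
    ultimately have "kdiff R y N1 a1 s \<in> zext R Q' (int (card s * T0) + (?D + int N))"
      using Q'.Qz_mult [OF powP [OF s(1)]] by (simp only:)
    moreover have e: "int (card s * T0) + (?D + int N) = n + int (N1 * p) + int N1"
      by (simp add: s N1_def algebra_simps)
    moreover have "n + int (N1 * p) + int N1 \<ge> int n1"
    proof -
      have "int N1 \<ge> int T0" "int (N1 * p) \<ge> 0" by (simp_all add: N1_def)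
      then show ?thesis using T0 by linarith
    qed
    ultimately show "kdiff R y N1 a1 s \<in> zext R Q (n + int (N1 * p) + int N1)"
      using zeq by (simp only:)
  qed
  obtain T b where b: "b \<in> Pow U \<rightarrow> carrier R"
    "\<forall>s\<subseteq>U. Suc (card s) = p \<longrightarrow> b s \<in> zext R P (n + int ((N1 + T) * p) - int (N1 + T))"
    "\<forall>s\<subseteq>U. card s = p \<longrightarrow> kprod R y s [^] T \<otimes> a1 s \<ominus> kdiff R y (N1 + T) b s
          \<in> zext R Q (n + int ((N1 + T) * p))"
    using quot_vanishes_ex [OF van a1 a1h a1k] by (elim exE bexE conjE)
  define M where "M = N1 + T"
  define b2 where "b2 s = kprod R y s [^] T0 \<otimes> b s" for s
  \<comment> \<open>The shift made before the hypothesis is applied, the exponent \<open>T\<close>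
    that it provides, and a shift of the result.\<close>
  define L where "L = T0 + T + T0"
  have NL: "N + L = M + T0" by (simp add: L_def M_def N1_def)
  show "\<exists>T. \<exists>b \<in> Pow U \<rightarrow> carrier R.
       (\<forall>s\<subseteq>U. Suc (card s) = p \<longrightarrow> b s \<in> zext R P (n + int ((N + T) * p) - int (N + T))) \<and>
       (\<forall>s\<subseteq>U. card s = p \<longrightarrow> kprod R y s [^] T \<otimes> a s \<ominus> kdiff R y (N + T) b s
          \<in> zext R Q' (n + int ((N + T) * p)))"
  proof (rule exI [of _ L], rule bexI [of _ b2], intro conjI allI impI)
    show "b2 \<in> Pow U \<rightarrow> carrier R"
      unfolding b2_def by (intro funcsetI Q.m_closed Q.nat_pow_closed kpc funcset_PowD [OF b(1)]) simp_all
    fix s assume s: "s \<subseteq> U"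
    show "b2 s \<in> zext R P (n + int ((N + L) * p) - int (N + L))" if c: "Suc (card s) = p"
    proof -
      have "b s \<in> zext R P (n + int (M * p) - int M)" using b(2) s c unfolding M_def by blast
      from Q.Pz_mult [OF powP [OF s] this]
      have "b2 s \<in> zext R P (int (card s * T0) + (n + int (M * p) - int M))" unfolding b2_def .
      moreover have "int (card s * T0) + (n + int (M * p) - int M) = n + int ((N + L) * p) - int (N + L)"
        unfolding NL c [symmetric] by (simp add: algebra_simps)
      ultimately show ?thesis by (simp only:)
    qed
    show "kprod R y s [^] L \<otimes> a s \<ominus> kdiff R y (N + L) b2 s \<in> zext R Q' (n + int ((N + L) * p))"
      if c: "card s = p"
    proof -
      have cl: "kprod R y s \<in> carrier R" "a s \<in> carrier R" "kdiff R y M b s \<in> carrier R"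
        using kpc [OF s] funcset_PowD [OF a s] Q.kdiff_closed [OF s yc b(1)] by auto
      have "kprod R y s [^] T \<otimes> a1 s \<ominus> kdiff R y M b s \<in> zext R Q (n + int (M * p))"
        using b(3) s c unfolding M_def by blast
      from Q.Qz_mult [OF powP [OF s] this]
      have 1: "kprod R y s [^] T0 \<otimes> (kprod R y s [^] T \<otimes> a1 s \<ominus> kdiff R y M b s) \<in>
          zext R Q (int (card s * T0) + (n + int (M * p)))" .
      have E: "int (card s * T0) + (n + int (M * p)) = n + int ((N + L) * p)"
        unfolding NL c by (simp add: algebra_simps)
      have kd: "kdiff R y (N + L) b2 s = kprod R y s [^] T0 \<otimes> kdiff R y M b s"
        unfolding b2_def [abs_def] NL by (rule Q.kdiff_shift [OF finS [OF s] s yc b(1)])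
      have kp: "kprod R y s [^] L \<otimes> a s = kprod R y s [^] T0 \<otimes> (kprod R y s [^] T \<otimes> a1 s)"
        using cl(1,2) by (simp add: a1_def L_def Q.m_assoc [symmetric] Q.nat_pow_mult ac_simps)
      have dist: "u \<otimes> (v \<ominus> w) = u \<otimes> v \<ominus> u \<otimes> w" if "u \<in> carrier R" "v \<in> carrier R" "w \<in> carrier R" for u v w
        using that by (simp add: a_minus_def Q.r_distr Q.r_minus)
      have "kprod R y s [^] L \<otimes> a s \<ominus> kdiff R y (N + L) b2 s =
          kprod R y s [^] T0 \<otimes> (kprod R y s [^] T \<otimes> a1 s \<ominus> kdiff R y M b s)"
        unfolding kd kp by (rule dist [symmetric]) (use cl in \<open>simp_all add: a1_def\<close>)
      then have 2: "kprod R y s [^] L \<otimes> a s \<ominus> kdiff R y (N + L) b2 s \<in> zext R Q (n + int ((N + L) * p))"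
        using 1 unfolding E by (simp only:)
      show ?thesis
      proof (cases "p \<ge> 1")
        case True
        have "T0 * 1 \<le> (N + L) * p" by (rule mult_le_mono) (use True in \<open>simp_all add: L_def\<close>)
        then have "int ((N + L) * p) \<ge> int T0" by (simp only: mult_1_right zle_int)
        then have "n + int ((N + L) * p) \<ge> int n1" using T0 by linarith
        then show ?thesis using 2 zeq by (simp only:)
      next
        case False
        then have "p = 0" by simp
        then show ?thesis using 2 p by auto
      qed
    qed
  qed
qed

section \<open>Powers of ideals and nilpotence modulo an ideal\<close>

context cring
begin

text \<open>If \<open>y\<^sup>i\<close> and \<open>Z\<^sup>n\<close> lie in \<open>K\<close>, so does \<open>(y, Z)\<^sup>i\<^sup>+\<^sup>n\<close>; the factor \<open>r\<close> makes the induction go through.\<close>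

lemma nilpotent_mod_insert:
  assumes K: "ideal K R" and Z: "ideal Z R" and W: "ideal W R" and y: "y \<in> carrier R"
    and dec: "\<And>w. w \<in> W \<Longrightarrow> \<exists>s\<in>carrier R. \<exists>z\<in>Z. w = y \<otimes> s \<oplus> z"
    and Zp: "\<And>n. ideal (Zp n) R" "Zp 0 = carrier R" "\<And>n a b. a \<in> Zp n \<Longrightarrow> b \<in> Z \<Longrightarrow> a \<otimes> b \<in> Zp (Suc n)"
    and Wp: "\<And>n. ideal (Wp n) R" "\<And>n. Wp (Suc n) = Wp n \<cdot> W"
    and "r \<in> carrier R" "y [^] (i::nat) \<otimes> r \<in> K" "\<And>z. z \<in> Zp n \<Longrightarrow> z \<otimes> r \<in> K" "w \<in> Wp (i + n)"
  shows "w \<otimes> r \<in> K"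
  using assms(11-)
proof (induction "i + n" arbitrary: i n r w)
  case 0
  interpret K: ideal K R by (rule K)
  have "r \<in> K" using 0 by simp
  then show ?case using K.I_l_closed ideal.Icarr [OF Wp(1) 0(5)] by simp
next
  case (Suc e)
  interpret K: ideal K R by (rule K)
  have wc: "w \<in> carrier R" using ideal.Icarr [OF Wp(1) Suc.prems(4)] .
  show ?case
  proof (cases "i = 0 \<or> n = 0")
    case True
    then have "r \<in> K"
    proof
      assume "i = 0" then show ?thesis using Suc.prems(1,2) by simp
    next
      assume "n = 0"
      then have "\<one> \<in> Zp n" using Zp(2) by simp
      then show ?thesis using Suc.prems(3) [of \<one>] Suc.prems(1) by simp
    qed
    then show ?thesis using wc by (rule K.I_l_closed)
  next
    case False
    then obtain i' n' where i: "i = Suc i'" and n: "n = Suc n'" by (metis not0_implies_Suc)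
    have "w \<in> Wp e \<cdot> W" using Suc.prems(4) unfolding Suc.hyps(2) [symmetric] Wp(2) .
    then show ?thesis
    proof (induction w)
      case (prod v u)
      have vc: "v \<in> carrier R" using ideal.Icarr [OF Wp(1) prod(1)] .
      obtain s z where u: "s \<in> carrier R" "z \<in> Z" "u = y \<otimes> s \<oplus> z" using dec [OF prod(2)] by blast
      have zc: "z \<in> carrier R" using ideal.Icarr [OF Z u(2)] .
      have rc: "r \<in> carrier R" by (rule Suc.prems(1))
      \<comment> \<open>In \<open>u = y s + z\<close> the first term is absorbed into
        \<open>r\<close> and lowers \<open>i\<close>; the second one is absorbed likewise and lowers
        \<open>n\<close>.\<close>
      have 1: "v \<otimes> (y \<otimes> s \<otimes> r) \<in> K"
      proof (rule Suc.hyps(1) [of i' n])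
        show "e = i' + n" using Suc.hyps(2) i by simp
        show "y \<otimes> s \<otimes> r \<in> carrier R" using y u rc by simp
        have "s \<otimes> (y [^] i \<otimes> r) \<in> K" using Suc.prems(2) u(1) by (rule K.I_l_closed)
        then show "y [^] i' \<otimes> (y \<otimes> s \<otimes> r) \<in> K" using y u(1) rc by (simp add: i m_ac)
        show "z' \<otimes> (y \<otimes> s \<otimes> r) \<in> K" if z': "z' \<in> Zp n" for z'
        proof -
          have "(y \<otimes> s) \<otimes> (z' \<otimes> r) \<in> K" by (rule K.I_l_closed [OF Suc.prems(3) [OF z']]) (use y u in simp)
          then show ?thesis using y u(1) rc ideal.Icarr [OF Zp(1) z'] by (simp add: m_ac)
        qed
        show "v \<in> Wp (i' + n)" using prod(1) \<open>e = i' + n\<close> by simp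
      qed
      have 2: "v \<otimes> (z \<otimes> r) \<in> K"
      proof (rule Suc.hyps(1) [of i n'])
        show "e = i + n'" using Suc.hyps(2) n by simp
        show "z \<otimes> r \<in> carrier R" using zc rc by simp
        have "z \<otimes> (y [^] i \<otimes> r) \<in> K" using Suc.prems(2) zc by (rule K.I_l_closed)
        then show "y [^] i \<otimes> (z \<otimes> r) \<in> K" using y zc rc by (simp add: m_ac)
        show "z' \<otimes> (z \<otimes> r) \<in> K" if z': "z' \<in> Zp n'" for z'
          using Suc.prems(3) [of "z' \<otimes> z"] Zp(3) [OF z' u(2)] zc rc ideal.Icarr [OF Zp(1) z']
          by (simp add: n m_assoc)
        show "v \<in> Wp (i + n')" using prod(1) \<open>e = i + n'\<close> by simp
      qed
      have "v \<otimes> u \<otimes> r = v \<otimes> (y \<otimes> s \<otimes> r) \<oplus> v \<otimes> (z \<otimes> r)"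
        unfolding u(3) using vc y u(1) zc rc by (simp add: l_distr r_distr m_ac)
      then show ?case using 1 2 K.a_closed by simp
    next
      case (sum a b)
      have "a \<in> carrier R" "b \<in> carrier R"
        using sum(1,2) ideal.Icarr [OF ideal_prod_is_ideal [OF Wp(1) W]] by blast+
      then show ?case using sum K.a_closed Suc.prems(1) by (simp add: l_distr)
    qed
  qed
qed

text \<open>Supplies the power laws for \<open>ideal_pow\<close>, which is a power in this
  monoid.\<close>

lemma ideals_comm_monoid: "comm_monoid (ideals_set R)"
proof (rule comm_monoidI)
  fix I J K assume "I \<in> carrier (ideals_set R)" "J \<in> carrier (ideals_set R)" "K \<in> carrier (ideals_set R)"
  then show "I \<otimes>\<^bsub>ideals_set R\<^esub> J \<otimes>\<^bsub>ideals_set R\<^esub> K = I \<otimes>\<^bsub>ideals_set R\<^esub> (J \<otimes>\<^bsub>ideals_set R\<^esub> K)"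
    by (simp add: ideals_set_def ideal_prod_assoc)
next
  fix I J assume "I \<in> carrier (ideals_set R)" "J \<in> carrier (ideals_set R)"
  then show "I \<otimes>\<^bsub>ideals_set R\<^esub> J \<in> carrier (ideals_set R)"
    and "I \<otimes>\<^bsub>ideals_set R\<^esub> J = J \<otimes>\<^bsub>ideals_set R\<^esub> I"
    using ideal_prod_is_ideal [of I J] ideal_prod_commute [of I J] by (simp_all add: ideals_set_def)
next
  fix I assume I: "I \<in> carrier (ideals_set R)"
  have "carrier R \<cdot> I = I \<cdot> carrier R" using I by (intro ideal_prod_commute oneideal) (simp add: ideals_set_def)
  then show "\<one>\<^bsub>ideals_set R\<^esub> \<otimes>\<^bsub>ideals_set R\<^esub> I = I"
    using I ideal_prod_one [of I] by (simp add: ideals_set_def)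
qed (simp add: ideals_set_def oneideal)

lemma ideal_pow_ideal: "ideal I R \<Longrightarrow> ideal (ideal_pow R I n) R"
  using monoid.nat_pow_closed [OF comm_monoid.axioms(1) [OF ideals_comm_monoid], of I n]
  by (simp add: ideals_set_def)

lemma ideal_pow_0: "ideal_pow R I 0 = carrier R"
  by (simp add: ideals_set_def nat_pow_def)

lemma ideal_pow_Suc: "ideal_pow R I (Suc n) = ideal_pow R I n \<cdot> I"
  by (simp add: ideals_set_def nat_pow_def)

lemma ideal_pow_add:
  assumes "ideal I R"
  shows "ideal_pow R I (m + n) = ideal_pow R I m \<cdot> ideal_pow R I n"
  using monoid.nat_pow_mult [OF comm_monoid.axioms(1) [OF ideals_comm_monoid], of I m n] assms
  by (simp add: ideals_set_def)

lemma ideal_pow_mult: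
  assumes "ideal I R" "a \<in> ideal_pow R I m" "b \<in> ideal_pow R I n"
  shows "a \<otimes> b \<in> ideal_pow R I (m + n)"
  unfolding ideal_pow_add [OF assms(1)] using assms(2,3) by (rule ideal_prod.prod)

lemma ideal_pow_pow:
  assumes "ideal I R"
  shows "ideal_pow R (ideal_pow R I m) n = ideal_pow R I (m * n)"
  using monoid.nat_pow_pow [OF comm_monoid.axioms(1) [OF ideals_comm_monoid], of I m n] assms
  by (simp add: ideals_set_def)

lemma ideal_pow_mono:
  assumes "ideal I R" "m \<le> n"
  shows "ideal_pow R I n \<subseteq> ideal_pow R I m"
proof -
  have "ideal_pow R I (m + (n - m)) \<subseteq> ideal_pow R I m"
    unfolding ideal_pow_add [OF assms(1)]
    using ideal_prod_inter [OF ideal_pow_ideal [OF assms(1)] ideal_pow_ideal [OF assms(1)]] by blast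
  then show ?thesis using assms(2) by simp
qed

lemma ideal_pow_1:
  assumes "ideal I R"
  shows "ideal_pow R I 1 = I"
  using monoid.nat_pow_eone [OF comm_monoid.axioms(1) [OF ideals_comm_monoid], of I] assms
  by (simp add: ideals_set_def)

lemma genideal_insert_decomp:
  assumes "y \<in> carrier R" "A \<subseteq> carrier R" "w \<in> genideal R (insert y A)"
  shows "\<exists>s\<in>carrier R. \<exists>z\<in>genideal R A. w = y \<otimes> s \<oplus> z"
proof -
  let ?L = "{w \<in> carrier R. \<exists>s\<in>carrier R. \<exists>z\<in>genideal R A. w = y \<otimes> s \<oplus> z}"
  interpret Z: ideal "genideal R A" R using assms(2) by (rule genideal_ideal)
  have "ideal ?L R"
  proof (rule ideal_memI)
    show "\<zero> \<in> ?L" using assms(1) Z.zero_closed by (auto intro!: bexI [of _ \<zero>])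
    fix a assume "a \<in> ?L"
    then obtain s z where a: "s \<in> carrier R" "z \<in> genideal R A" "a = y \<otimes> s \<oplus> z" by blast
    have zc: "z \<in> carrier R" using a Z.Icarr by blast
    show "a \<oplus> b \<in> ?L" if "b \<in> ?L" for b
    proof -
      from that obtain t u where b: "t \<in> carrier R" "u \<in> genideal R A" "b = y \<otimes> t \<oplus> u" by blast
      have uc: "u \<in> carrier R" using b Z.Icarr by blast
      have "a \<oplus> b = y \<otimes> (s \<oplus> t) \<oplus> (z \<oplus> u)"
        unfolding a b using assms(1) a(1) b(1) zc uc by (simp add: r_distr a_ac)
      moreover have "s \<oplus> t \<in> carrier R" "z \<oplus> u \<in> genideal R A" using a b by auto
      moreover have "a \<oplus> b \<in> carrier R" unfolding a b using assms(1) a(1) b(1) zc uc by simp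
      ultimately show ?thesis by blast
    qed
    show "r \<otimes> a \<in> ?L" if r: "r \<in> carrier R" for r
    proof -
      have "r \<otimes> a = y \<otimes> (r \<otimes> s) \<oplus> r \<otimes> z"
        unfolding a using assms(1) a(1) zc r by (simp add: r_distr m_ac)
      moreover have "r \<otimes> s \<in> carrier R" "r \<otimes> z \<in> genideal R A" using a r Z.I_l_closed by auto
      moreover have "r \<otimes> a \<in> carrier R" unfolding a using assms(1) a(1) zc r by simp
      ultimately show ?thesis by blast
    qed
  qed auto
  moreover have "insert y A \<subseteq> ?L"
  proof
    fix v assume "v \<in> insert y A"
    then show "v \<in> ?L"
    proof
      assume "v = y"
      moreover have "y = y \<otimes> \<one> \<oplus> \<zero>" using assms(1) by simp
      ultimately show ?thesis using assms(1) Z.zero_closed by blast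
    next
      assume v: "v \<in> A"
      then have "v = y \<otimes> \<zero> \<oplus> v" using assms(1,2) by auto
      moreover have "v \<in> genideal R A" using v genideal_self [OF assms(2)] by blast
      ultimately show ?thesis using assms(2) v by blast
    qed
  qed
  ultimately have "genideal R (insert y A) \<subseteq> ?L" by (rule genideal_minimal)
  then show ?thesis using assms(3) by blast
qed

text \<open>Generators are adjoined one at a time; the exponent \<open>i\<close> of the new
  generator and the exponent \<open>n\<close> of the ideal of the others add up.\<close>

lemma ideal_pow_in_ideal:
  assumes "finite A" "A \<subseteq> carrier R" "ideal K R" "\<And>y. y \<in> A \<Longrightarrow> \<exists>k::nat. y [^] k \<in> K"
  shows "\<exists>m. ideal_pow R (genideal R A) m \<subseteq> K"
  using assms(1,2,4)
proof (induction A)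
  case empty
  interpret K: ideal K R by fact
  have "genideal R {} \<subseteq> K" by (rule genideal_minimal [OF assms(3)]) simp
  then have "ideal_pow R (genideal R {}) 1 \<subseteq> K" using ideal_pow_1 genideal_ideal by simp
  then show ?case by blast
next
  case (insert y A)
  have A: "A \<subseteq> carrier R" "y \<in> carrier R" "insert y A \<subseteq> carrier R" using insert.prems by auto
  have Z: "ideal (genideal R A) R" and W: "ideal (genideal R (insert y A)) R"
    using genideal_ideal A by blast+
  obtain n where n: "ideal_pow R (genideal R A) n \<subseteq> K" using insert by blast
  obtain i :: nat where i: "y [^] i \<in> K" using insert.prems by blast
  have "w \<in> K" if w: "w \<in> ideal_pow R (genideal R (insert y A)) (i + n)" for w
  proof -
    have "w \<otimes> \<one> \<in> K"
    proof (rule nilpotent_mod_insert [where Zp = "ideal_pow R (genideal R A)" and Wp = "ideal_pow R (genideal R (insert y A))",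
          OF assms(3) Z W A(2) genideal_insert_decomp [OF A(2,1)] ideal_pow_ideal [OF Z] ideal_pow_0 _
            ideal_pow_ideal [OF W] ideal_pow_Suc _ _ _ w])
      show "a \<otimes> b \<in> ideal_pow R (genideal R A) (Suc n)"
        if "a \<in> ideal_pow R (genideal R A) n" "b \<in> genideal R A" for n a b
        unfolding ideal_pow_Suc using that by (rule ideal_prod.prod)
      show "y [^] i \<otimes> \<one> \<in> K" using i A by simp
      show "z \<otimes> \<one> \<in> K" if "z \<in> ideal_pow R (genideal R A) n" for z
        using that n ideal.Icarr [OF ideal_pow_ideal [OF Z] that] by auto
    qed auto
    moreover have "w \<in> carrier R" using ideal.Icarr [OF ideal_pow_ideal [OF W] w] .
    ultimately show ?thesis by simp
  qed
  then show ?case by blast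
qed

end


section \<open>Ratliff--Rush closures\<close>

text \<open>In a Noetherian ring the union of a nonempty chain of ideals belongs to the chain, so
  Zorn's lemma applies to any nonempty family of ideals.\<close>

lemma (in noetherian_ring) ideal_maximal_element:
  assumes "\<A> \<noteq> {}" "\<And>J. J \<in> \<A> \<Longrightarrow> ideal J R"
  shows "\<exists>K\<in>\<A>. \<forall>J\<in>\<A>. K \<subseteq> J \<longrightarrow> J = K"
proof (rule subset_Zorn)
  fix C assume C: "subset.chain \<A> C"
  show "\<exists>K\<in>\<A>. \<forall>J\<in>C. J \<subseteq> K"
  proof (cases "C = {}")
    case True
    then show ?thesis using assms(1) by blast
  next
    case False
    have sub: "C \<subseteq> \<A>" using C by (simp add: pred_on.chain_def)
    then have "C \<subseteq> {I. ideal I R}" using assms(2) by (intro subsetI CollectI) (rule assms(2), rule subsetD)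
    then have "subset.chain {I. ideal I R} C" using C by (simp add: pred_on.chain_def)
    then have "\<Union>C \<in> C" by (rule ideal_chain_is_trivial [OF False])
    with sub have "\<Union>C \<in> \<A>" by (rule subsetD)
    then show ?thesis by (rule bexI [rotated]) (intro ballI Union_upper)
  qed
qed

locale noetherian_cring = noetherian_ring + cring
begin

text \<open>The colon ideals \<open>K : y^k\<close> ascend with \<open>k\<close>, and at a maximal
  one among them they stop growing.\<close>

lemma colon_stabilizes:
  assumes K: "ideal K R" and y: "y \<in> carrier R"
  shows "\<exists>k. \<forall>c\<in>carrier R. y [^] Suc k \<otimes> c \<in> K \<longrightarrow> y [^] k \<otimes> c \<in> K"
proof -
  interpret K: ideal K R by (rule K)
  define C where "C k = {c \<in> carrier R. y [^] (k::nat) \<otimes> c \<in> K}" for k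
  have "ideal (C k) R" for k
  proof (rule ideal_memI)
    show "\<zero> \<in> C k" using y K.zero_closed by (simp add: C_def)
    show "a \<oplus> b \<in> C k" if "a \<in> C k" "b \<in> C k" for a b
      using that y K.a_closed by (simp add: C_def r_distr)
    show "r \<otimes> a \<in> C k" if a: "a \<in> C k" and r: "r \<in> carrier R" for a r
    proof -
      have "r \<otimes> (y [^] k \<otimes> a) \<in> K" using a r K.I_l_closed by (simp add: C_def)
      then show ?thesis using a r y by (simp add: C_def m_lcomm)
    qed
  qed (auto simp: C_def)
  then have "\<exists>K'\<in>range C. \<forall>J\<in>range C. K' \<subseteq> J \<longrightarrow> J = K'"
    by (intro ideal_maximal_element) auto
  then obtain k where k: "\<And>l. C k \<subseteq> C l \<Longrightarrow> C l = C k" by auto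
  have "C k \<subseteq> C (Suc k)"
  proof
    fix c assume c: "c \<in> C k"
    have "y \<otimes> (y [^] k \<otimes> c) \<in> K" using c y K.I_l_closed by (simp add: C_def)
    then show "c \<in> C (Suc k)" using c y by (simp add: C_def m_assoc m_comm m_lcomm)
  qed
  then have "C (Suc k) = C k" by (rule k)
  then have "\<forall>c\<in>carrier R. y [^] Suc k \<otimes> c \<in> K \<longrightarrow> y [^] k \<otimes> c \<in> K"
    unfolding C_def by blast
  then show ?thesis by blast
qed

text \<open>A weak form of the Artin--Rees lemma, by the classical argument with an ideal \<open>K\<close> that is
  maximal subject to \<open>K \<inter> J = I J\<close>: such a \<open>K\<close> contains a power of every element of \<open>I\<close>.\<close>

lemma ideal_pow_inter:
  assumes I: "ideal I R" and J: "ideal J R"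
  shows "\<exists>m. ideal_pow R I m \<inter> J \<subseteq> I \<cdot> J"
proof -
  let ?\<A> = "{K. ideal K R \<and> I \<cdot> J \<subseteq> K \<and> K \<inter> J \<subseteq> I \<cdot> J}"
  have "I \<cdot> J \<in> ?\<A>" using ideal_prod_is_ideal [OF I J] by simp
  then have "?\<A> \<noteq> {}" by (rule_tac notI) (simp only: empty_iff)
  moreover have "ideal L R" if "L \<in> ?\<A>" for L using that by (simp only: mem_Collect_eq)
  ultimately have "\<exists>K\<in>?\<A>. \<forall>J\<in>?\<A>. K \<subseteq> J \<longrightarrow> J = K"
    by (rule ideal_maximal_element)
  then obtain K where K0: "K \<in> ?\<A>" "\<forall>J\<in>?\<A>. K \<subseteq> J \<longrightarrow> J = K" by (elim bexE)
  have K: "ideal K R" "I \<cdot> J \<subseteq> K" "K \<inter> J \<subseteq> I \<cdot> J" using K0(1) by simp_all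
  have max: "L = K" if "ideal L R" "I \<cdot> J \<subseteq> L" "L \<inter> J \<subseteq> I \<cdot> J" "K \<subseteq> L" for L
    using K0(2) that by simp
  interpret K: ideal K R by (rule K(1))
  interpret J: ideal J R by (rule J)
  have "\<exists>k::nat. y [^] k \<in> K" if yI: "y \<in> I" for y
  proof -
    have y: "y \<in> carrier R" using yI ideal.Icarr [OF I] by blast
    obtain k where k: "\<And>c. c \<in> carrier R \<Longrightarrow> y [^] Suc k \<otimes> c \<in> K \<Longrightarrow> y [^] k \<otimes> c \<in> K"
      using colon_stabilizes [OF K(1) y] by blast
    define L where "L = genideal R (insert (y [^] k) K)"
    have ins: "insert (y [^] k) K \<subseteq> carrier R" using y K.Icarr by blast
    have L: "ideal L R" unfolding L_def using ins by (rule genideal_ideal)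
    have sub: "insert (y [^] k) K \<subseteq> L" unfolding L_def using ins by (rule genideal_self)
    have gK: "genideal R K = K"
    proof
      show "genideal R K \<subseteq> K" by (rule genideal_minimal [OF K(1)]) simp
      show "K \<subseteq> genideal R K" by (rule genideal_self) (rule K.a_subset)
    qed
    \<comment> \<open>An element \<open>u = y^k c + b\<close> of \<open>L \<inter> J\<close>
      satisfies \<open>y u \<in> I J \<subseteq> K\<close>, so \<open>y^(k+1) c \<in> K\<close>. By
      the choice of \<open>k\<close> then \<open>y^k c \<in> K\<close>, whence
      \<open>u \<in> K \<inter> J\<close>.\<close>
    have "L \<inter> J \<subseteq> I \<cdot> J"
    proof
      fix u assume u: "u \<in> L \<inter> J"
      obtain c b where cb: "c \<in> carrier R" "b \<in> K" "u = y [^] k \<otimes> c \<oplus> b"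
        using genideal_insert_decomp [of "y [^] k" K u] u y K.a_subset unfolding L_def gK by auto
      have bc: "b \<in> carrier R" using cb(2) K.Icarr by blast
      have "y \<otimes> u \<in> I \<cdot> J" using yI u by (intro ideal_prod.prod) auto
      then have yu: "y \<otimes> u \<in> K" using K(2) by blast
      have yb: "\<ominus> (y \<otimes> b) \<in> K" using cb(2) y by (intro K.a_inv_closed K.I_l_closed)
      have "y [^] Suc k \<otimes> c = y \<otimes> u \<oplus> \<ominus> (y \<otimes> b)"
        unfolding cb(3) using y cb(1) bc by (simp add: r_distr a_assoc r_neg m_ac)
      then have "y [^] Suc k \<otimes> c \<in> K" using yu yb K.a_closed by metis
      then have "y [^] k \<otimes> c \<in> K" using k cb(1) by blast
      then have "u \<in> K" unfolding cb(3) using cb(2) by (rule K.a_closed)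
      then show "u \<in> I \<cdot> J" using u K(3) by blast
    qed
    then have "L = K" using max [OF L] K(2) sub by blast
    then show ?thesis using sub by blast
  qed
  moreover obtain A where A: "A \<subseteq> carrier R" "finite A" "I = genideal R A"
    using finetely_gen [OF I] by blast
  ultimately have "\<exists>m. ideal_pow R I m \<subseteq> K"
    unfolding A(3) using genideal_self [OF A(1)] by (intro ideal_pow_in_ideal A(1,2) K(1)) blast
  then obtain m where "ideal_pow R I m \<subseteq> K" by blast
  then have "ideal_pow R I m \<inter> J \<subseteq> I \<cdot> J" using K(3) by blast
  then show ?thesis by blast
qed

text \<open>\<open>ideal_pow_inter\<close> for \<open>I^N\<close> and the principal ideal of
  \<open>x\<close> puts \<open>(I^N)^m \<inter> (x)\<close> inside \<open>x I^N\<close>, and the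
  regular element \<open>x\<close> can be cancelled. The exponent found is
  \<open>N * m\<close>.\<close>

lemma colon_regular:
  assumes I: "ideal I R" and x: "x \<in> carrier R"
    and reg: "\<And>a. a \<in> carrier R \<Longrightarrow> x \<otimes> a = \<zero> \<Longrightarrow> a = \<zero>"
  shows "\<exists>m. \<forall>c\<in>carrier R. x \<otimes> c \<in> ideal_pow R I m \<longrightarrow> c \<in> ideal_pow R I N"
proof -
  have IN: "ideal (ideal_pow R I N) R" by (rule ideal_pow_ideal [OF I])
  interpret N: ideal "ideal_pow R I N" R by (rule IN)
  obtain m where m: "ideal_pow R (ideal_pow R I N) m \<inter> cgenideal R x \<subseteq> ideal_pow R I N \<cdot> cgenideal R x"
    using ideal_pow_inter [OF IN cgenideal_ideal [OF x]] by blast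
  have prodx: "\<exists>d\<in>ideal_pow R I N. w = x \<otimes> d" if "w \<in> ideal_pow R I N \<cdot> cgenideal R x" for w
    using that
  proof (induction w)
    case (prod i j)
    obtain r where r: "r \<in> carrier R" "j = r \<otimes> x" using prod(2) by (auto simp: cgenideal_def)
    have ic: "i \<in> carrier R" using prod(1) N.Icarr by blast
    have "i \<otimes> j = x \<otimes> (r \<otimes> i)" unfolding r(2) using r(1) ic x by (simp add: m_ac)
    moreover have "r \<otimes> i \<in> ideal_pow R I N" using prod(1) r(1) by (rule N.I_l_closed)
    ultimately show ?case by blast
  next
    case (sum a b)
    then obtain d e where de: "d \<in> ideal_pow R I N" "a = x \<otimes> d" "e \<in> ideal_pow R I N" "b = x \<otimes> e" by blast
    have "a \<oplus> b = x \<otimes> (d \<oplus> e)" using de x N.Icarr by (simp add: r_distr)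
    moreover have "d \<oplus> e \<in> ideal_pow R I N" using de by (intro N.a_closed)
    ultimately show ?case by blast
  qed
  have "c \<in> ideal_pow R I N" if c: "c \<in> carrier R" and xc: "x \<otimes> c \<in> ideal_pow R I (N * m)" for c
  proof -
    have "x \<otimes> c \<in> cgenideal R x" using c x by (auto simp: cgenideal_def m_comm)
    then have "x \<otimes> c \<in> ideal_pow R I N \<cdot> cgenideal R x" using m xc unfolding ideal_pow_pow [OF I] by blast
    then obtain d where d: "d \<in> ideal_pow R I N" "x \<otimes> c = x \<otimes> d" using prodx by blast
    have dc: "d \<in> carrier R" using d(1) by (rule N.Icarr)
    have "x \<otimes> (c \<ominus> d) = x \<otimes> c \<ominus> x \<otimes> d" using x c dc by (simp add: a_minus_def r_distr r_minus)
    also have "\<dots> = \<zero>" using d(2) x dc by (simp add: a_minus_def r_neg)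
    finally have "c \<ominus> d = \<zero>" using reg c dc by blast
    then have "c = d" using c dc by (simp add: r_right_minus_eq)
    then show ?thesis using d(1) by simp
  qed
  then show ?thesis by blast
qed

end

section \<open>Cohomology of the associated graded ring in degrees 0 and 1\<close>

context cring
begin

lemma zext_int: "zext R P (int d) = P d"
  by (simp add: zext_def)

lemma ksign_singleton: "ksign R j {j} = \<one>"
proof -
  have "{i \<in> {j}. i < j} = {}" by auto
  then show ?thesis unfolding ksign_def by (simp only: card.empty) simp
qed

lemma kdiff_singleton:
  assumes "y j \<in> carrier R" "c {} \<in> carrier R"
  shows "kdiff R y N c {j} = y j [^] N \<otimes> c {}"
proof -
  have "kdiff R y N c {j} = ksign R j {j} \<otimes> (y j [^] N \<otimes> c {})"
    unfolding kdiff_def by (subst finsum_insert) (use assms in auto)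
  then show ?thesis using assms by (simp add: ksign_singleton)
qed

text \<open>With exponent 0 the differential at a pair is, up to sign, the difference of two values.
  So the same fraction \<open>a\<close> in every localization is a cocycle.\<close>

lemma kdiff_const_pair:
  assumes "card s = 2" "a \<in> carrier R" "y \<in> s \<rightarrow> carrier R"
  shows "kdiff R y 0 (\<lambda>_. a) s = \<zero>"
proof -
  obtain i j where ij: "s = {i, j}" "i \<noteq> j" using assms(1) by (auto simp: card_2_iff)
  have "kdiff R y 0 (\<lambda>_. a) (insert i {j}) = ksign R i (insert i {j}) \<otimes>
      (y i [^] (0::nat) \<otimes> a \<ominus> kdiff R y 0 (\<lambda>s. ksign R i (insert i s) \<otimes> a) {j})"
    by (rule kdiff_insert [where U = s]) (use ij assms in auto)
  also have "kdiff R y 0 (\<lambda>s. ksign R i (insert i s) \<otimes> a) {j} = y j [^] (0::nat) \<otimes> (ksign R i {i} \<otimes> a)"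
    by (rule kdiff_singleton) (use ij assms in auto)
  also have "ksign R i {i} = \<one>" by (rule ksign_singleton)
  finally show ?thesis using assms(2) ij by (simp add: a_minus_def r_neg)
qed

abbreviation gr_vanishes where
  "gr_vanishes I \<equiv> quot_vanishes R (ideal_pow R I) (\<lambda>n. ideal_pow R I (Suc n))"

text \<open>For \<open>p = 0\<close> the only index set is empty, its denominator is one and its
  coboundaries are zero. Hence \<open>T\<close> and \<open>b\<close> disappear from the conclusion,
  and the degree \<open>k\<close> does not depend on the exponent \<open>K\<close>.\<close>

lemma gr_vanishes_0D:
  assumes van: "gr_vanishes I y U 0 (int k)" and U: "finite U" "y \<in> U \<rightarrow> carrier R"
    and I: "ideal I R" and a: "a \<in> ideal_pow R I k"
    and ya: "\<And>j. j \<in> U \<Longrightarrow> y j [^] K \<otimes> a \<in> ideal_pow R I (k + K + 1)"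
  shows "a \<in> ideal_pow R I (Suc k)"
proof -
  have ac: "a \<in> carrier R" using ideal.Icarr [OF ideal_pow_ideal [OF I] a] .
  have 1: "(\<lambda>_. a) \<in> Pow U \<rightarrow> carrier R" using ac by simp
  have "int k + int (K * 0) = int k" by simp
  then have 2: "\<forall>s\<subseteq>U. card s = 0 \<longrightarrow> a \<in> zext R (ideal_pow R I) (int k + int (K * 0))"
    using a by (simp only: zext_int simp_thms)
  have 3: "\<forall>s\<subseteq>U. card s = Suc 0 \<longrightarrow> kdiff R y K (\<lambda>_. a) s \<in>
      zext R (\<lambda>n. ideal_pow R I (Suc n)) (int k + int (K * 0) + int K)"
  proof (intro allI impI)
    fix s assume s: "s \<subseteq> U" "card s = Suc 0"
    then obtain j where j: "s = {j}" "j \<in> U" by (auto simp: card_1_singleton_iff)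
    have "kdiff R y K (\<lambda>_. a) s = y j [^] K \<otimes> a"
      unfolding j(1) by (rule kdiff_singleton) (use j U ac in auto)
    moreover have e: "int k + int (K * 0) + int K = int (k + K)" by simp
    moreover have "y j [^] K \<otimes> a \<in> ideal_pow R I (Suc (k + K))" using ya [OF j(2)] by (simp only: Suc_eq_plus1)
    ultimately show "kdiff R y K (\<lambda>_. a) s \<in> zext R (\<lambda>n. ideal_pow R I (Suc n)) (int k + int (K * 0) + int K)"
      by (simp only: e zext_int)
  qed
  obtain T b where "\<forall>s\<subseteq>U. card s = 0 \<longrightarrow> kprod R y s [^] T \<otimes> a \<ominus> kdiff R y (K + T) b s
      \<in> zext R (\<lambda>n. ideal_pow R I (Suc n)) (int k + int ((K + T) * 0))"
    using quot_vanishes_ex [OF van 1 2 3] by (elim exE bexE conjE)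
  then have "kprod R y {} [^] T \<otimes> a \<ominus> kdiff R y (K + T) b {}
      \<in> zext R (\<lambda>n. ideal_pow R I (Suc n)) (int k + int ((K + T) * 0))"
    by (metis card.empty empty_subsetI)
  moreover have "int k + int ((K + T) * 0) = int k" by simp
  moreover have "kprod R y {} [^] T \<otimes> a \<ominus> kdiff R y (K + T) b {} = a" using ac by (simp add: a_minus_def)
  ultimately show ?thesis by (simp only: zext_int)
qed

lemma gr_vanishes_0I:
  assumes U: "finite U" "y \<in> U \<rightarrow> carrier R" and I: "ideal I R"
    and van: "\<And>a K. a \<in> ideal_pow R I k \<Longrightarrow> (\<And>j. j \<in> U \<Longrightarrow> y j [^] K \<otimes> a \<in> ideal_pow R I (k + K + 1))
      \<Longrightarrow> a \<in> ideal_pow R I (Suc k)"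
  shows "gr_vanishes I y U 0 (int k)"
  unfolding quot_vanishes_def
proof (intro allI ballI impI)
  fix K a
  assume a: "a \<in> Pow U \<rightarrow> carrier R"
    and hom: "\<forall>s\<subseteq>U. card s = 0 \<longrightarrow> a s \<in> zext R (ideal_pow R I) (int k + int (K * 0))"
    and cyc: "\<forall>s\<subseteq>U. card s = Suc 0 \<longrightarrow> kdiff R y K a s \<in>
      zext R (\<lambda>n. ideal_pow R I (Suc n)) (int k + int (K * 0) + int K)"
  have ac: "a {} \<in> carrier R" using funcset_PowD [OF a] by blast
  have "a {} \<in> zext R (ideal_pow R I) (int k + int (K * 0))" using hom by (metis card.empty empty_subsetI)
  moreover have "int k + int (K * 0) = int k" by simp
  ultimately have a0: "a {} \<in> ideal_pow R I k" by (simp only: zext_int)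
  have "a {} \<in> ideal_pow R I (Suc k)"
  proof (rule van [OF a0])
    fix j assume j: "j \<in> U"
    have "kdiff R y K a {j} \<in> zext R (\<lambda>n. ideal_pow R I (Suc n)) (int k + int (K * 0) + int K)"
      by (rule cyc [rule_format]) (use j in auto)
    moreover have "kdiff R y K a {j} = y j [^] K \<otimes> a {}"
      by (rule kdiff_singleton) (use j U ac in auto)
    moreover have "int k + int (K * 0) + int K = int (k + K)" by simp
    ultimately have "y j [^] K \<otimes> a {} \<in> ideal_pow R I (Suc (k + K))" by (simp only: zext_int)
    then show "y j [^] K \<otimes> a {} \<in> ideal_pow R I (k + K + 1)" by (simp only: Suc_eq_plus1)
  qed
  moreover have "int k + int ((K + 0) * 0) = int k" by simp
  ultimately have *: "a {} \<in> zext R (\<lambda>n. ideal_pow R I (Suc n)) (int k + int ((K + 0) * 0))"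
    by (simp only: zext_int)
  show "\<exists>T. \<exists>b \<in> Pow U \<rightarrow> carrier R.
    (\<forall>s\<subseteq>U. Suc (card s) = 0 \<longrightarrow> b s \<in> zext R (ideal_pow R I) (int k + int ((K + T) * 0) - int (K + T))) \<and>
    (\<forall>s\<subseteq>U. card s = 0 \<longrightarrow> kprod R y s [^] T \<otimes> a s \<ominus> kdiff R y (K + T) b s
          \<in> zext R (\<lambda>n. ideal_pow R I (Suc n)) (int k + int ((K + T) * 0)))"
  proof (rule exI [of _ 0], rule bexI [of _ "\<lambda>_. \<zero>"], intro conjI allI impI)
    fix s assume "s \<subseteq> U" "card s = 0"
    then have s: "s = {}" using U(1) finite_subset by fastforce
    have "kprod R y {} [^] (0::nat) \<otimes> a {} \<ominus> kdiff R y (K + 0) (\<lambda>_. \<zero>) {} = a {}"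
      using ac by (simp add: a_minus_def)
    then show "kprod R y s [^] (0::nat) \<otimes> a s \<ominus> kdiff R y (K + 0) (\<lambda>_. \<zero>) s
          \<in> zext R (\<lambda>n. ideal_pow R I (Suc n)) (int k + int ((K + 0) * 0))"
      unfolding s using * by (simp only:)
  qed auto
qed

text \<open>The fractions \<open>[y\<^sub>j\<^sup>K a] / y\<^sub>j\<^sup>K\<close> form a cocycle; where it is a coboundary,
  \<open>a\<close> may be corrected by an element of \<open>I\<^sup>k\<close>.\<close>

lemma gr_vanishes_1D:
  assumes van: "gr_vanishes I y U 1 (int k)" and U: "finite U" "y \<in> U \<rightarrow> carrier R"
    and I: "ideal I R" and a: "a \<in> carrier R"
    and ya: "\<And>j. j \<in> U \<Longrightarrow> y j [^] K \<otimes> a \<in> ideal_pow R I (k + K)"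
  shows "\<exists>b\<in>ideal_pow R I k. \<exists>L. \<forall>j\<in>U. y j [^] L \<otimes> (a \<ominus> b) \<in> ideal_pow R I (k + L + 1)"
proof -
  \<comment> \<open>The fraction \<open>a\<close> in every localization, rewritten from exponent 0
    to \<open>K\<close>; its differential is therefore a multiple of that of a constant
    family.\<close>
  define c where "c s = kprod R y s [^] K \<otimes> a" for s
  have kp: "kprod R y s \<in> carrier R" if "s \<subseteq> U" for s using that U(2) by (rule kprod_closed')
  have cj: "c {j} = y j [^] K \<otimes> a" "kprod R y {j} = y j" if j: "j \<in> U" for j
  proof -
    have "kprod R y (insert j {}) = y j \<otimes> kprod R y {}"
      by (rule kprod_insert) (use j U in auto)
    moreover have "y j \<in> carrier R" using j U by auto
    ultimately show "kprod R y {j} = y j" by simp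
    then show "c {j} = y j [^] K \<otimes> a" by (simp add: c_def)
  qed
  have 1: "c \<in> Pow U \<rightarrow> carrier R"
    unfolding c_def by (intro funcsetI m_closed nat_pow_closed kp a) simp
  have 2: "\<forall>s\<subseteq>U. card s = 1 \<longrightarrow> c s \<in> zext R (ideal_pow R I) (int k + int (K * 1))"
  proof (intro allI impI)
    fix s assume s: "s \<subseteq> U" "card s = 1"
    then obtain j where j: "s = {j}" "j \<in> U" by (auto simp: card_1_singleton_iff)
    have "int k + int (K * 1) = int (k + K)" by simp
    then show "c s \<in> zext R (ideal_pow R I) (int k + int (K * 1))"
      using ya [OF j(2)] by (simp only: j(1) cj(1) [OF j(2)] zext_int)
  qed
  have 3: "\<forall>s\<subseteq>U. card s = Suc 1 \<longrightarrow> kdiff R y K c s \<in>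
      zext R (\<lambda>n. ideal_pow R I (Suc n)) (int k + int (K * 1) + int K)"
  proof (intro allI impI)
    fix s assume s: "s \<subseteq> U" "card s = Suc 1"
    have "kdiff R y (0 + K) c s = kprod R y s [^] K \<otimes> kdiff R y 0 (\<lambda>_. a) s"
      unfolding c_def [abs_def]
      by (rule kdiff_shift [where U = U]) (use s U a finite_subset in auto)
    also have "kdiff R y 0 (\<lambda>_. a) s = \<zero>"
      by (rule kdiff_const_pair) (use s a U(2) in auto)
    finally have "kdiff R y K c s = \<zero>" using kp [OF s(1)] by simp
    moreover have "\<zero> \<in> ideal_pow R I (Suc n)" for n
      using ideal.axioms(1) [OF ideal_pow_ideal [OF I]] by (rule additive_subgroup.zero_closed)
    moreover have "int k + int (K * 1) + int K = int (k + K + K)" by simp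
    ultimately show "kdiff R y K c s \<in> zext R (\<lambda>n. ideal_pow R I (Suc n)) (int k + int (K * 1) + int K)"
      by (simp only: zext_int)
  qed
  obtain T b where b: "b \<in> Pow U \<rightarrow> carrier R"
    "\<forall>s\<subseteq>U. Suc (card s) = 1 \<longrightarrow> b s \<in> zext R (ideal_pow R I) (int k + int ((K + T) * 1) - int (K + T))"
    "\<forall>s\<subseteq>U. card s = 1 \<longrightarrow> kprod R y s [^] T \<otimes> c s \<ominus> kdiff R y (K + T) b s
      \<in> zext R (\<lambda>n. ideal_pow R I (Suc n)) (int k + int ((K + T) * 1))"
    using quot_vanishes_ex [OF van 1 2 3] by (elim exE bexE conjE)
  \<comment> \<open>The correction is the value of \<open>b\<close> at the empty set. The numerators
    have degree \<open>k + (K + T)\<close>, the differential accounts for \<open>K + T\<close>, and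
    \<open>k\<close> is left.\<close>
  have "b {} \<in> zext R (ideal_pow R I) (int k + int ((K + T) * 1) - int (K + T))"
    by (rule b(2) [rule_format]) auto
  moreover have "int k + int ((K + T) * 1) - int (K + T) = int k" by simp
  ultimately have b0: "b {} \<in> ideal_pow R I k" by (simp only: zext_int)
  have bc: "b {} \<in> carrier R" using funcset_PowD [OF b(1)] by blast
  have "y j [^] (K + T) \<otimes> (a \<ominus> b {}) \<in> ideal_pow R I (k + (K + T) + 1)" if j: "j \<in> U" for j
  proof -
    have yj: "y j \<in> carrier R" using j U by auto
    have "kprod R y {j} [^] T \<otimes> c {j} \<ominus> kdiff R y (K + T) b {j}
      \<in> zext R (\<lambda>n. ideal_pow R I (Suc n)) (int k + int ((K + T) * 1))"
      by (rule b(3) [rule_format]) (use j in auto)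
    moreover have "kdiff R y (K + T) b {j} = y j [^] (K + T) \<otimes> b {}"
      by (rule kdiff_singleton) (use yj bc in auto)
    moreover have "kprod R y {j} [^] T \<otimes> c {j} = y j [^] (K + T) \<otimes> a"
      unfolding cj [OF j] using yj a by (simp add: m_assoc [symmetric] nat_pow_mult add.commute)
    moreover have "y j [^] (K + T) \<otimes> a \<ominus> y j [^] (K + T) \<otimes> b {} = y j [^] (K + T) \<otimes> (a \<ominus> b {})"
      using yj a bc by (simp add: a_minus_def r_distr r_minus)
    ultimately have "y j [^] (K + T) \<otimes> (a \<ominus> b {}) \<in> zext R (\<lambda>n. ideal_pow R I (Suc n)) (int k + int ((K + T) * 1))"
      by (simp only:)
    moreover have "int k + int ((K + T) * 1) = int (k + (K + T))" by simp
    ultimately have "y j [^] (K + T) \<otimes> (a \<ominus> b {}) \<in> ideal_pow R I (Suc (k + (K + T)))" by (simp only: zext_int)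
    then show ?thesis by (simp only: Suc_eq_plus1)
  qed
  then show ?thesis using b0 by blast
qed

end

context noetherian_cring
begin

text \<open>This is the inequality \<open>a\<^sub>0(G(I)) < a\<^sub>1(G(I))\<close>, stated so that no finiteness of the invariants
  is needed: an element of \<open>H\<^sup>0\<close> in degree \<open>n\<close> is corrected, degree by degree, to elements of the
  Ratliff--Rush closures of \<open>I\<^sup>r\<close> for all \<open>r\<close>, which agree with \<open>I\<^sup>r\<close> for large \<open>r\<close>.\<close>

lemma gr_vanishes_0_if_1:
  assumes I: "ideal I R" and U: "finite U" "y \<in> U \<rightarrow> I"
    and i0: "i0 \<in> U" and reg: "\<And>a. a \<in> carrier R \<Longrightarrow> y i0 \<otimes> a = \<zero> \<Longrightarrow> a = \<zero>"
    and v1: "\<And>k. k > n \<Longrightarrow> gr_vanishes I y U 1 (int k)"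
    and v0: "\<And>k. k \<ge> n2 \<Longrightarrow> gr_vanishes I y U 0 (int k)"
  shows "gr_vanishes I y U 0 (int n)"
proof -
  note Ipow = ideal_pow_ideal [OF I]
  have yc: "y \<in> U \<rightarrow> carrier R" using U(2) ideal.Icarr [OF I] by blast
  have ycj: "y j \<in> carrier R" if "j \<in> U" for j using yc that by auto
  define x where "x = y i0"
  have x: "x \<in> carrier R" unfolding x_def using i0 by (rule ycj)
  \<comment> \<open>When the \<open>y j\<close> generate \<open>I\<close>, this is membership of
    \<open>a\<close> in the Ratliff--Rush closure of \<open>I^m\<close>, tested on powers of the
    generators.\<close>
  define tor where "tor m a \<longleftrightarrow> (\<exists>K. \<forall>j\<in>U. y j [^] K \<otimes> a \<in> ideal_pow R I (m + K))" for m :: nat and a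
  obtain m0 where m0: "\<And>c. c \<in> carrier R \<Longrightarrow> x \<otimes> c \<in> ideal_pow R I m0 \<Longrightarrow> c \<in> ideal_pow R I n2"
    using colon_regular [OF I x reg [folded x_def], of n2] by blast
  \<comment> \<open>Cancelling one factor \<open>x\<close> at first yields only
    \<open>c \<in> I^n2\<close>, by the choice of \<open>m0\<close>. The vanishing of
    \<open>H^0\<close> in degrees from \<open>n2\<close> on then lifts \<open>c\<close> one power at
    a time as far as \<open>I^m\<close>.\<close>
  have step: "c \<in> ideal_pow R I m"
    if c: "c \<in> carrier R" "tor m c" "x \<otimes> c \<in> ideal_pow R I (Suc m)" and m: "m0 \<le> m" for c m
  proof -
    have cn2: "c \<in> ideal_pow R I n2"
      using m0 [OF c(1)] c(3) ideal_pow_mono [OF I, of m0 "Suc m"] m by auto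
    obtain K where K: "\<And>j. j \<in> U \<Longrightarrow> y j [^] K \<otimes> c \<in> ideal_pow R I (m + K)"
      using c(2) unfolding tor_def by blast
    have grow: "c \<in> ideal_pow R I (n2 + d)" if "n2 + d \<le> m" for d
      using that
    proof (induction d)
      case 0
      then show ?case using cn2 by simp
    next
      case (Suc d)
      have "c \<in> ideal_pow R I (Suc (n2 + d))"
      proof (rule gr_vanishes_0D [OF v0 U(1) yc I])
        show "c \<in> ideal_pow R I (n2 + d)" using Suc by simp
        fix j assume "j \<in> U"
        then show "y j [^] K \<otimes> c \<in> ideal_pow R I (n2 + d + K + 1)"
          using K ideal_pow_mono [OF I, of "n2 + d + K + 1" "m + K"] Suc.prems by auto
      qed simp
      then show ?case by simp
    qed
    show ?thesis
    proof (cases "n2 \<le> m")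
      case True
      then show ?thesis using grow [of "m - n2"] by simp
    next
      case False
      then show ?thesis using cn2 ideal_pow_mono [OF I, of m n2] by auto
    qed
  qed
  \<comment> \<open>Starting from \<open>x^K a \<in> I^(m+K)\<close>, the factors \<open>x\<close>
    are removed one by one with \<open>step\<close>. The element \<open>x^e a\<close> satisfies
    \<open>tor (m + e)\<close> because \<open>x^e \<in> I^e\<close>.\<close>
  have closed: "a \<in> ideal_pow R I m" if a: "a \<in> carrier R" "tor m a" and m: "m0 \<le> m" for a m
  proof -
    obtain K where K: "\<And>j. j \<in> U \<Longrightarrow> y j [^] K \<otimes> a \<in> ideal_pow R I (m + K)"
      using a(2) unfolding tor_def by blast
    have "x [^] (K - i) \<otimes> a \<in> ideal_pow R I (m + (K - i))" if "i \<le> K" for i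
      using that
    proof (induction i)
      case 0
      then show ?case using K [OF i0] by (simp add: x_def)
    next
      case (Suc i)
      define e where "e = K - Suc i"
      have e: "K - i = Suc e" using Suc.prems by (simp add: e_def)
      have IH: "x [^] Suc e \<otimes> a \<in> ideal_pow R I (m + Suc e)" using Suc unfolding e by simp
      have "x [^] e \<otimes> a \<in> ideal_pow R I (m + e)"
      proof (rule step)
        show "x [^] e \<otimes> a \<in> carrier R" using x a by simp
        show "tor (m + e) (x [^] e \<otimes> a)"
          unfolding tor_def
        proof (intro exI ballI)
          fix j assume j: "j \<in> U"
          have "x [^] e \<in> ideal_pow R I e"
          proof (induction e)
            case 0
            show ?case unfolding ideal_pow_0 by simp
          next
            case (Suc e)
            then show ?case
              using ideal_prod.prod [of "x [^] e" "ideal_pow R I e" x I R] i0 U(2)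
              unfolding ideal_pow_Suc by (auto simp: x_def)
          qed
          from ideal_pow_mult [OF I this K [OF j]]
          have "x [^] e \<otimes> (y j [^] K \<otimes> a) \<in> ideal_pow R I (e + (m + K))" .
          moreover have "x [^] e \<otimes> (y j [^] K \<otimes> a) = y j [^] K \<otimes> (x [^] e \<otimes> a)"
            using x ycj [OF j] a by (simp add: m_lcomm)
          moreover have "e + (m + K) = m + e + K" by simp
          ultimately show "y j [^] K \<otimes> (x [^] e \<otimes> a) \<in> ideal_pow R I (m + e + K)" by (simp only:)
        qed
        have "x \<otimes> (x [^] e \<otimes> a) = x [^] Suc e \<otimes> a" using x a by (simp add: m_ac)
        then show "x \<otimes> (x [^] e \<otimes> a) \<in> ideal_pow R I (Suc (m + e))" using IH by simp
      qed (use m in simp)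
      then show ?case by (simp add: e_def)
    qed
    from this [of K] show ?thesis using a by simp
  qed
  show ?thesis
  proof (rule gr_vanishes_0I [OF U(1) yc I])
    fix a K assume a: "a \<in> ideal_pow R I n"
      and ya: "\<And>j. j \<in> U \<Longrightarrow> y j [^] K \<otimes> a \<in> ideal_pow R I (n + K + 1)"
    interpret N: ideal "ideal_pow R I (Suc n)" R by (rule Ipow)
    have ac: "a \<in> carrier R" using ideal.Icarr [OF Ipow a] .
    \<comment> \<open>Stage \<open>r\<close> provides a representative of \<open>a\<close> modulo
      \<open>I^(n+1)\<close> that satisfies \<open>tor\<close> for \<open>I^(n+1+r)\<close>. Stage 0
      is the cocycle condition, with its additional \<open>+ 1\<close>; each further stage uses the
      vanishing of \<open>H^1\<close> in degree \<open>n + 1 + r\<close>, which exceeds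
      \<open>n\<close>.\<close>
    have "\<exists>a'\<in>carrier R. a \<ominus> a' \<in> ideal_pow R I (Suc n) \<and> tor (Suc n + r) a'" for r
    proof (induction r)
      case 0
      have "a \<ominus> a = \<zero>" using ac by (simp add: a_minus_def r_neg)
      then have "a \<ominus> a \<in> ideal_pow R I (Suc n)" using N.zero_closed by (simp only:)
      moreover have "tor (Suc n + 0) a" unfolding tor_def using ya by (intro exI [of _ K]) simp
      ultimately show ?case using ac by blast
    next
      case (Suc r)
      then obtain a' where a': "a' \<in> carrier R" "a \<ominus> a' \<in> ideal_pow R I (Suc n)" "tor (Suc n + r) a'" by blast
      obtain K' where K': "\<And>j. j \<in> U \<Longrightarrow> y j [^] K' \<otimes> a' \<in> ideal_pow R I (Suc n + r + K')"
        using a'(3) unfolding tor_def by blast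
      have "\<exists>b\<in>ideal_pow R I (Suc n + r). \<exists>L. \<forall>j\<in>U.
          y j [^] L \<otimes> (a' \<ominus> b) \<in> ideal_pow R I (Suc n + r + L + 1)"
        by (rule gr_vanishes_1D [OF v1 U(1) yc I a'(1) K']) simp_all
      then obtain b L where b: "b \<in> ideal_pow R I (Suc n + r)"
        "\<And>j. j \<in> U \<Longrightarrow> y j [^] L \<otimes> (a' \<ominus> b) \<in> ideal_pow R I (Suc n + r + L + 1)"
        by blast
      have bN: "b \<in> ideal_pow R I (Suc n)" using b(1) ideal_pow_mono [OF I, of "Suc n" "Suc n + r"] by auto
      have bc: "b \<in> carrier R" using bN by (rule N.Icarr)
      have "a \<ominus> (a' \<ominus> b) = (a \<ominus> a') \<oplus> b"
        using ac a'(1) bc by (simp add: a_minus_def minus_add a_assoc)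
      then have "a \<ominus> (a' \<ominus> b) \<in> ideal_pow R I (Suc n)" using a'(2) bN N.a_closed by simp
      moreover have "tor (Suc n + Suc r) (a' \<ominus> b)"
        unfolding tor_def using b(2) by (intro exI [of _ L]) simp
      ultimately show ?case using a'(1) bc by blast
    qed
    \<comment> \<open>At stage \<open>m0\<close> the degree \<open>Suc n + m0\<close> is large
      enough for \<open>closed\<close>.\<close>
    from this [of m0] obtain a' where a': "a' \<in> carrier R" "a \<ominus> a' \<in> ideal_pow R I (Suc n)" "tor (Suc n + m0) a'"
      by blast
    have "a' \<in> ideal_pow R I (Suc n + m0)" by (rule closed [OF a'(1,3)]) simp
    then have a'N: "a' \<in> ideal_pow R I (Suc n)" using ideal_pow_mono [OF I, of "Suc n" "Suc n + m0"] by auto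
    have "a = (a \<ominus> a') \<oplus> a'" using ac a'(1) by (simp add: a_minus_def a_assoc l_neg)
    then show "a \<in> ideal_pow R I (Suc n)" using a'(2) a'N N.a_closed by metis
  qed
qed

end


section \<open>Comparison of the two regularities\<close>

context graded_quot
begin

text \<open>The hypotheses involve \<open>P\<close> but not \<open>Q\<close>, so one list of
  generators computes the invariants of both G(I) and F(I), and the two can be compared numerator by
  numerator.\<close>

lemma a_invariant_quot:
  assumes "set ys \<subseteq> P 1" "P 1 = genideal R (set ys)" "\<And>n. P (Suc n) = P 1 \<cdot> P n"
  shows "a_invariant S (self_module S) p =
    Sup {ereal (real_of_int n) | n. \<not> quot_vanishes R P Q (nth ys) {..<length ys} p n}"
proof -
  interpret S: graded_cring S prj by (rule S_graded)
  have y: "ys ! i \<in> P 1" if "i \<in> {..<length ys}" for i using assms(1) that by auto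
  let ?Y = "map (kap 1) ys"
  have "cech_vanishes S (nth ?Y) {..<length ?Y} p n \<longleftrightarrow> quot_vanishes R P Q (nth ys) {..<length ys} p n" for n
  proof -
    have "cech_vanishes S (\<lambda>i. kap 1 (ys ! i)) {..<length ys} p n \<longleftrightarrow> cech_vanishes S (nth ?Y) (id ` {..<length ys}) p n"
    proof (rule S.cech_vanishes_reindex)
      show "strict_mono (id :: nat \<Rightarrow> nat)" by (simp add: strict_mono_def)
      show "(!) ?Y \<in> id ` {..<length ys} \<rightarrow> hcomp S 1" using kap_hcomp [OF y] by auto
    qed simp
    moreover have "cech_vanishes S (\<lambda>i. kap 1 (ys ! i)) {..<length ys} p n \<longleftrightarrow>
        quot_vanishes R P Q (nth ys) {..<length ys} p n"
    proof
      assume "cech_vanishes S (\<lambda>i. kap 1 (ys ! i)) {..<length ys} p n"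
      then show "quot_vanishes R P Q (nth ys) {..<length ys} p n"
        by (rule quot_vanishesI [where y = "nth ys", rotated 2]) (use y in auto)
    next
      assume "quot_vanishes R P Q (nth ys) {..<length ys} p n"
      then show "cech_vanishes S (\<lambda>i. kap 1 (ys ! i)) {..<length ys} p n"
        by (rule quot_vanishesD [where y = "nth ys", rotated 2]) (use y in auto)
    qed
    ultimately show ?thesis by simp
  qed
  then show ?thesis using S.a_invariant_eq [OF generates_irrelevant_map [OF assms]] by simp
qed

end

lemma ideal_prod_mono:
  assumes "I \<subseteq> I'"
  shows "I \<cdot>\<^bsub>R\<^esub> J \<subseteq> I' \<cdot>\<^bsub>R\<^esub> J"
proof
  fix w assume "w \<in> I \<cdot>\<^bsub>R\<^esub> J"
  then show "w \<in> I' \<cdot>\<^bsub>R\<^esub> J"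
    by (induction w) (use assms in \<open>auto intro: ideal_prod.intros\<close>)
qed

context cring
begin

lemma graded_quot_assoc_graded:
  assumes I: "ideal I R"
  shows "graded_quot R (ideal_pow R I) (\<lambda>n. ideal_pow R I (Suc n))"
proof (rule graded_quot.intro [OF cring_axioms graded_quot_axioms.intro])
  show "ideal_pow R I (Suc n) \<subseteq> ideal_pow R I n" for n by (rule ideal_pow_mono [OF I]) simp
  show "a \<otimes> b \<in> ideal_pow R I (i + j)" if "a \<in> ideal_pow R I i" "b \<in> ideal_pow R I j" for a b i j
    using I that by (rule ideal_pow_mult)
  show "a \<otimes> b \<in> ideal_pow R I (Suc (i + j))" if "a \<in> ideal_pow R I i" "b \<in> ideal_pow R I (Suc j)" for a b i j
    using ideal_pow_mult [OF I that] by (simp only: add_Suc_right)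
qed (rule ideal_pow_ideal [OF I] ideal_pow_0)+

lemma graded_quot_fiber:
  assumes I: "ideal I R" and J: "ideal J R"
  shows "graded_quot R (ideal_pow R I) (\<lambda>n. J \<cdot> ideal_pow R I n)"
proof (rule graded_quot.intro [OF cring_axioms graded_quot_axioms.intro])
  note Ipow = ideal_pow_ideal [OF I]
  show "ideal (J \<cdot> ideal_pow R I n) R" for n by (rule ideal_prod_is_ideal [OF J Ipow])
  show "J \<cdot> ideal_pow R I n \<subseteq> ideal_pow R I n" for n
    using ideal_prod_inter [OF J Ipow] by blast
  show "a \<otimes> b \<in> ideal_pow R I (i + j)" if "a \<in> ideal_pow R I i" "b \<in> ideal_pow R I j" for a b i j
    using I that by (rule ideal_pow_mult)
  show "a \<otimes> b \<in> J \<cdot> ideal_pow R I (i + j)" if a: "a \<in> ideal_pow R I i" and b: "b \<in> J \<cdot> ideal_pow R I j" for a b i j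
  proof -
    have ac: "a \<in> carrier R" using ideal.Icarr [OF Ipow a] .
    show ?thesis
      using b
    proof (induction b)
      case (prod m c)
      have "m \<in> carrier R" "c \<in> carrier R"
        using ideal.Icarr [OF J prod(1)] ideal.Icarr [OF Ipow prod(2)] .
      then have "a \<otimes> (m \<otimes> c) = m \<otimes> (a \<otimes> c)" using ac by (simp add: m_lcomm)
      moreover have "m \<otimes> (a \<otimes> c) \<in> J \<cdot> ideal_pow R I (i + j)"
        using prod(1) ideal_pow_mult [OF I a prod(2)] by (rule ideal_prod.prod)
      ultimately show ?case by simp
    next
      case (sum b c)
      have "b \<in> carrier R" "c \<in> carrier R"
        using sum(1,2) ideal.Icarr [OF ideal_prod_is_ideal [OF J Ipow]] by blast+
      then have "a \<otimes> (b \<oplus> c) = a \<otimes> b \<oplus> a \<otimes> c" using ac by (simp add: r_distr)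
      then show ?case using ideal_prod.sum [OF sum.IH] by simp
    qed
  qed
qed (rule ideal_pow_ideal [OF I] ideal_pow_0)+

lemma quot_vanishes_negative:
  assumes "finite U" "n < 0"
  shows "quot_vanishes R P Q y U 0 n"
  unfolding quot_vanishes_def
proof (intro allI ballI impI)
  fix K a
  assume hom: "\<forall>s\<subseteq>U. card s = 0 \<longrightarrow> a s \<in> zext R P (n + int (K * 0))"
  show "\<exists>T. \<exists>b \<in> Pow U \<rightarrow> carrier R.
    (\<forall>s\<subseteq>U. Suc (card s) = 0 \<longrightarrow> b s \<in> zext R P (n + int ((K + T) * 0) - int (K + T))) \<and>
    (\<forall>s\<subseteq>U. card s = 0 \<longrightarrow> kprod R y s [^] T \<otimes> a s \<ominus> kdiff R y (K + T) b s
          \<in> zext R Q (n + int ((K + T) * 0)))"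
  proof (rule exI [of _ 0], rule bexI [of _ "\<lambda>_. \<zero>"], intro conjI allI impI)
    fix s assume s: "s \<subseteq> U" "card s = 0"
    then have "a s \<in> zext R P (n + int (K * 0))" using hom by blast
    then have "a s = \<zero>" using assms(2) by (simp add: zext_def)
    moreover have "s = {}" using s assms(1) finite_subset by fastforce
    ultimately show "kprod R y s [^] (0::nat) \<otimes> a s \<ominus> kdiff R y (K + 0) (\<lambda>_. \<zero>) s
          \<in> zext R Q (n + int ((K + 0) * 0))"
      using assms(2) by (simp add: zext_def a_minus_def)
  qed auto
qed

text \<open>The first member of a nonempty regular sequence is regular modulo the ideal of the empty
  list, which is zero.\<close>

lemma grade_pos_regular:
  assumes "grade R I > 0"
  shows "\<exists>x\<in>I \<inter> carrier R. \<forall>a\<in>carrier R. x \<otimes> a = \<zero> \<longrightarrow> a = \<zero>"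
proof -
  obtain xs where xs: "regular_sequence R xs" "set xs \<subseteq> I" "enat (length xs) > 0"
    using assms unfolding grade_def less_Sup_iff by auto
  have len: "0 < length xs" using xs(3) by (simp add: zero_enat_def)
  have "genideal R {} \<subseteq> {\<zero>}" by (rule genideal_minimal [OF zeroideal]) simp
  moreover have "\<zero> \<in> genideal R {}"
    using genideal_ideal [of "{}"] by (simp add: additive_subgroup.zero_closed ideal.axioms(1))
  ultimately have z: "genideal R {} = {\<zero>}" by blast
  have "\<forall>a\<in>carrier R. xs ! 0 \<otimes> a \<in> genideal R (set (take 0 xs)) \<longrightarrow> a \<in> genideal R (set (take 0 xs))"
    using xs(1) len unfolding regular_sequence_def by blast
  then have "\<forall>a\<in>carrier R. xs ! 0 \<otimes> a = \<zero> \<longrightarrow> a = \<zero>" by (simp add: z)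
  moreover have "xs ! 0 \<in> I \<inter> carrier R"
    using xs(1,2) nth_mem [OF len] unfolding regular_sequence_def by blast
  ultimately show ?thesis by blast
qed

end

theorem proposition2p5:
  fixes A :: "('a, 'b) ring_scheme" and \<mm> I :: "'a set" and n0 :: nat
  assumes "noetherian_ring A" and "local_ring A \<mm>"
    and "infinite (carrier (A Quot \<mm>))"
    and "krull_dim A > 0"
    and "primary_to A \<mm> I"
    and "grade A I > 0"
    and "n0 > 0" and "ideal_pow A I n0 = \<mm> \<cdot>\<^bsub>A\<^esub> ideal_pow A I (n0 - 1)"
  shows "regularity (fiber_cone A \<mm> I) (self_module (fiber_cone A \<mm> I)) =
         regularity (assoc_graded_ring A I) (self_module (assoc_graded_ring A I))"
proof -
  have cr: "cring A" and max: "maximalideal \<mm> A" using assms(2) by (auto simp: local_ring_def)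
  interpret A: noetherian_cring A by (rule noetherian_cring.intro [OF assms(1) cr])
  have m: "ideal \<mm> A" using max by (rule maximalideal.axioms)
  have I: "ideal I A" and rad: "radical_of A I = \<mm>"
    using assms(5) by (auto simp: primary_to_def primary_ideal_def)
  have Im: "I \<subseteq> \<mm>"
  proof
    fix a assume a: "a \<in> I"
    then have "a [^]\<^bsub>A\<^esub> (1::nat) \<in> I" "a \<in> carrier A" using ideal.Icarr [OF I] by simp_all
    then show "a \<in> \<mm>" unfolding rad [symmetric] radical_of_def by (auto intro!: exI [of _ "1::nat"])
  qed
  let ?P = "ideal_pow A I"
  let ?QG = "\<lambda>n. ?P (Suc n)" and ?QF = "\<lambda>n. \<mm> \<cdot>\<^bsub>A\<^esub> ?P n"
  interpret G: graded_quot A ?P ?QG by (rule A.graded_quot_assoc_graded [OF I])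
  interpret F: graded_quot A ?P ?QF by (rule A.graded_quot_fiber [OF I m])
  have PS: "?P (Suc n) = ?P 1 \<cdot>\<^bsub>A\<^esub> ?P n" for n
    using A.ideal_pow_add [OF I, of 1 n] by (simp only: plus_1_eq_Suc)
  \<comment> \<open>The relation \<open>I^n0 = \<mm> I^(n0-1)\<close> multiplied by
    \<open>I^j\<close>.\<close>
  have eq: "?QG k = ?QF k" if "k \<ge> n0 - 1" for k
  proof -
    define j where "j = k - (n0 - 1)"
    have k: "k = (n0 - 1) + j" "Suc k = n0 + j" using that assms(7) by (auto simp: j_def)
    have "?P (Suc k) = (\<mm> \<cdot>\<^bsub>A\<^esub> ?P (n0 - 1)) \<cdot>\<^bsub>A\<^esub> ?P j"
      unfolding k(2) A.ideal_pow_add [OF I] assms(8) ..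
    also have "\<dots> = \<mm> \<cdot>\<^bsub>A\<^esub> ?P k"
      unfolding k(1) A.ideal_pow_add [OF I]
      by (rule A.ideal_prod_assoc [OF m A.ideal_pow_ideal [OF I] A.ideal_pow_ideal [OF I]])
    finally show ?thesis .
  qed
  have sub: "?QG k \<subseteq> ?QF k" for k
    unfolding PS A.ideal_pow_1 [OF I] using Im by (rule ideal_prod_mono)
  obtain x where x: "x \<in> I" "x \<in> carrier A" "\<And>a. a \<in> carrier A \<Longrightarrow> x \<otimes>\<^bsub>A\<^esub> a = \<zero>\<^bsub>A\<^esub> \<Longrightarrow> a = \<zero>\<^bsub>A\<^esub>"
    using A.grade_pos_regular [OF assms(6)] by blast
  obtain B where B: "B \<subseteq> carrier A" "finite B" "I = genideal A B" using A.finetely_gen [OF I] by blast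
  \<comment> \<open>The regular element joins the generators, because
    \<open>gr_vanishes_0_if_1\<close> needs a regular \<open>y i0\<close>.\<close>
  obtain ys where ys: "set ys = insert x B" using B(2) finite_list [of "insert x B"] by auto
  have "B \<subseteq> I" using A.genideal_self [OF B(1)] B(3) by simp
  then have ysI: "set ys \<subseteq> I" using ys x(1) by simp
  have Igen: "I = genideal A (set ys)"
  proof
    have "genideal A B \<subseteq> genideal A (set ys)"
      using A.genideal_self [of "set ys"] ys B(1) x(2)
      by (intro A.genideal_minimal A.genideal_ideal) auto
    then show "I \<subseteq> genideal A (set ys)" using B(3) by simp
    show "genideal A (set ys) \<subseteq> I" using I ysI by (rule A.genideal_minimal)
  qed
  define y where "y = (!) ys"
  define U where "U = {..<length ys}"
  have yI: "y \<in> U \<rightarrow> I" using ysI by (auto simp: y_def U_def)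
  have y1: "y i \<in> ?P 1" if "i \<in> U" for i using yI that unfolding A.ideal_pow_1 [OF I] by blast
  have finU: "finite U" by (simp add: U_def)
  have "x \<in> set ys" using ys by simp
  then obtain i0 where i0: "i0 \<in> U" "y i0 = x" unfolding y_def U_def in_set_conv_nth by blast
  have gens: "set ys \<subseteq> ?P 1" "?P 1 = genideal A (set ys)"
    using ysI Igen unfolding A.ideal_pow_1 [OF I] by auto
  define VG where "VG = quot_vanishes A ?P ?QG y U"
  define VF where "VF = quot_vanishes A ?P ?QF y U"
  define aG where "aG p = Sup {ereal (real_of_int n) | n. \<not> VG p n}" for p
  define aF where "aF p = Sup {ereal (real_of_int n) | n. \<not> VF p n}" for p
  have aG: "a_invariant (assoc_graded_ring A I) (self_module (assoc_graded_ring A I)) p = aG p" for p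
    unfolding assoc_graded_ring_def aG_def VG_def y_def U_def by (rule G.a_invariant_quot [OF gens PS])
  have aF: "a_invariant (fiber_cone A \<mm> I) (self_module (fiber_cone A \<mm> I)) p = aF p" for p
    unfolding fiber_cone_def aF_def VF_def y_def U_def by (rule F.a_invariant_quot [OF gens PS])
  note gG = A.graded_quot_assoc_graded [OF I] and gF = A.graded_quot_fiber [OF I m]
  have GF: "VG p n \<Longrightarrow> VF p n" if "p \<ge> 1 \<or> zext A ?QG n \<subseteq> zext A ?QF n" for p n
    unfolding VG_def VF_def by (rule quot_vanishes_compare [OF gG gF eq finU y1 that])
  have FG: "VF p n \<Longrightarrow> VG p n" if "p \<ge> 1 \<or> zext A ?QF n \<subseteq> zext A ?QG n" for p n
    unfolding VG_def VF_def by (rule quot_vanishes_compare [OF gF gG eq [symmetric] finU y1 that])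
  have zsub: "zext A ?QG n \<subseteq> zext A ?QF n" for n
    unfolding zext_def using sub [of "nat n"] by (cases "n \<ge> 0") simp_all
  \<comment> \<open>Since \<open>I \<subseteq> \<mm>\<close>, vanishing passes from G(I) to F(I) in
    every degree. For \<open>p = 0\<close> the converse is obtained through \<open>FG\<close> only
    where the two quotients agree.\<close>
  have GF0: "VG p n \<Longrightarrow> VF p n" for p n
    by (rule GF) (use zsub in blast)+
  have pos: "aF p = aG p" if "p \<ge> 1" for p
  proof -
    have "VF p n \<longleftrightarrow> VG p n" for n using GF FG that by blast
    then show ?thesis by (simp add: aF_def aG_def)
  qed
  have le0: "aF p \<le> aG p" for p
    unfolding aF_def aG_def by (rule Sup_subset_mono) (use GF0 in blast)
  define rF where "rF = (SUP i. aF i + ereal (real i))"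
  define rG where "rG = (SUP i. aG i + ereal (real i))"
  have "rF \<le> rG"
    unfolding rF_def rG_def by (rule SUP_mono) (use le0 in \<open>auto intro: add_right_mono\<close>)
  have rF_ge: "ereal (real_of_int k) + ereal (real p) \<le> rF" if "\<not> VF p k" for p k
  proof -
    have "ereal (real_of_int k) \<le> aF p" unfolding aF_def by (rule Sup_upper) (use that in blast)
    then have "ereal (real_of_int k) + ereal (real p) \<le> aF p + ereal (real p)" by (rule add_right_mono)
    also have "\<dots> \<le> rF" unfolding rF_def by (rule SUP_upper) simp
    finally show ?thesis .
  qed
  \<comment> \<open>Only the term \<open>p = 0\<close> of \<open>rG\<close> is not already a term of
    \<open>rF\<close>.\<close>
  have aG0: "aG 0 \<le> rF"
    unfolding aG_def
  proof (rule Sup_least)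
    fix z assume "z \<in> {ereal (real_of_int n) | n. \<not> VG 0 n}"
    then obtain k where k: "z = ereal (real_of_int k)" "\<not> VG 0 k" by blast
    have "k \<ge> 0"
    proof (rule ccontr)
      assume "\<not> k \<ge> 0"
      then have "VG 0 k" unfolding VG_def by (intro A.quot_vanishes_negative finU) simp
      then show False using k(2) by simp
    qed
    then obtain n where n: "k = int n" using nonneg_int_cases by blast
    show "z \<le> rF"
    proof (rule ccontr)
      assume "\<not> z \<le> rF"
      then have less: "rF < ereal (real n)" using k(1) n by simp
      \<comment> \<open>\<open>rF\<close> bounds \<open>l + p\<close> for every nonzero group, so
        all cohomology of F(I) vanishes in the degrees from \<open>n\<close> on.\<close>
      have VF: "VF p (int l)" if "l \<ge> n" for p l
      proof (rule ccontr)
        assume "\<not> VF p (int l)"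
        then have "ereal (real_of_int (int l)) + ereal (real p) \<le> rF" by (rule rF_ge)
        moreover have "ereal (real n) \<le> ereal (real_of_int (int l)) + ereal (real p)" using that by simp
        ultimately show False using less by (meson leD order_trans)
      qed
      have "VG 0 (int n)"
        unfolding VG_def
      proof (rule A.gr_vanishes_0_if_1 [OF I finU yI i0(1)])
        show "a = \<zero>\<^bsub>A\<^esub>" if "a \<in> carrier A" "y i0 \<otimes>\<^bsub>A\<^esub> a = \<zero>\<^bsub>A\<^esub>" for a
          using x(3) that unfolding i0(2) by blast
        show "quot_vanishes A ?P ?QG y U 1 (int l)" if "l > n" for l
          using FG [of 1 "int l"] VF [of l 1] that unfolding VG_def by simp
        \<comment> \<open>The bound \<open>max n (n0 - 1)\<close> combines two thresholds: from
          \<open>n\<close> on the cohomology of F(I) vanishes, and from \<open>n0 - 1\<close> on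
          vanishing of \<open>H^0\<close> transfers back to G(I).\<close>
        show "quot_vanishes A ?P ?QG y U 0 (int l)" if "l \<ge> max n (n0 - 1)" for l
        proof -
          have "zext A ?QF (int l) \<subseteq> zext A ?QG (int l)"
            using eq [of l] that unfolding A.zext_int by (simp only: max.bounded_iff order_refl)
          then show ?thesis using FG [of 0 "int l"] VF [of l 0] that unfolding VG_def by simp
        qed
      qed
      then show False using k(2) n by simp
    qed
  qed
  have "rG \<le> rF"
    unfolding rG_def
  proof (rule SUP_least)
    fix i
    show "aG i + ereal (real i) \<le> rF"
    proof (cases "i = 0")
      case True
      then show ?thesis using aG0 by simp
    next
      case False
      then have e: "aG i = aF i" using pos [of i] by simp
      show ?thesis unfolding rF_def e by (rule SUP_upper) simp
    qed
  qed
  with \<open>rF \<le> rG\<close> have "rF = rG" by (rule antisym)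
  then show ?thesis unfolding regularity_def aG aF rF_def rG_def .
qed

end
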